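(* Let $E$ be an infinite-dimensional closed commutative ${}^*$-subalgebra of $\mathcal{L}(s',s)$ and let $\big(\sum_{j\in\mathcal{N}_k}\langle\cdot,f_j\rangle f_j\big)_{k\in\mathbb{N}}$ be its canonical Schauder basis, where $(f_j)_{j\in\mathbb{N}}\subset s$ is an orthonormal sequence and $(\mathcal{N}_k)_{k\in\mathbb{N}}$ is a family of finite nonempty pairwise disjoint subsets of $\mathbb{N}$. Then the following assertions are equivalent: (i) $E$ is isomorphic as a Fr\'echet ${}^*$-algebra to some closed ${}^*$-subalgebra of $s$; (ii) $E$ is isomorphic as a Fr\'echet space to some complemented subspace of $s$; (iii) $E$ has the property $(\Omega)$; (iv) there is $p\in\mathbb{N}_0$ such that for every $q\in\mathbb{N}_0$ there are $r\in\mathbb{N}_0$ and $C>0$ such that for all $k\in\mathbb{N}$ $$\max_{j\in\mathcal{N}_k}|f_j|_q\leq C\max_{j\in\mathcal{N}_k}|f_j|_p^r.$$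
   Context: $\mathbb{N}=\{1,2,\dots\}$, $\mathbb{N}_0=\mathbb{N}\cup\{0\}$; all spaces are over $\mathbb{C}$. A Fr\'echet ${}^*$-algebra is a Fr\'echet space (complete metrizable locally convex space) that is an algebra with continuous multiplication and continuous involution; an isomorphism of Fr\'echet ${}^*$-algebras is an algebra ${}^*$-isomorphism that is also a homeomorphism. The space $s$: $s=\{\xi=(\xi_j)_{j\in\mathbb{N}}\in\mathbb{C}^{\mathbb{N}}:|\xi|_q:=(\sum_{j=1}^\infty|\xi_j|^2j^{2q})^{1/2}<\infty\text{ for all }q\in\mathbb{N}_0\}$, with the topology of the norms $(|\cdot|_q)_{q\in\mathbb{N}_0}$; it is a Fr\'echet ${}^*$-algebra with pointwise multiplication and pointwise complex conjugation. Its strong dual is identified with $s'=\{\xi\in\mathbb{C}^{\mathbb{N}}:|\xi|_q':=(\sum_{j=1}^\infty|\xi_j|^2j^{-2q})^{1/2}<\infty\text{ for some }q\in\mathbb{N}_0\}$ (with inductive limit topology) via $\langle\xi,\eta\rangle=\sum_j\xi_j\overline{\eta_j}$, which is defined on $s\times s'\cup s'\times s$ and on $\ell_2\times\ell_2$. The algebra $\mathcal{L}(s',s)$: all continuous linear operators $s'\to s$, with the topology of uniform convergence on bounded sets of $s'$, given by the norms $\|x\|_q:=\sup_{|\xi|_q'\leq1}|x\xi|_q$, $q\in\mathbb{N}_0$. Since $s\subset\ell_2\subset s'$ continuously and densely, each $x\in\mathcal{L}(s',s)$ is identified with the bounded operator on $\ell_2$ it induces; multiplication is composition and the involution is the Hilbert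 space adjoint. With these operations $\mathcal{L}(s',s)$ is a Fr\'echet ${}^*$-algebra. Projections are orthogonal (self-adjoint idempotent) operators on $\ell_2$. A projection belongs to $\mathcal{L}(s',s)$ iff it has the form $\sum_{k\in I}\langle\cdot,f_k\rangle f_k$ with $I$ finite and $(f_k)_{k\in I}\subset s$ orthonormal (in $\ell_2$). For an infinite-dimensional closed commutative ${}^*$-subalgebra $E$ of $\mathcal{L}(s',s)$, the nonzero minimal projections of $E$ (nonzero projections $P\in E$ such that no nonzero projection $Q\in E$, $Q\ne P$, satisfies $QP=Q$) are pairwise orthogonal and form a Schauder basis of $E$; this is called the canonical Schauder basis of $E$. A subspace $F$ of a Fr\'echet space $X$ is complemented if there is a continuous linear projection $\pi:X\to X$ with image $F$. A Fr\'echet space $X$ with a fundamental sequence $(\|\cdot\|_q)_{q\in\mathbb{N}_0}$ of seminorms has the property $(\Omega)$ if $$\forall p\;\exists q\;\forall r\;\exists\theta\in(0,1)\;\exists C>0\;\forall y\in X'\quad \|y\|_q'\leq C(\|y\|_p')^{1-\theta}(\|y\|_r')^{\theta},$$ where $p,q,r\in\mathbb{N}_0$, $X'$ is the topological dual of $X$ and $\|y\|_p':=\sup\{|y(x)|:\|x\|_p\leq1\}\in[0,\infty]$. *)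

theory Defs
  imports "HOL-Analysis.Analysis" "HOL-Library.Function_Algebras"
begin

text \<open>
  Complex vector spaces.  Addition on function types is the pointwise one of
  \<^theory>\<open>HOL-Library.Function_Algebras\<close>; below, scalar multiplication is pointwise as well, so that
  scalar sequences and operators between sequence spaces become instances at once.
\<close>

class complex_vector = ab_group_add +
  fixes scaleC :: "complex \<Rightarrow> 'a \<Rightarrow> 'a"  (infixr "*\<^sub>C" 75)
  assumes scaleC_add_right: "a *\<^sub>C (x + y) = a *\<^sub>C x + a *\<^sub>C y"
    and scaleC_add_left: "(a + b) *\<^sub>C x = a *\<^sub>C x + b *\<^sub>C x"
    and scaleC_scaleC: "a *\<^sub>C b *\<^sub>C x = (a * b) *\<^sub>C x"
    and scaleC_one: "1 *\<^sub>C x = x"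

global_interpretation cvec: vector_space "scaleC :: complex \<Rightarrow> 'a \<Rightarrow> 'a::complex_vector"
  by unfold_locales (simp_all add: scaleC_add_right scaleC_add_left scaleC_scaleC scaleC_one)

instantiation complex :: complex_vector
begin
definition scaleC_complex :: "complex \<Rightarrow> complex \<Rightarrow> complex"
  where "scaleC_complex c z = c * z"
instance by standard (simp_all add: scaleC_complex_def algebra_simps)
end

instantiation "fun" :: (type, complex_vector) complex_vector
begin
definition scaleC_fun :: "complex \<Rightarrow> ('a \<Rightarrow> 'b) \<Rightarrow> 'a \<Rightarrow> 'b"
  where "scaleC_fun c f = (\<lambda>x. c *\<^sub>C f x)"
instance
  by standard
    (simp_all add: scaleC_fun_def fun_eq_iff scaleC_add_right scaleC_add_left scaleC_scaleC scaleC_one)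
end

definition clinear_on :: "'a::complex_vector set \<Rightarrow> ('a \<Rightarrow> 'b::complex_vector) \<Rightarrow> bool" where
  "clinear_on V f \<longleftrightarrow>
     (\<forall>x\<in>V. \<forall>y\<in>V. f (x + y) = f x + f y) \<and> (\<forall>c. \<forall>x\<in>V. f (c *\<^sub>C x) = c *\<^sub>C f x)"

definition infinite_dim :: "'a::complex_vector set \<Rightarrow> bool" where
  "infinite_dim V \<longleftrightarrow> \<not> (\<exists>B. finite B \<and> V \<subseteq> cvec.span B)"


text \<open>
  Locally convex spaces: a carrier \<open>V\<close> together with a nonempty set \<open>P\<close> of seminorms.  The
  topology has the \<open>P\<close>-balls around points of \<open>V\<close> as a subbase.
\<close>

definition seminorm_on :: "'a::complex_vector set \<Rightarrow> ('a \<Rightarrow> real) \<Rightarrow> bool" where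
  "seminorm_on V p \<longleftrightarrow>
     (\<forall>x\<in>V. 0 \<le> p x) \<and> (\<forall>x\<in>V. \<forall>y\<in>V. p (x + y) \<le> p x + p y) \<and>
     (\<forall>c. \<forall>x\<in>V. p (c *\<^sub>C x) = cmod c * p x)"

definition seminorm_topology :: "'a::complex_vector set \<Rightarrow> ('a \<Rightarrow> real) set \<Rightarrow> 'a topology" where
  "seminorm_topology V P =
     topology_generated_by {{y \<in> V. p (y - x) < e} |p x e. p \<in> P \<and> x \<in> V \<and> 0 < e}"

definition frechet_iso ::
  "'a::complex_vector topology \<Rightarrow> 'a set \<Rightarrow> 'b::complex_vector topology \<Rightarrow> 'b set \<Rightarrow> ('a \<Rightarrow> 'b) \<Rightarrow> bool"
  where "frechet_iso T A U B \<phi> \<longleftrightarrow>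
     clinear_on A \<phi> \<and> homeomorphic_map (subtopology T A) (subtopology U B) \<phi>"

definition frechet_star_iso ::
  "'a::complex_vector topology \<Rightarrow> ('a \<Rightarrow> 'a \<Rightarrow> 'a) \<Rightarrow> ('a \<Rightarrow> 'a) \<Rightarrow> 'a set \<Rightarrow>
   'b::complex_vector topology \<Rightarrow> ('b \<Rightarrow> 'b \<Rightarrow> 'b) \<Rightarrow> ('b \<Rightarrow> 'b) \<Rightarrow> 'b set \<Rightarrow> ('a \<Rightarrow> 'b) \<Rightarrow> bool"
  where "frechet_star_iso T mulA starA A U mulB starB B \<phi> \<longleftrightarrow>
     frechet_iso T A U B \<phi> \<and>
     (\<forall>x\<in>A. \<forall>y\<in>A. \<phi> (mulA x y) = mulB (\<phi> x) (\<phi> y)) \<and>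
     (\<forall>x\<in>A. \<phi> (starA x) = starB (\<phi> x))"

definition closed_star_subalgebra ::
  "'a::complex_vector topology \<Rightarrow> ('a \<Rightarrow> 'a \<Rightarrow> 'a) \<Rightarrow> ('a \<Rightarrow> 'a) \<Rightarrow> 'a set \<Rightarrow> bool"
  where "closed_star_subalgebra T mul star B \<longleftrightarrow>
     cvec.subspace B \<and> (\<forall>x\<in>B. \<forall>y\<in>B. mul x y \<in> B) \<and> (\<forall>x\<in>B. star x \<in> B) \<and> closedin T B"

definition complemented_in :: "'a::complex_vector topology \<Rightarrow> 'a set \<Rightarrow> bool" where
  "complemented_in T F \<longleftrightarrow>
     (\<exists>\<pi>. clinear_on (topspace T) \<pi> \<and> continuous_map T T \<pi> \<and>
          (\<forall>x\<in>topspace T. \<pi> (\<pi> x) = \<pi> x) \<and> \<pi> ` topspace T = F)"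

definition schauder_basis ::
  "'a::complex_vector topology \<Rightarrow> 'a set \<Rightarrow> (nat \<Rightarrow> 'a) \<Rightarrow> bool" where
  "schauder_basis T A b \<longleftrightarrow>
     (\<forall>k. b k \<in> A) \<and>
     (\<forall>x\<in>A. \<exists>!c. limitin (subtopology T A) (\<lambda>n. \<Sum>k<n. c k *\<^sub>C b k) x sequentially)"


text \<open>
  The property \<open>(\<Omega>)\<close> of the space \<open>V\<close> whose topology is given by the sequence \<open>nrm\<close> of seminorms.
  Dual norms take values in \<open>[0,\<infinity>]\<close>.  If one of the factors on the right-hand side of the
  inequality vanishes then the functional is \<open>0\<close>, hence \<open>0 * \<infinity>\<close> does not occur there.
\<close>

definition top_dual :: "'a::complex_vector set \<Rightarrow> (nat \<Rightarrow> 'a \<Rightarrow> real) \<Rightarrow> ('a \<Rightarrow> complex) set" where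
  "top_dual V nrm =
     {y. clinear_on V y \<and> continuous_map (seminorm_topology V (range nrm)) euclidean y}"

definition dual_norm :: "'a set \<Rightarrow> ('a \<Rightarrow> real) \<Rightarrow> ('a \<Rightarrow> complex) \<Rightarrow> ennreal" where
  "dual_norm V p y = (SUP x\<in>{x\<in>V. p x \<le> 1}. ennreal (cmod (y x)))"

text \<open>Powers with exponent \<open>a > 0\<close> on \<open>[0,\<infinity>]\<close>.\<close>

definition ennreal_powr :: "ennreal \<Rightarrow> real \<Rightarrow> ennreal" where
  "ennreal_powr t a = (if t = \<infinity> then \<infinity> else ennreal (enn2real t powr a))"

definition property_Omega :: "'a::complex_vector set \<Rightarrow> (nat \<Rightarrow> 'a \<Rightarrow> real) \<Rightarrow> bool" where
  "property_Omega V nrm \<longleftrightarrow>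
     (\<forall>p. \<exists>q. \<forall>r. \<exists>\<theta>::real. 0 < \<theta> \<and> \<theta> < 1 \<and> (\<exists>C::real. 0 < C \<and>
        (\<forall>y\<in>top_dual V nrm.
           dual_norm V (nrm q) y \<le>
             ennreal C * ennreal_powr (dual_norm V (nrm p) y) (1 - \<theta>)
                       * ennreal_powr (dual_norm V (nrm r) y) \<theta>)))"


text \<open>
  Sequences indexed by \<open>{1,2,...}\<close> are represented with a shift: the value at \<open>j :: nat\<close> is the
  \<open>(j+1)\<close>-st coordinate and therefore carries the weight \<open>Suc j\<close>.
\<close>

type_synonym cseq = "nat \<Rightarrow> complex"

definition s_norm :: "nat \<Rightarrow> cseq \<Rightarrow> real" where
  "s_norm q \<xi> = sqrt (\<Sum>j. (cmod (\<xi> j))\<^sup>2 * real (Suc j) ^ (2 * q))"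

definition s_space :: "cseq set" where
  "s_space = {\<xi>. \<forall>q. summable (\<lambda>j. (cmod (\<xi> j))\<^sup>2 * real (Suc j) ^ (2 * q))}"

definition s_top :: "cseq topology" where
  "s_top = seminorm_topology s_space (range s_norm)"

definition s_mult :: "cseq \<Rightarrow> cseq \<Rightarrow> cseq" where
  "s_mult \<xi> \<eta> = (\<lambda>j. \<xi> j * \<eta> j)"

definition s_star :: "cseq \<Rightarrow> cseq" where
  "s_star \<xi> = (\<lambda>j. cnj (\<xi> j))"

definition s'_norm :: "nat \<Rightarrow> cseq \<Rightarrow> real" where
  "s'_norm q \<xi> = sqrt (\<Sum>j. (cmod (\<xi> j))\<^sup>2 / real (Suc j) ^ (2 * q))"

definition s'_step :: "nat \<Rightarrow> cseq set" where
  "s'_step q = {\<xi>. summable (\<lambda>j. (cmod (\<xi> j))\<^sup>2 / real (Suc j) ^ (2 * q))}"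

definition s'_space :: "cseq set" where
  "s'_space = (\<Union>q. s'_step q)"

text \<open>
  The locally convex inductive limit topology of the steps: it is generated by all seminorms whose
  restriction to each of the Hilbert spaces \<open>s'_step q\<close> is continuous.
\<close>

definition s'_top :: "cseq topology" where
  "s'_top = seminorm_topology s'_space
     {p. seminorm_on s'_space p \<and> (\<forall>q. \<exists>C. \<forall>\<xi>\<in>s'_step q. p \<xi> \<le> C * s'_norm q \<xi>)}"

definition ell2 :: "cseq set" where
  "ell2 = {\<xi>. summable (\<lambda>j. (cmod (\<xi> j))\<^sup>2)}"

definition pairing :: "cseq \<Rightarrow> cseq \<Rightarrow> complex" where
  "pairing \<xi> \<eta> = (\<Sum>j. \<xi> j * cnj (\<eta> j))"

definition orthonormal_seq :: "(nat \<Rightarrow> cseq) \<Rightarrow> bool" where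
  "orthonormal_seq f \<longleftrightarrow>
     (\<forall>i. f i \<in> ell2) \<and> (\<forall>i j. pairing (f i) (f j) = (if i = j then 1 else 0))"


text \<open>
  The continuous linear operators from \<open>s'\<close> to \<open>s\<close>, extended by \<open>0\<close> outside \<open>s'\<close> to total
  functions.  Because \<open>s \<subseteq> s'\<close>, the product of two such operators is plain composition \<open>(\<circ>)\<close>.
\<close>

type_synonym cseq_op = "cseq \<Rightarrow> cseq"

definition L_space :: "cseq_op set" where
  "L_space = {x. clinear_on s'_space x \<and> continuous_map s'_top s_top x \<and> (\<forall>\<xi>. \<xi> \<notin> s'_space \<longrightarrow> x \<xi> = 0)}"

definition L_norm :: "nat \<Rightarrow> cseq_op \<Rightarrow> real" where
  "L_norm q x = (SUP \<xi>\<in>{\<xi> \<in> s'_step q. s'_norm q \<xi> \<le> 1}. s_norm q (x \<xi>))"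

definition L_top :: "cseq_op topology" where
  "L_top = seminorm_topology L_space (range L_norm)"

text \<open>
  The Hilbert space adjoint of the operator induced on \<open>\<ell>\<^sub>2\<close>, again viewed as an operator from \<open>s'\<close>
  to \<open>s\<close>; it is unique since \<open>\<ell>\<^sub>2\<close> is dense in \<open>s'\<close>.
\<close>

definition L_star :: "cseq_op \<Rightarrow> cseq_op" where
  "L_star x = (THE y. y \<in> L_space \<and> (\<forall>\<xi>\<in>ell2. \<forall>\<eta>\<in>ell2. pairing (x \<xi>) \<eta> = pairing \<xi> (y \<eta>)))"

definition is_projection :: "cseq_op \<Rightarrow> bool" where
  "is_projection P \<longleftrightarrow> P \<in> L_space \<and> P \<circ> P = P \<and> L_star P = P"

definition minimal_projections :: "cseq_op set \<Rightarrow> cseq_op set" where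
  "minimal_projections E =
     {P \<in> E. is_projection P \<and> P \<noteq> 0 \<and>
        \<not> (\<exists>Q\<in>E. is_projection Q \<and> Q \<noteq> 0 \<and> Q \<noteq> P \<and> Q \<circ> P = Q)}"

text \<open>Enumerations of the nonzero minimal projections which are Schauder bases.\<close>

definition canonical_schauder_basis :: "cseq_op set \<Rightarrow> (nat \<Rightarrow> cseq_op) \<Rightarrow> bool" where
  "canonical_schauder_basis E b \<longleftrightarrow>
     bij_betw b UNIV (minimal_projections E) \<and> schauder_basis L_top E b"

text \<open>The operator \<open>\<Sum>j\<in>J. \<langle>\<cdot>, f j\<rangle> f j\<close> for \<open>f j\<close> in \<open>s\<close>.\<close>

definition span_projection :: "(nat \<Rightarrow> cseq) \<Rightarrow> nat set \<Rightarrow> cseq_op" where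
  "span_projection f J = (\<lambda>\<xi>. if \<xi> \<in> s'_space then \<Sum>j\<in>J. pairing \<xi> (f j) *\<^sub>C f j else 0)"


text \<open>
  The topology used for the dual in the definition of \<open>(\<Omega>)\<close> is the subspace topology.
\<close>

lemma subtopology_seminorm_topology:
  assumes A: "cvec.subspace A" and "A \<subseteq> V" and V: "cvec.subspace V"
    and P: "\<And>p. p \<in> P \<Longrightarrow> seminorm_on V p"
  shows "subtopology (seminorm_topology V P) A = seminorm_topology A P"
proof -
  let ?B = "\<lambda>V. {{y \<in> V. p (y - x) < e} |p x e. p \<in> P \<and> x \<in> V \<and> 0 < e}"
  have dist: "p (y - x) \<le> p (y - z) + p (z - x)"
    if "p \<in> P" "x \<in> V" "y \<in> V" "z \<in> V" for p x y z
  proof -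
    have "y - z \<in> V" "z - x \<in> V" using that V by (auto intro: cvec.subspace_diff)
    moreover have "y - x = (y - z) + (z - x)" by simp
    ultimately show ?thesis using P[OF that(1)] by (metis seminorm_on_def)
  qed
  have zero: "p (x - x) = 0" if "p \<in> P" for p x
  proof -
    have "p (0 *\<^sub>C 0) = cmod 0 * p 0"
      using P[OF that] cvec.subspace_0[OF V] unfolding seminorm_on_def by blast
    then show ?thesis by simp
  qed
  have 1: "openin (seminorm_topology A P) (A \<inter> {y \<in> V. p (y - x) < e})"
    if "p \<in> P" "x \<in> V" "0 < e" for p x e
  proof (subst openin_subopen, intro ballI)
    fix z assume z: "z \<in> A \<inter> {y \<in> V. p (y - x) < e}"
    let ?T = "{y \<in> A. p (y - z) < e - p (z - x)}"
    have "openin (seminorm_topology A P) ?T"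
      unfolding seminorm_topology_def openin_topology_generated_by_iff
    proof (rule generate_topology_on.Basis)
      show "?T \<in> ?B A" using z that by (intro CollectI exI[of _ p] exI[of _ z] exI[of _ "e - p (z - x)"]) auto
    qed
    moreover have "z \<in> ?T" using z zero[OF that(1)] by auto
    moreover have "?T \<subseteq> A \<inter> {y \<in> V. p (y - x) < e}"
    proof
      fix y assume y: "y \<in> ?T"
      then have "y \<in> V" using \<open>A \<subseteq> V\<close> by auto
      then show "y \<in> A \<inter> {y \<in> V. p (y - x) < e}"
        using dist[OF that(1,2), of y z] z y by auto
    qed
    ultimately show "\<exists>T. openin (seminorm_topology A P) T \<and> z \<in> T \<and> T \<subseteq> A \<inter> {y \<in> V. p (y - x) < e}"
      by blast
  qed
  have 2: "openin (seminorm_topology A P) (A \<inter> U)"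
    if "generate_topology_on (?B V) U" for U
    using that
  proof induction
    case Empty show ?case by simp
  next
    case (Int a b)
    have "A \<inter> (a \<inter> b) = (A \<inter> a) \<inter> (A \<inter> b)" by auto
    then show ?case using Int by auto
  next
    case (UN K)
    have eq: "A \<inter> \<Union>K = \<Union>((\<inter>) A ` K)" by auto
    show ?case unfolding eq using UN by (intro openin_Union) auto
  next
    case (Basis s)
    then show ?case using 1 by auto
  qed
  have 3: "openin (subtopology (seminorm_topology V P) A) U"
    if "generate_topology_on (?B A) U" for U
    using that
  proof induction
    case (Basis s)
    then obtain p x e where s: "s = {y \<in> A. p (y - x) < e}" "p \<in> P" "x \<in> A" "0 < e" by auto
    have "openin (seminorm_topology V P) {y \<in> V. p (y - x) < e}"
      unfolding seminorm_topology_def openin_topology_generated_by_iff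
      using s \<open>A \<subseteq> V\<close> by (intro generate_topology_on.Basis) blast
    moreover have "s = {y \<in> V. p (y - x) < e} \<inter> A" using s \<open>A \<subseteq> V\<close> by auto
    ultimately show ?case unfolding openin_subtopology by blast
  qed auto
  show ?thesis
    unfolding topology_eq
  proof (intro allI iffI)
    fix S assume "openin (subtopology (seminorm_topology V P) A) S"
    then obtain U where "openin (seminorm_topology V P) U" "S = A \<inter> U"
      unfolding openin_subtopology by (auto simp: Int_commute)
    then show "openin (seminorm_topology A P) S"
      using 2 unfolding seminorm_topology_def openin_topology_generated_by_iff by blast
  next
    fix S assume "openin (seminorm_topology A P) S"
    then show "openin (subtopology (seminorm_topology V P) A) S"
      using 3 unfolding seminorm_topology_def openin_topology_generated_by_iff by blast
  qed
qed

end

theory Submission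
  imports Defs "HOL-Library.Nat_Bijection"
begin

text \<open>
  Write \<open>a q k\<close> for the largest value of \<open>s_norm q (f j)\<close> with
  \<open>j \<in> N k\<close>. The algebra \<open>E\<close> is the Koethe sequence space of the weights
  \<open>a q\<close>. An element \<open>x\<close> of \<open>E\<close> acts on all \<open>f j\<close> of
  the \<open>k\<close>-th block as one scalar \<open>coef x k\<close>; algebra operations and adjoints
  become pointwise operations on these scalars, and \<open>L_norm q x\<close> is comparable with the
  supremum of \<open>\<bar>coef x k\<bar> * a q k\<close> up to a change of \<open>q\<close>. The lower
  estimate holds because each \<open>f j\<close> lies in the unit ball of every step of
  \<open>s'\<close>. The upper estimate needs summability over \<open>k\<close>, and this comes from a
  counting argument: by Bessel's inequality at most a multiple of \<open>R\<close> vectors of an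
  orthonormal sequence have \<open>s_norm 1\<close> at most \<open>R\<close>
  (\<open>orthonormal_card_le\<close>), so suprema against a larger weight control sums against a
  smaller one (\<open>coefficient_sum_bound\<close>). The same count bounds the ranks of the
  projections.

  Since \<open>s_norm 0 (f j) = 1\<close>, the Cauchy-Schwarz inequality gives
  \<open>(a q k)\<^sup>2 \<le> a (2 * q) k\<close>. Hence powers of one weight are always dominated by
  later weights; the polynomial condition on the \<open>f j\<close> says that conversely all weights are
  dominated by powers of a single weight \<open>b = a p\<close>. Under this condition the topology of
  \<open>E\<close> is therefore given by the powers of \<open>b\<close> alone. The counting argument
  allows an injective renumbering \<open>m\<close> of the blocks for which \<open>b k\<close> and
  \<open>m k\<close> are polynomially comparable (\<open>polynomial_relabelling\<close>), and then
  \<open>E\<close> is the algebra of all sequences in \<open>s\<close> supported on the range of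
  \<open>m\<close>. This is both a closed \<open>*\<close>-subalgebra and the range of a coordinate
  projection, so the polynomial condition implies the two statements on embeddings into
  \<open>s\<close>.

  Conversely, a \<open>*\<close>-isomorphism onto a subalgebra of \<open>s\<close> sends the basis
  projections to idempotents of \<open>s\<close>. These are indicators of sets, and for them every norm
  is at most a power of the first one (\<open>s_norm_idempotent_le\<close>); pulled back to
  \<open>E\<close> this is the polynomial condition. An isomorphism onto a complemented subspace gives
  \<open>(\<Omega>)\<close>, because \<open>s\<close> has this property, by splitting a sequence at a
  suitable index (\<open>s_functional_interpolation\<close>), and because it passes to retracts
  (\<open>property_Omega_if_retract_of_s\<close>). Finally \<open>(\<Omega>)\<close>, applied with
  \<open>p = 0\<close> to the coordinate functionals of the basis, bounds a positive power of
  \<open>a r k\<close> by a multiple of \<open>a Q k\<close> with \<open>Q\<close> independent of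
  \<open>r\<close>, which is the polynomial condition again.
\<close>


section \<open>Seminorm topologies\<close>

lemma clinear_on_add: "clinear_on V f \<Longrightarrow> x \<in> V \<Longrightarrow> y \<in> V \<Longrightarrow> f (x + y) = f x + f y"
  and clinear_on_scaleC: "clinear_on V f \<Longrightarrow> x \<in> V \<Longrightarrow> f (c *\<^sub>C x) = c *\<^sub>C f x"
  by (auto simp: clinear_on_def)

lemma scaleC_minus_one: "(-1) *\<^sub>C x = - (x :: 'a::complex_vector)"
  by (simp add: cvec.scale_minus_left)

lemma clinear_on_diff:
  assumes "cvec.subspace V" "clinear_on V f" "x \<in> V" "y \<in> V"
  shows "f (x - y) = f x - f y"
proof -
  have "f (x + (-1) *\<^sub>C y) = f x + (-1) *\<^sub>C f y"
    using assms by (metis clinear_on_def cvec.subspace_scale)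
  then show ?thesis by (simp add: scaleC_minus_one)
qed

lemma clinear_on_zero:
  assumes "cvec.subspace V" "clinear_on V f"
  shows "f 0 = 0"
  using clinear_on_diff[OF assms, of 0 0] cvec.subspace_0[OF assms(1)] by simp



lemma seminorm_on_nonneg: "seminorm_on V p \<Longrightarrow> x \<in> V \<Longrightarrow> 0 \<le> p x"
  and seminorm_on_add: "seminorm_on V p \<Longrightarrow> x \<in> V \<Longrightarrow> y \<in> V \<Longrightarrow> p (x + y) \<le> p x + p y"
  and seminorm_on_scaleC: "seminorm_on V p \<Longrightarrow> x \<in> V \<Longrightarrow> p (c *\<^sub>C x) = cmod c * p x"
  by (auto simp: seminorm_on_def)

lemma seminorm_on_minus: "seminorm_on V p \<Longrightarrow> x \<in> V \<Longrightarrow> p (- x) = p x"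
  using seminorm_on_scaleC[of V p x "-1"] by (simp add: scaleC_minus_one)

lemma seminorm_on_minus_commute:
  "cvec.subspace V \<Longrightarrow> seminorm_on V p \<Longrightarrow> x \<in> V \<Longrightarrow> y \<in> V \<Longrightarrow> p (x - y) = p (y - x)"
  using seminorm_on_minus[of V p "x - y"] cvec.subspace_diff[of V x y] by simp

lemma seminorm_on_zero: "cvec.subspace V \<Longrightarrow> seminorm_on V p \<Longrightarrow> p 0 = 0"
  using seminorm_on_scaleC[of V p 0 0] by (simp add: cvec.subspace_0)

lemma seminorm_on_diff_triangle:
  assumes "cvec.subspace V" "seminorm_on V p" "x \<in> V" "y \<in> V" "z \<in> V"
  shows "p (y - x) \<le> p (y - z) + p (z - x)"
proof -
  have "y - z \<in> V" "z - x \<in> V" using assms by (auto intro: cvec.subspace_diff)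
  from seminorm_on_add[OF assms(2) this] show ?thesis by simp
qed

lemma seminorm_on_sum:
  assumes "cvec.subspace V" "seminorm_on V p" "\<And>i. i \<in> I \<Longrightarrow> x i \<in> V"
  shows "p (\<Sum>i\<in>I. x i) \<le> (\<Sum>i\<in>I. p (x i))"
  using assms(3)
proof (induction I rule: infinite_finite_induct)
  case (insert i I)
  then have "p (x i + (\<Sum>i\<in>I. x i)) \<le> p (x i) + p (\<Sum>i\<in>I. x i)"
    by (intro seminorm_on_add[OF assms(2)] cvec.subspace_sum[OF assms(1)]) auto
  then show ?case using insert by force
qed (simp_all add: seminorm_on_zero[OF assms(1,2)])

lemma seminorm_on_subset: "seminorm_on V p \<Longrightarrow> A \<subseteq> V \<Longrightarrow> seminorm_on A p"
  unfolding seminorm_on_def by blast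

locale seminormed_space =
  fixes V :: "'a::complex_vector set" and P :: "('a \<Rightarrow> real) set"
  assumes subspace: "cvec.subspace V"
    and seminorm: "p \<in> P \<Longrightarrow> seminorm_on V p"
    and nonempty: "P \<noteq> {}"
begin

lemma openin_ball: "p \<in> P \<Longrightarrow> x \<in> V \<Longrightarrow> 0 < e \<Longrightarrow> openin (seminorm_topology V P) {y \<in> V. p (y - x) < e}"
  unfolding seminorm_topology_def by (rule topology_generated_by_Basis) blast

lemma centre_in_ball: "p \<in> P \<Longrightarrow> x \<in> V \<Longrightarrow> 0 < e \<Longrightarrow> x \<in> {y \<in> V. p (y - x) < e}"
  using seminorm_on_zero[OF subspace seminorm, of p] by simp

lemma topspace_eq: "topspace (seminorm_topology V P) = V"
proof -
  obtain p where "p \<in> P" using nonempty by blast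
  then have "V \<subseteq> topspace (seminorm_topology V P)"
    using openin_ball[of p _ 1] centre_in_ball[of p _ 1] openin_subset by fastforce
  moreover have "topspace (seminorm_topology V P) \<subseteq> V"
    unfolding seminorm_topology_def topology_generated_by_topspace by auto
  ultimately show ?thesis by blast
qed

lemma openinI:
  assumes "U \<subseteq> V" "\<And>x. x \<in> U \<Longrightarrow> \<exists>p\<in>P. \<exists>e>0. {y \<in> V. p (y - x) < e} \<subseteq> U"
  shows "openin (seminorm_topology V P) U"
proof (subst openin_subopen, intro ballI)
  fix x assume x: "x \<in> U"
  then obtain p e where "p \<in> P" "0 < e" "{y \<in> V. p (y - x) < e} \<subseteq> U" using assms(2) by meson
  with openin_ball[of p x e] centre_in_ball[of p x e] assms(1) x
  show "\<exists>T. openin (seminorm_topology V P) T \<and> x \<in> T \<and> T \<subseteq> U" by (meson subsetD)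
qed

lemma finite_ball_in_open:
  assumes "openin (seminorm_topology V P) U" "x \<in> U"
  shows "\<exists>F e. finite F \<and> F \<subseteq> P \<and> 0 < e \<and> {y \<in> V. \<forall>p\<in>F. p (y - x) < e} \<subseteq> U"
proof -
  have "generate_topology_on {{y \<in> V. p (y - x) < e} |p x e. p \<in> P \<and> x \<in> V \<and> 0 < e} U"
    using assms(1) unfolding seminorm_topology_def openin_topology_generated_by_iff .
  then show ?thesis using assms(2)
  proof induction
    case Empty
    then show ?case by simp
  next
    case (Int a b)
    then obtain F e G d where
      "finite F" "F \<subseteq> P" "0 < e" "{y \<in> V. \<forall>p\<in>F. p (y - x) < e} \<subseteq> a"
      "finite G" "G \<subseteq> P" "0 < d" "{y \<in> V. \<forall>p\<in>G. p (y - x) < d} \<subseteq> b" by auto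
    then show ?case
      by (intro exI[of _ "F \<union> G"] exI[of _ "min e d"]) (simp add: subset_iff)
  next
    case (UN K)
    from UN.prems obtain k where k: "k \<in> K" "x \<in> k" by (rule UnionE)
    from UN.IH[OF this] obtain F e where
      "finite F" "F \<subseteq> P" "0 < e" "{y \<in> V. \<forall>p\<in>F. p (y - x) < e} \<subseteq> k" by (elim exE conjE)
    with k(1) show ?case by (intro exI[of _ F] exI[of _ e] conjI subset_trans[OF _ Union_upper])
  next
    case (Basis s)
    then obtain p z e where s: "s = {y \<in> V. p (y - z) < e}" "p \<in> P" "z \<in> V" "0 < e" by auto
    with Basis have "x \<in> V" "p (x - z) < e" by auto
    moreover have "p (y - z) < e" if "y \<in> V" "p (y - x) < e - p (x - z)" for y
      using seminorm_on_diff_triangle[OF subspace seminorm[OF s(2)] s(3) that(1) \<open>x \<in> V\<close>] that(2) by simp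
    ultimately show ?case
      using s by (intro exI[of _ "{p}"] exI[of _ "e - p (x - z)"]) auto
  qed
qed

lemma limitin_iff:
  assumes "\<And>n. x n \<in> V"
  shows "limitin (seminorm_topology V P) x l sequentially \<longleftrightarrow>
    l \<in> V \<and> (\<forall>p\<in>P. (\<lambda>n. p (x n - l)) \<longlonglongrightarrow> 0)"
proof safe
  assume l: "limitin (seminorm_topology V P) x l sequentially"
  then show lV: "l \<in> V" using limitin_topspace[OF l] by (simp add: topspace_eq)
  fix p assume p: "p \<in> P"
  show "(\<lambda>n. p (x n - l)) \<longlonglongrightarrow> 0"
  proof (rule tendstoI)
    fix e :: real assume "0 < e"
    then have "\<forall>\<^sub>F n in sequentially. x n \<in> {y \<in> V. p (y - l) < e}"
      using l openin_ball[OF p lV \<open>0 < e\<close>] centre_in_ball[OF p lV \<open>0 < e\<close>]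
      unfolding limitin_def by meson
    then show "\<forall>\<^sub>F n in sequentially. dist (p (x n - l)) 0 < e"
    proof eventually_elim
      case (elim n)
      then show ?case
        using seminorm_on_nonneg[OF seminorm[OF p] cvec.subspace_diff[OF subspace assms lV]] by auto
    qed
  qed
next
  assume lV: "l \<in> V" and lim: "\<forall>p\<in>P. (\<lambda>n. p (x n - l)) \<longlonglongrightarrow> 0"
  show "limitin (seminorm_topology V P) x l sequentially"
    unfolding limitin_def topspace_eq
  proof (intro conjI allI impI)
    fix U assume "openin (seminorm_topology V P) U \<and> l \<in> U"
    then obtain F e where F: "finite F" "F \<subseteq> P" "0 < e" "{y \<in> V. \<forall>p\<in>F. p (y - l) < e} \<subseteq> U"
      using finite_ball_in_open[of U l] by meson
    have "\<forall>\<^sub>F n in sequentially. \<forall>p\<in>F. p (x n - l) < e"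
    proof (intro eventually_ball_finite F(1) ballI)
      fix p assume "p \<in> F"
      then show "\<forall>\<^sub>F n in sequentially. p (x n - l) < e"
        by (rule order_tendstoD(2)[OF lim[rule_format, OF subsetD[OF F(2)]] F(3)])
    qed
    then show "\<forall>\<^sub>F n in sequentially. x n \<in> U"
      proof eventually_elim
      case (elim n)
      then show ?case by (intro subsetD[OF F(4)]) (simp add: assms)
    qed
  qed (fact lV)
qed

end

text \<open>
  A linear map that is continuous sends a basic neighbourhood of \<open>0\<close> into the unit ball of \<open>q\<close>;
  homogeneity turns this inclusion into an estimate.
\<close>

lemma continuous_map_imp_bound:
  assumes "seminormed_space V P" "seminormed_space W Q"
    and T: "clinear_on V T" and cont: "continuous_map (seminorm_topology V P) (seminorm_topology W Q) T"
    and q: "q \<in> Q"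
  shows "\<exists>F C. finite F \<and> F \<subseteq> P \<and> 0 < C \<and> (\<forall>x\<in>V. q (T x) \<le> C * (\<Sum>p\<in>F. p x))"
proof -
  interpret V: seminormed_space V P by fact
  interpret W: seminormed_space W Q by fact
  have TW: "T x \<in> W" if "x \<in> V" for x
    using cont that by (auto simp: continuous_map_def V.topspace_eq W.topspace_eq)
  have T0: "T 0 = 0" by (rule clinear_on_zero[OF V.subspace T])
  have "openin (seminorm_topology V P) {x \<in> V. T x \<in> {y \<in> W. q (y - 0) < 1}}"
    using openin_continuous_map_preimage[OF cont W.openin_ball[OF q cvec.subspace_0[OF W.subspace]], of 1]
    unfolding V.topspace_eq by simp
  moreover have "0 \<in> {x \<in> V. T x \<in> {y \<in> W. q (y - 0) < 1}}"
    using T0 cvec.subspace_0[OF V.subspace] W.centre_in_ball[OF q cvec.subspace_0[OF W.subspace], of 1] by simp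
  ultimately obtain F e where F: "finite F" "F \<subseteq> P" "0 < e"
    "{y \<in> V. \<forall>p\<in>F. p (y - 0) < e} \<subseteq> {x \<in> V. T x \<in> {y \<in> W. q (y - 0) < 1}}"
    using V.finite_ball_in_open[of _ 0] by meson
  have "q (T x) \<le> (1 / e) * (\<Sum>p\<in>F. p x)" if x: "x \<in> V" for x
  proof -
    define S where "S = (\<Sum>p\<in>F. p x)"
    have nn: "0 \<le> p x" if "p \<in> F" for p
      using seminorm_on_nonneg[OF V.seminorm x] that F by blast
    have "e * q (T x) \<le> S"
    proof (rule dense_ge)
      fix t assume "S < t"
      \<comment> \<open>Scaling \<open>x\<close> by \<open>e / t\<close> puts it into the neighbourhood that \<open>T\<close> maps into the unit ball of \<open>q\<close>.\<close>
      have "0 \<le> S" unfolding S_def by (rule sum_nonneg) (rule nn)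
      with \<open>S < t\<close> have "0 < t" by simp
      define c where "c = e / t"
      have c: "0 < c" "c * t = e" using \<open>0 < t\<close> \<open>0 < e\<close> by (auto simp: c_def)
      let ?y = "complex_of_real c *\<^sub>C x"
      have y: "?y \<in> V" by (rule cvec.subspace_scale[OF V.subspace x])
      have "p ?y < e" if "p \<in> F" for p
      proof -
        have "p x \<le> S" unfolding S_def by (rule member_le_sum[OF that nn F(1)]) auto
        then have "p x < t" using \<open>S < t\<close> by simp
        moreover have "p ?y = c * p x"
          using seminorm_on_scaleC[OF V.seminorm x, of p "complex_of_real c"] that F c by auto
        ultimately show ?thesis using c by (metis mult_less_cancel_left_pos)
      qed
      then have "q (T ?y) < 1" using F(4) y by auto
      moreover have "q (T ?y) = c * q (T x)"
        using clinear_on_scaleC[OF T x, of "complex_of_real c"]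
          seminorm_on_scaleC[OF W.seminorm[OF q] TW[OF x], of "complex_of_real c"] c
        by simp
      ultimately show "e * q (T x) \<le> t"
        using \<open>0 < t\<close> unfolding c(2)[symmetric]
        by (simp add: mult.assoc mult.left_commute mult_left_le)
    qed
    then show ?thesis using \<open>0 < e\<close> by (simp add: S_def field_simps)
  qed
  then show ?thesis using F by (intro exI[of _ F] exI[of _ "1 / e"]) auto
qed

lemma bound_imp_continuous_map:
  assumes "seminormed_space V P" "seminormed_space W Q"
    and T: "clinear_on V T" and TW: "\<And>x. x \<in> V \<Longrightarrow> T x \<in> W"
    and bound: "\<And>q. q \<in> Q \<Longrightarrow> \<exists>p\<in>P. \<exists>C. \<forall>x\<in>V. q (T x) \<le> C * p x"
  shows "continuous_map (seminorm_topology V P) (seminorm_topology W Q) T"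
proof -
  interpret V: seminormed_space V P by fact
  interpret W: seminormed_space W Q by fact
  have *: "openin (seminorm_topology V P) (T -` {y \<in> W. q (y - w) < e} \<inter> topspace (seminorm_topology V P))"
    if q: "q \<in> Q" and w: "w \<in> W" and e: "0 < e" for q w e
  proof (rule V.openinI)
    fix x assume x: "x \<in> T -` {y \<in> W. q (y - w) < e} \<inter> topspace (seminorm_topology V P)"
    then have xV: "x \<in> V" and less: "q (T x - w) < e" by (auto simp: V.topspace_eq)
    obtain p C where p: "p \<in> P" "\<forall>x\<in>V. q (T x) \<le> C * p x" using bound[OF q] by blast
    define d where "d = (e - q (T x - w)) / (\<bar>C\<bar> + 1)"
    have "y \<in> T -` {y \<in> W. q (y - w) < e}" if y: "y \<in> V" "p (y - x) < d" for y
    proof -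
      have yx: "y - x \<in> V" by (rule cvec.subspace_diff[OF V.subspace y(1) xV])
      have "q (T y - T x) \<le> C * p (y - x)"
        using p(2) yx clinear_on_diff[OF V.subspace T y(1) xV] by metis
      also have "\<dots> \<le> (\<bar>C\<bar> + 1) * p (y - x)"
        by (intro mult_right_mono seminorm_on_nonneg[OF V.seminorm[OF p(1)] yx]) auto
      also have "\<dots> < (\<bar>C\<bar> + 1) * d" using y(2) by (intro mult_strict_left_mono) auto
      also have "\<dots> = e - q (T x - w)" unfolding d_def by simp
      finally have "q (T y - w) < e"
        using seminorm_on_diff_triangle[OF W.subspace W.seminorm[OF q] w TW[OF y(1)] TW[OF xV]] by simp
      then show ?thesis using TW y by auto
    qed
    moreover have "0 < d" using less unfolding d_def by simp
    ultimately show "\<exists>p\<in>P. \<exists>e'>0. {y \<in> V. p (y - x) < e'}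
        \<subseteq> T -` {y \<in> W. q (y - w) < e} \<inter> topspace (seminorm_topology V P)"
      using p(1) V.topspace_eq by blast
  qed (auto simp: V.topspace_eq)
  have "T ` topspace (seminorm_topology V P) \<subseteq> topspace (seminorm_topology W Q)"
    using TW unfolding V.topspace_eq W.topspace_eq by (rule image_subsetI)
  then show ?thesis
    unfolding seminorm_topology_def[of W] topology_generated_by_topspace
  proof (intro continuous_on_generated_topo)
    fix U assume "U \<in> {{y \<in> W. q (y - w) < e} |q w e. q \<in> Q \<and> w \<in> W \<and> 0 < e}"
    then obtain q w e where U: "U = {y \<in> W. q (y - w) < e}" "q \<in> Q" "w \<in> W" "0 < e"
      by (elim CollectE exE conjE)
    show "openin (seminorm_topology V P) (T -` U \<inter> topspace (seminorm_topology V P))"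
      unfolding U(1) by (rule *[OF U(2-4)])
  qed
qed

text \<open>
  For an increasing sequence of seminorms the finite sums of seminorms in the previous estimates can
  be replaced by a single seminorm, so that continuity becomes a statement about two indices.
\<close>

locale graded_space =
  fixes V :: "'a::complex_vector set" and nrm :: "nat \<Rightarrow> 'a \<Rightarrow> real"
  assumes grade_subspace: "cvec.subspace V"
    and grade_seminorm: "seminorm_on V (nrm q)"
    and mono: "p \<le> q \<Longrightarrow> x \<in> V \<Longrightarrow> nrm p x \<le> nrm q x"
begin

sublocale seminormed_space V "range nrm"
proof unfold_locales
  show "cvec.subspace V" by (rule grade_subspace)
  show "seminorm_on V p" if "p \<in> range nrm" for p using that by (rule rangeE) (simp add: grade_seminorm)
  show "range nrm \<noteq> {}" by simp
qed

lemma graded_subspace: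
  assumes "cvec.subspace A" "A \<subseteq> V"
  shows "graded_space A nrm"
proof unfold_locales
  show "cvec.subspace A" by (rule assms(1))
  show "seminorm_on A (nrm q)" for q by (rule seminorm_on_subset[OF grade_seminorm assms(2)])
  show "nrm p x \<le> nrm q x" if "p \<le> q" "x \<in> A" for p q x
    by (rule mono[OF that(1) subsetD[OF assms(2) that(2)]])
qed

lemma subtopology_eq:
  assumes "cvec.subspace A" "A \<subseteq> V"
  shows "subtopology (seminorm_topology V (range nrm)) A = seminorm_topology A (range nrm)"
proof (rule subtopology_seminorm_topology[OF assms subspace])
  show "seminorm_on V p" if "p \<in> range nrm" for p using that by (rule rangeE) (simp add: grade_seminorm)
qed

end

lemma continuous_map_graded_imp_bound:
  assumes "graded_space V nrm" "graded_space W nrm'"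
    and T: "clinear_on V T"
    and cont: "continuous_map (seminorm_topology V (range nrm)) (seminorm_topology W (range nrm')) T"
  shows "\<exists>m C. 0 < C \<and> (\<forall>x\<in>V. nrm' q (T x) \<le> C * nrm m x)"
proof -
  interpret V: graded_space V nrm by fact
  interpret W: graded_space W nrm' by fact
  obtain F C where F: "finite F" "F \<subseteq> range nrm" "0 < C" and
    bound: "\<forall>x\<in>V. nrm' q (T x) \<le> C * (\<Sum>p\<in>F. p x)"
    using continuous_map_imp_bound[OF V.seminormed_space_axioms W.seminormed_space_axioms T cont, of "nrm' q"]
    by (metis rangeI)
  obtain I where I: "finite I" "F = nrm ` I" using finite_subset_image[OF F(1,2)] by metis
  define m where "m = Max (insert 0 I)"
  have "nrm' q (T x) \<le> (C * (real (card F) + 1)) * nrm m x" if x: "x \<in> V" for x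
  proof -
    have "(\<Sum>p\<in>F. p x) \<le> (\<Sum>p\<in>F. nrm m x)"
      using I x V.mono unfolding m_def by (intro sum_mono) auto
    also have "\<dots> \<le> (real (card F) + 1) * nrm m x"
      using seminorm_on_nonneg[OF V.grade_seminorm x] by (simp add: distrib_right)
    finally have "C * (\<Sum>p\<in>F. p x) \<le> C * ((real (card F) + 1) * nrm m x)"
      using F(3) by (intro mult_left_mono) auto
    with bound x show ?thesis unfolding mult.assoc by (meson order_trans)
  qed
  then show ?thesis using F(3)
    by (intro exI[of _ m] exI[of _ "C * (real (card F) + 1)"]) auto
qed

lemma clinear_on_inv_into:
  assumes V: "cvec.subspace V" and T: "clinear_on V T" and bij: "bij_betw T V W"
  shows "clinear_on W (inv_into V T)"
proof -
  define S where "S = inv_into V T"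
  have S: "S y \<in> V" "T (S y) = y" if "y \<in> W" for y
    using bij that unfolding S_def by (auto simp: bij_betw_def inv_into_into f_inv_into_f)
  have S': "S (T x) = x" if "x \<in> V" for x
    using bij that unfolding S_def by (auto simp: bij_betw_def inv_into_f_f)
  show ?thesis
    unfolding clinear_on_def S_def[symmetric]
  proof safe
    fix x y assume "x \<in> W" "y \<in> W"
    then have "x + y = T (S x + S y)" using clinear_on_add[OF T] S by metis
    then show "S (x + y) = S x + S y"
      using S' S \<open>x \<in> W\<close> \<open>y \<in> W\<close> cvec.subspace_add[OF V] by metis
  next
    fix c x assume "x \<in> W"
    then have "c *\<^sub>C x = T (c *\<^sub>C S x)" using clinear_on_scaleC[OF T] S by metis
    then show "S (c *\<^sub>C x) = c *\<^sub>C S x"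
      using S' S \<open>x \<in> W\<close> cvec.subspace_scale[OF V] by metis
  qed
qed

lemma clinear_on_image_subspace:
  assumes V: "cvec.subspace V" and T: "clinear_on V T"
  shows "cvec.subspace (T ` V)"
proof (rule cvec.subspaceI)
  show "0 \<in> T ` V" using clinear_on_zero[OF V T] cvec.subspace_0[OF V] by (metis imageI)
  show "x + y \<in> T ` V" if "x \<in> T ` V" "y \<in> T ` V" for x y
    using that clinear_on_add[OF T] cvec.subspace_add[OF V] by (metis (no_types) imageE imageI)
  show "c *\<^sub>C x \<in> T ` V" if "x \<in> T ` V" for c x
    using that clinear_on_scaleC[OF T] cvec.subspace_scale[OF V] by (metis (no_types) imageE imageI)
qed

lemma homeomorphic_map_of_bounds:
  assumes "graded_space V nrm" "graded_space W nrm'"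
    and T: "clinear_on V T" and bij: "bij_betw T V W"
    and up: "\<And>q. \<exists>m C. \<forall>x\<in>V. nrm' q (T x) \<le> C * nrm m x"
    and down: "\<And>q. \<exists>m C. \<forall>x\<in>V. nrm q x \<le> C * nrm' m (T x)"
  shows "homeomorphic_map (seminorm_topology V (range nrm)) (seminorm_topology W (range nrm')) T"
proof -
  interpret V: graded_space V nrm by fact
  interpret W: graded_space W nrm' by fact
  define S where "S = inv_into V T"
  have S: "S y \<in> V" "T (S y) = y" if "y \<in> W" for y
    using bij that unfolding S_def by (auto simp: bij_betw_def inv_into_into f_inv_into_f)
  have S': "S (T x) = x" if "x \<in> V" for x
    using bij that unfolding S_def by (auto simp: bij_betw_def inv_into_f_f)
  have TW: "T x \<in> W" if "x \<in> V" for x using bij that by (auto simp: bij_betw_def)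
  have linS: "clinear_on W S" unfolding S_def by (rule clinear_on_inv_into[OF V.subspace T bij])
  have "continuous_map (seminorm_topology V (range nrm)) (seminorm_topology W (range nrm')) T"
    using up TW
    by (intro bound_imp_continuous_map T V.seminormed_space_axioms W.seminormed_space_axioms) blast+
  moreover have "continuous_map (seminorm_topology W (range nrm')) (seminorm_topology V (range nrm)) S"
  proof (intro bound_imp_continuous_map linS V.seminormed_space_axioms W.seminormed_space_axioms S(1))
    fix q assume "q \<in> range nrm"
    then obtain n where n: "q = nrm n" by blast
    obtain m C where "\<forall>x\<in>V. nrm n x \<le> C * nrm' m (T x)" using down by blast
    then have "\<forall>y\<in>W. nrm n (S y) \<le> C * nrm' m y" using S by metis
    then show "\<exists>p\<in>range nrm'. \<exists>C. \<forall>x\<in>W. q (S x) \<le> C * p x" using n by blast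
  qed
  ultimately have "homeomorphic_maps (seminorm_topology V (range nrm)) (seminorm_topology W (range nrm')) T S"
    unfolding homeomorphic_maps_def V.topspace_eq W.topspace_eq using S S' by blast
  then show ?thesis using homeomorphic_map_maps by blast
qed

lemma homeomorphic_map_imp_bounds:
  assumes "graded_space V nrm" "graded_space W nrm'"
    and T: "clinear_on V T"
    and homeo: "homeomorphic_map (seminorm_topology V (range nrm)) (seminorm_topology W (range nrm')) T"
  shows "bij_betw T V W"
    and "\<exists>m C. 0 < C \<and> (\<forall>x\<in>V. nrm' q (T x) \<le> C * nrm m x)"
    and "\<exists>m C. 0 < C \<and> (\<forall>y\<in>W. nrm q (inv_into V T y) \<le> C * nrm' m y)"
proof -
  interpret V: graded_space V nrm by fact
  interpret W: graded_space W nrm' by fact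
  show bij: "bij_betw T V W"
    using homeomorphic_imp_injective_map[OF homeo] homeomorphic_imp_surjective_map[OF homeo]
    unfolding bij_betw_def V.topspace_eq W.topspace_eq by simp
  show "\<exists>m C. 0 < C \<and> (\<forall>x\<in>V. nrm' q (T x) \<le> C * nrm m x)"
    by (rule continuous_map_graded_imp_bound[OF assms(1,2) T homeomorphic_imp_continuous_map[OF homeo]])
  obtain S where S: "homeomorphic_maps (seminorm_topology V (range nrm)) (seminorm_topology W (range nrm')) T S"
    using homeo homeomorphic_map_maps by metis
  then have contS: "continuous_map (seminorm_topology W (range nrm')) (seminorm_topology V (range nrm)) S"
    and eq: "\<And>x. x \<in> V \<Longrightarrow> S (T x) = x"
    by (auto simp: homeomorphic_maps_def V.topspace_eq)
  have "continuous_map (seminorm_topology W (range nrm')) (seminorm_topology V (range nrm)) (inv_into V T)"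
  proof (rule continuous_map_eq[OF contS])
    fix y assume "y \<in> topspace (seminorm_topology W (range nrm'))"
    then obtain x where "x \<in> V" "y = T x" using bij unfolding W.topspace_eq bij_betw_def by auto
    then show "S y = inv_into V T y" using eq bij by (simp add: bij_betw_def inv_into_f_f)
  qed
  then show "\<exists>m C. 0 < C \<and> (\<forall>y\<in>W. nrm q (inv_into V T y) \<le> C * nrm' m y)"
    by (rule continuous_map_graded_imp_bound[OF assms(2,1) clinear_on_inv_into[OF V.subspace T bij]])
qed


section \<open>Weighted square-summable sequences\<close>

text \<open>
  The norms of \<open>s\<close> have the weights \<open>(j + 1) ^ (2 * q)\<close> and those of \<open>s'\<close> their reciprocals, so both
  scales are treated together.
\<close>

definition wnorm :: "(nat \<Rightarrow> real) \<Rightarrow> cseq \<Rightarrow> real" where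
  "wnorm w \<xi> = sqrt (\<Sum>j. (cmod (\<xi> j))\<^sup>2 * w j)"

definition wspace :: "(nat \<Rightarrow> real) \<Rightarrow> cseq set" where
  "wspace w = {\<xi>. summable (\<lambda>j. (cmod (\<xi> j))\<^sup>2 * w j)}"

text \<open>
  Membership and norm are both controlled by the finite partial sums, so that all estimates below
  reduce to inequalities for finite sums.
\<close>

lemma wnorm_le_iff:
  assumes w: "\<And>j. 0 \<le> w j" and M: "0 \<le> M"
  shows "\<xi> \<in> wspace w \<and> wnorm w \<xi> \<le> M \<longleftrightarrow> (\<forall>n. (\<Sum>j<n. (cmod (\<xi> j))\<^sup>2 * w j) \<le> M\<^sup>2)"
proof safe
  fix n assume "\<xi> \<in> wspace w" and le: "wnorm w \<xi> \<le> M"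
  then have s: "summable (\<lambda>j. (cmod (\<xi> j))\<^sup>2 * w j)" by (simp add: wspace_def)
  have "(\<Sum>j<n. (cmod (\<xi> j))\<^sup>2 * w j) \<le> (\<Sum>j. (cmod (\<xi> j))\<^sup>2 * w j)"
    by (rule sum_le_suminf[OF s]) (auto simp: w)
  also have "\<dots> \<le> M\<^sup>2"
    using le M unfolding wnorm_def by (metis real_sqrt_le_iff real_sqrt_unique)
  finally show "(\<Sum>j<n. (cmod (\<xi> j))\<^sup>2 * w j) \<le> M\<^sup>2" .
next
  assume le: "\<forall>n. (\<Sum>j<n. (cmod (\<xi> j))\<^sup>2 * w j) \<le> M\<^sup>2"
  have s: "summable (\<lambda>j. (cmod (\<xi> j))\<^sup>2 * w j)"
    by (rule summableI_nonneg_bounded[of _ "M\<^sup>2"]) (use le w in auto)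
  then show "\<xi> \<in> wspace w" by (simp add: wspace_def)
  have "(\<Sum>j. (cmod (\<xi> j))\<^sup>2 * w j) \<le> M\<^sup>2" by (rule suminf_le_const[OF s]) (use le in auto)
  then have "wnorm w \<xi> \<le> sqrt (M\<^sup>2)" unfolding wnorm_def by (rule real_sqrt_le_mono)
  then show "wnorm w \<xi> \<le> M" using M by simp
qed

lemma wnorm_leI:
  assumes "\<And>j. 0 \<le> w j" "0 \<le> M" "\<And>n. (\<Sum>j<n. (cmod (\<xi> j))\<^sup>2 * w j) \<le> M\<^sup>2"
  shows "\<xi> \<in> wspace w" "wnorm w \<xi> \<le> M"
  using wnorm_le_iff[of w M \<xi>] assms by auto

lemma wnorm_nonneg:
  assumes "\<And>j. 0 \<le> w j" "\<xi> \<in> wspace w"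
  shows "0 \<le> wnorm w \<xi>"
  using assms unfolding wnorm_def wspace_def by (auto intro!: suminf_nonneg)

lemma wnorm_partial_sum_le:
  assumes w: "\<And>j. 0 \<le> w j" and \<xi>: "\<xi> \<in> wspace w"
  shows "(\<Sum>j<n. (cmod (\<xi> j))\<^sup>2 * w j) \<le> (wnorm w \<xi>)\<^sup>2"
proof -
  show ?thesis using \<xi> wnorm_le_iff[of w "wnorm w \<xi>" \<xi>] wnorm_nonneg[of w \<xi>] w by simp
qed

lemma wnorm_L2_set_le:
  assumes w: "\<And>j. 0 \<le> w j" and \<xi>: "\<xi> \<in> wspace w"
  shows "L2_set (\<lambda>j. cmod (\<xi> j) * sqrt (w j)) {..<n} \<le> wnorm w \<xi>"
proof -
  have "L2_set (\<lambda>j. cmod (\<xi> j) * sqrt (w j)) {..<n} = sqrt (\<Sum>j<n. (cmod (\<xi> j))\<^sup>2 * w j)"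
    unfolding L2_set_def using w by (simp add: power_mult_distrib)
  also have "\<dots> \<le> wnorm w \<xi>"
    by (rule real_le_lsqrt) (use wnorm_partial_sum_le[OF w \<xi>] w \<xi> in \<open>auto intro: wnorm_nonneg sum_nonneg\<close>)
  finally show ?thesis .
qed

lemma wnorm_coordinate_le:
  assumes w: "\<And>j. 0 \<le> w j" and \<xi>: "\<xi> \<in> wspace w"
  shows "cmod (\<xi> j) * sqrt (w j) \<le> wnorm w \<xi>"
  using member_le_L2_set[of "{..<Suc j}" j "\<lambda>j. cmod (\<xi> j) * sqrt (w j)"] wnorm_L2_set_le[OF w \<xi>, of "Suc j"]
  by simp

lemma wnorm_triangle:
  assumes w: "\<And>j. 0 \<le> w j" and \<xi>: "\<xi> \<in> wspace w" and \<eta>: "\<eta> \<in> wspace w"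
  shows "\<xi> + \<eta> \<in> wspace w" "wnorm w (\<xi> + \<eta>) \<le> wnorm w \<xi> + wnorm w \<eta>"
proof -
  have "(\<Sum>j<n. (cmod ((\<xi> + \<eta>) j))\<^sup>2 * w j) \<le> (wnorm w \<xi> + wnorm w \<eta>)\<^sup>2" for n
  proof -
    have "(\<Sum>j<n. (cmod ((\<xi> + \<eta>) j))\<^sup>2 * w j) = (L2_set (\<lambda>j. cmod ((\<xi> + \<eta>) j) * sqrt (w j)) {..<n})\<^sup>2"
      unfolding L2_set_def using w by (simp add: power_mult_distrib sum_nonneg)
    also have "\<dots> \<le> (L2_set (\<lambda>j. cmod (\<xi> j) * sqrt (w j) + cmod (\<eta> j) * sqrt (w j)) {..<n})\<^sup>2"
      by (intro power_mono L2_set_mono L2_set_nonneg)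
        (auto simp: w distrib_right[symmetric] intro!: mult_right_mono norm_triangle_ineq)
    also have "\<dots> \<le> (wnorm w \<xi> + wnorm w \<eta>)\<^sup>2"
      by (intro power_mono L2_set_nonneg order_trans[OF L2_set_triangle_ineq] add_mono
          wnorm_L2_set_le assms)
    finally show ?thesis .
  qed
  then show "\<xi> + \<eta> \<in> wspace w" "wnorm w (\<xi> + \<eta>) \<le> wnorm w \<xi> + wnorm w \<eta>"
    using wnorm_leI[of w "wnorm w \<xi> + wnorm w \<eta>" "\<xi> + \<eta>"] wnorm_nonneg[of w] assms by auto
qed

lemma wnorm_scaleC:
  assumes \<xi>: "\<xi> \<in> wspace w"
  shows "c *\<^sub>C \<xi> \<in> wspace w" "wnorm w (c *\<^sub>C \<xi>) = cmod c * wnorm w \<xi>"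
proof -
  have eq: "(\<lambda>j. (cmod ((c *\<^sub>C \<xi>) j))\<^sup>2 * w j) = (\<lambda>j. (cmod c)\<^sup>2 * ((cmod (\<xi> j))\<^sup>2 * w j))"
    by (simp add: scaleC_fun_def scaleC_complex_def norm_mult power_mult_distrib mult.assoc)
  show "c *\<^sub>C \<xi> \<in> wspace w" using \<xi> unfolding wspace_def mem_Collect_eq eq by (rule summable_mult)
  show "wnorm w (c *\<^sub>C \<xi>) = cmod c * wnorm w \<xi>"
    using \<xi> unfolding wspace_def mem_Collect_eq wnorm_def eq
    by (simp add: suminf_mult real_sqrt_mult)
qed

lemma wspace_subspace:
  assumes "\<And>j. 0 \<le> w j"
  shows "cvec.subspace (wspace w)"
proof (rule cvec.subspaceI)
  show "0 \<in> wspace w" by (simp add: wspace_def)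
qed (use wnorm_triangle(1)[of w] wnorm_scaleC(1) assms in auto)

lemma wnorm_seminorm:
  assumes "\<And>j. 0 \<le> w j"
  shows "seminorm_on (wspace w) (wnorm w)"
  unfolding seminorm_on_def using assms
  by (auto intro: wnorm_nonneg wnorm_triangle(2) simp: wnorm_scaleC(2))

lemma wnorm_mono:
  assumes w: "\<And>j. 0 \<le> w j" and le: "\<And>j. w j \<le> w' j" and \<xi>: "\<xi> \<in> wspace w'"
  shows "\<xi> \<in> wspace w" "wnorm w \<xi> \<le> wnorm w' \<xi>"
proof -
  have w': "0 \<le> w' j" for j using order_trans[OF w le] .
  have "(\<Sum>j<n. (cmod (\<xi> j))\<^sup>2 * w j) \<le> (wnorm w' \<xi>)\<^sup>2" for n
    by (rule order_trans[OF sum_mono wnorm_partial_sum_le[OF w' \<xi>, of n]])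
      (intro mult_left_mono le, simp)
  then show "\<xi> \<in> wspace w" "wnorm w \<xi> \<le> wnorm w' \<xi>"
    using wnorm_leI[of w "wnorm w' \<xi>" \<xi>] wnorm_nonneg[of w' \<xi>] w w' \<xi> by auto
qed

text \<open>
  The weights are compared only on the support of \<open>\<eta>\<close>; for truncations and tails of \<open>\<xi>\<close> this yields a
  constant that depends on the place of the cut.
\<close>

lemma wnorm_le_on_support:
  assumes w: "\<And>j. 0 \<le> w j" "\<And>j. 0 \<le> w' j" and c: "0 \<le> c" and \<xi>: "\<xi> \<in> wspace w'"
    and le: "\<And>j. cmod (\<eta> j) \<le> cmod (\<xi> j)" "\<And>j. \<eta> j \<noteq> 0 \<Longrightarrow> w j \<le> c\<^sup>2 * w' j"
  shows "\<eta> \<in> wspace w" "wnorm w \<eta> \<le> c * wnorm w' \<xi>"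
proof -
  have "(\<Sum>j<n. (cmod (\<eta> j))\<^sup>2 * w j) \<le> (c * wnorm w' \<xi>)\<^sup>2" for n
  proof -
    have "(\<Sum>j<n. (cmod (\<eta> j))\<^sup>2 * w j) \<le> (\<Sum>j<n. c\<^sup>2 * ((cmod (\<xi> j))\<^sup>2 * w' j))"
    proof (rule sum_mono)
      fix j
      show "(cmod (\<eta> j))\<^sup>2 * w j \<le> c\<^sup>2 * ((cmod (\<xi> j))\<^sup>2 * w' j)"
      proof (cases "\<eta> j = 0")
        case False
        have "(cmod (\<eta> j))\<^sup>2 * w j \<le> (cmod (\<xi> j))\<^sup>2 * (c\<^sup>2 * w' j)"
          by (intro mult_mono power_mono le False w) auto
        then show ?thesis by (simp add: mult_ac)
      qed (simp add: w)
    qed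
    also have "\<dots> \<le> c\<^sup>2 * (wnorm w' \<xi>)\<^sup>2"
      unfolding sum_distrib_left[symmetric]
      using wnorm_partial_sum_le[of w' \<xi> n] w \<xi> by (intro mult_left_mono) auto
    finally show ?thesis by (simp add: power_mult_distrib)
  qed
  then show "\<eta> \<in> wspace w" "wnorm w \<eta> \<le> c * wnorm w' \<xi>"
    using wnorm_leI[of w "c * wnorm w' \<xi>" \<eta>] w c \<xi> wnorm_nonneg[of w' \<xi>] by auto
qed

text \<open>Lower semicontinuity under coordinatewise limits; it also provides membership of the limit.\<close>

lemma wnorm_pointwise_limit_le:
  assumes w: "\<And>j. 0 \<le> w j" and M: "0 \<le> M"
    and lim: "\<And>j. (\<lambda>m. \<eta> m j) \<longlonglongrightarrow> \<xi> j"
    and bound: "\<forall>\<^sub>F m in sequentially. \<eta> m \<in> wspace w \<and> wnorm w (\<eta> m) \<le> M"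
  shows "\<xi> \<in> wspace w" "wnorm w \<xi> \<le> M"
proof -
  have "(\<Sum>j<n. (cmod (\<xi> j))\<^sup>2 * w j) \<le> M\<^sup>2" for n
  proof (rule tendsto_upperbound)
    show "(\<lambda>m. \<Sum>j<n. (cmod (\<eta> m j))\<^sup>2 * w j) \<longlonglongrightarrow> (\<Sum>j<n. (cmod (\<xi> j))\<^sup>2 * w j)"
      by (intro tendsto_intros lim)
    show "\<forall>\<^sub>F m in sequentially. (\<Sum>j<n. (cmod (\<eta> m j))\<^sup>2 * w j) \<le> M\<^sup>2"
      using bound
    proof eventually_elim
      case (elim m)
      then show ?case using wnorm_le_iff[of w M "\<eta> m"] w M by simp
    qed
  qed simp
  then show "\<xi> \<in> wspace w" "wnorm w \<xi> \<le> M" using wnorm_leI[of w M \<xi>] w M by auto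
qed

text \<open>Cauchy-Schwarz for the factorization \<open>\<bar>\<xi> j\<bar>\<^sup>2 * w j = \<bar>\<xi> j\<bar> * (\<bar>\<xi> j\<bar> * w j)\<close>.\<close>

lemma wnorm_log_convex:
  assumes w: "\<And>j. 0 \<le> w j" and \<xi>: "\<xi> \<in> wspace (\<lambda>j. 1)" "\<xi> \<in> wspace (\<lambda>j. (w j)\<^sup>2)"
  shows "(wnorm w \<xi>)\<^sup>2 \<le> wnorm (\<lambda>j. 1) \<xi> * wnorm (\<lambda>j. (w j)\<^sup>2) \<xi>"
proof -
  let ?M = "wnorm (\<lambda>j. 1) \<xi> * wnorm (\<lambda>j. (w j)\<^sup>2) \<xi>"
  have M: "0 \<le> ?M" by (intro mult_nonneg_nonneg wnorm_nonneg \<xi>) auto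
  have "(\<Sum>j<n. (cmod (\<xi> j))\<^sup>2 * w j) \<le> (sqrt ?M)\<^sup>2" for n
  proof -
    have "(\<Sum>j<n. (cmod (\<xi> j))\<^sup>2 * w j)
        = (\<Sum>j<n. \<bar>cmod (\<xi> j) * sqrt 1\<bar> * \<bar>cmod (\<xi> j) * sqrt ((w j)\<^sup>2)\<bar>)"
      using w by (intro sum.cong) (auto simp: power2_eq_square)
    also have "\<dots> \<le> L2_set (\<lambda>j. cmod (\<xi> j) * sqrt 1) {..<n} * L2_set (\<lambda>j. cmod (\<xi> j) * sqrt ((w j)\<^sup>2)) {..<n}"
      by (rule L2_set_mult_ineq)
    also have "\<dots> \<le> ?M"
      using \<xi> by (intro mult_mono wnorm_L2_set_le L2_set_nonneg wnorm_nonneg) auto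
    finally show ?thesis using M by simp
  qed
  then have "\<xi> \<in> wspace w" "wnorm w \<xi> \<le> sqrt ?M" using wnorm_leI[of w "sqrt ?M" \<xi>] w M by auto
  then have "(wnorm w \<xi>)\<^sup>2 \<le> (sqrt ?M)\<^sup>2" by (intro power_mono wnorm_nonneg w)
  then show ?thesis using M by simp
qed

lemma wnorm_pairing:
  assumes w: "\<And>j. 0 < w j" and \<xi>: "\<xi> \<in> wspace (\<lambda>j. 1 / w j)" and \<eta>: "\<eta> \<in> wspace w"
  shows "summable (\<lambda>j. \<xi> j * cnj (\<eta> j))" "cmod (pairing \<xi> \<eta>) \<le> wnorm (\<lambda>j. 1 / w j) \<xi> * wnorm w \<eta>"
proof -
  let ?M = "wnorm (\<lambda>j. 1 / w j) \<xi> * wnorm w \<eta>"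
  have w0: "0 \<le> w j" for j using w[of j] by simp
  have le: "(\<Sum>j<n. norm (\<xi> j * cnj (\<eta> j))) \<le> ?M" for n
  proof -
    have "(\<Sum>j<n. norm (\<xi> j * cnj (\<eta> j)))
        = (\<Sum>j<n. \<bar>cmod (\<xi> j) * sqrt (1 / w j)\<bar> * \<bar>cmod (\<eta> j) * sqrt (w j)\<bar>)"
      using w by (intro sum.cong) (auto simp: norm_mult real_sqrt_divide less_imp_le less_imp_neq[THEN not_sym])
    also have "\<dots> \<le> L2_set (\<lambda>j. cmod (\<xi> j) * sqrt (1 / w j)) {..<n} * L2_set (\<lambda>j. cmod (\<eta> j) * sqrt (w j)) {..<n}"
      by (rule L2_set_mult_ineq)
    also have "\<dots> \<le> ?M"
      using \<xi> \<eta> w0 by (intro mult_mono wnorm_L2_set_le L2_set_nonneg wnorm_nonneg) auto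
    finally show ?thesis .
  qed
  have s: "summable (\<lambda>j. norm (\<xi> j * cnj (\<eta> j)))"
    by (rule summableI_nonneg_bounded[of _ ?M]) (use le in auto)
  then show "summable (\<lambda>j. \<xi> j * cnj (\<eta> j))" by (rule summable_norm_cancel)
  show "cmod (pairing \<xi> \<eta>) \<le> ?M"
    unfolding pairing_def
    by (rule order_trans[OF summable_norm[OF s] suminf_le_const[OF s]]) (rule le)
qed


section \<open>The spaces \<open>s\<close> and \<open>s'\<close>\<close>

abbreviation s_weight :: "nat \<Rightarrow> nat \<Rightarrow> real" where
  "s_weight q \<equiv> (\<lambda>j. real (Suc j) ^ (2 * q))"

lemma s_norm_eq_wnorm: "s_norm q = wnorm (s_weight q)"
  by (simp add: fun_eq_iff s_norm_def wnorm_def)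

lemma s_space_eq: "s_space = (\<Inter>q. wspace (s_weight q))"
  by (auto simp: s_space_def wspace_def)

lemma s'_norm_eq_wnorm: "s'_norm q = wnorm (\<lambda>j. 1 / s_weight q j)"
  by (simp add: fun_eq_iff s'_norm_def wnorm_def)

lemma s'_step_eq: "s'_step q = wspace (\<lambda>j. 1 / s_weight q j)"
  by (simp add: s'_step_def wspace_def)

lemma ell2_eq: "ell2 = s'_step 0" "ell2 = wspace (\<lambda>j. 1)"
  by (simp_all add: ell2_def s'_step_def wspace_def)

lemma s_in_wspace: "\<xi> \<in> s_space \<Longrightarrow> \<xi> \<in> wspace (s_weight q)"
  by (simp add: s_space_eq)

lemma s_norm_nonneg: "\<xi> \<in> s_space \<Longrightarrow> 0 \<le> s_norm q \<xi>"
  and s'_norm_nonneg: "\<xi> \<in> s'_step q \<Longrightarrow> 0 \<le> s'_norm q \<xi>"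
  unfolding s_norm_eq_wnorm s'_norm_eq_wnorm s'_step_eq s_space_eq by (auto intro!: wnorm_nonneg)

lemma s_weight_mono: "p \<le> q \<Longrightarrow> s_weight p j \<le> s_weight q j"
  by (rule power_increasing) auto

lemma graded_s: "graded_space s_space s_norm"
proof unfold_locales
  show "cvec.subspace s_space"
    unfolding s_space_eq by (rule cvec.subspace_Int) (simp add: wspace_subspace)
  show "seminorm_on s_space (s_norm q)" for q
    unfolding s_norm_eq_wnorm using wnorm_seminorm[of "s_weight q"]
    by (rule seminorm_on_subset) (auto simp: s_space_eq)
  show "s_norm p \<xi> \<le> s_norm q \<xi>" if "p \<le> q" "\<xi> \<in> s_space" for p q \<xi>
    unfolding s_norm_eq_wnorm
    using wnorm_mono(2)[of "s_weight p" "s_weight q" \<xi>] s_weight_mono[OF that(1)] s_in_wspace[OF that(2)] by simp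
qed

interpretation s: graded_space s_space s_norm by (rule graded_s)

lemma topspace_s_top: "topspace s_top = s_space"
  unfolding s_top_def by (rule s.topspace_eq)

lemma s'_step_subspace: "cvec.subspace (s'_step q)"
  unfolding s'_step_eq using wspace_subspace[of "\<lambda>j. 1 / s_weight q j"] by simp

lemma s'_norm_seminorm: "seminorm_on (s'_step q) (s'_norm q)"
  unfolding s'_step_eq s'_norm_eq_wnorm using wnorm_seminorm[of "\<lambda>j. 1 / s_weight q j"] by simp

lemma s'_step_mono:
  assumes "p \<le> q" "\<xi> \<in> s'_step p"
  shows "\<xi> \<in> s'_step q" "s'_norm q \<xi> \<le> s'_norm p \<xi>"
proof -
  have *: "1 / s_weight q j \<le> 1 / s_weight p j" for j
    using s_weight_mono[OF assms(1)] by (intro divide_left_mono) auto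
  show "\<xi> \<in> s'_step q" "s'_norm q \<xi> \<le> s'_norm p \<xi>"
    using wnorm_mono[of "\<lambda>j. 1 / s_weight q j" "\<lambda>j. 1 / s_weight p j" \<xi>] assms(2) *
    unfolding s'_step_eq s'_norm_eq_wnorm by auto
qed

lemma s'_step_subset: "s'_step q \<subseteq> s'_space"
  by (auto simp: s'_space_def)

lemma s'_space_subspace: "cvec.subspace s'_space"
proof (rule cvec.subspaceI)
  show "0 \<in> s'_space" using cvec.subspace_0[OF s'_step_subspace] s'_step_subset by blast
  fix \<xi> assume "\<xi> \<in> s'_space"
  then obtain p where p: "\<xi> \<in> s'_step p" by (auto simp: s'_space_def)
  show "c *\<^sub>C \<xi> \<in> s'_space" for c
    using cvec.subspace_scale[OF s'_step_subspace p] s'_step_subset by blast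
  fix \<eta> assume "\<eta> \<in> s'_space"
  then obtain q where q: "\<eta> \<in> s'_step q" by (auto simp: s'_space_def)
  have "\<xi> + \<eta> \<in> s'_step (max p q)"
    by (rule cvec.subspace_add[OF s'_step_subspace s'_step_mono(1)[OF _ p] s'_step_mono(1)[OF _ q]]) auto
  then show "\<xi> + \<eta> \<in> s'_space" using s'_step_subset by blast
qed

lemma s_norm_coordinate_le: "\<xi> \<in> s_space \<Longrightarrow> cmod (\<xi> j) * real (Suc j) ^ q \<le> s_norm q \<xi>"
  using wnorm_coordinate_le[of "s_weight q" \<xi> j] s_in_wspace[of \<xi> q]
  by (simp add: s_norm_eq_wnorm real_sqrt_power power_mult)

lemma s_norm_zero_imp:
  assumes "\<xi> \<in> s_space" "s_norm 0 \<xi> \<le> 0"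
  shows "\<xi> = 0"
proof
  fix j show "\<xi> j = 0 j" using s_norm_coordinate_le[OF assms(1), of j 0] assms(2) order_trans[of "cmod (\<xi> j)"] by fastforce
qed

lemma s_subset_s'_step:
  assumes "\<xi> \<in> s_space"
  shows "\<xi> \<in> s'_step q" "s'_norm q \<xi> \<le> s_norm 0 \<xi>"
proof -
  have "1 / s_weight q j \<le> s_weight 0 j" for j by simp
  then show "\<xi> \<in> s'_step q" "s'_norm q \<xi> \<le> s_norm 0 \<xi>"
    using wnorm_mono[of "\<lambda>j. 1 / s_weight q j" "s_weight 0" \<xi>] s_in_wspace[OF assms, of 0]
    unfolding s'_step_eq s'_norm_eq_wnorm s_norm_eq_wnorm by auto
qed

lemma s_subset_s': "\<xi> \<in> s_space \<Longrightarrow> \<xi> \<in> s'_space"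
  and s_subset_ell2: "\<xi> \<in> s_space \<Longrightarrow> \<xi> \<in> ell2"
  using s_subset_s'_step(1)[of \<xi> 0] s'_step_subset by (auto simp: ell2_eq(1))

lemma ell2_subset_s': "ell2 \<subseteq> s'_space"
  unfolding ell2_eq(1) by (rule s'_step_subset)

lemma s_norm_log_convex:
  assumes "\<xi> \<in> s_space"
  shows "(s_norm q \<xi>)\<^sup>2 \<le> s_norm 0 \<xi> * s_norm (2 * q) \<xi>"
proof -
  have "(\<lambda>j. (s_weight q j)\<^sup>2) = s_weight (2 * q)" by (simp add: power_mult[symmetric] mult.commute)
  then show ?thesis
    using wnorm_log_convex[of "s_weight q" \<xi>] s_in_wspace[OF assms, of 0] s_in_wspace[OF assms, of "2 * q"]
    by (simp add: s_norm_eq_wnorm)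
qed

lemma pairing_bound:
  assumes "\<xi> \<in> s'_step q" "\<eta> \<in> s_space"
  shows "summable (\<lambda>j. \<xi> j * cnj (\<eta> j))" "cmod (pairing \<xi> \<eta>) \<le> s'_norm q \<xi> * s_norm q \<eta>"
  using wnorm_pairing[of "s_weight q" \<xi> \<eta>] assms s_in_wspace[OF assms(2), of q]
  by (simp_all add: s'_step_eq s'_norm_eq_wnorm s_norm_eq_wnorm)

lemma pairing_ell2_summable:
  assumes "\<xi> \<in> ell2" "\<eta> \<in> ell2"
  shows "summable (\<lambda>j. \<xi> j * cnj (\<eta> j))" "cmod (pairing \<xi> \<eta>) \<le> s'_norm 0 \<xi> * s'_norm 0 \<eta>"
  using wnorm_pairing[of "\<lambda>_. 1" \<xi> \<eta>] assms
  by (simp_all add: ell2_eq(2) s'_norm_eq_wnorm)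

lemma s_norm_0: "s_norm 0 = s'_norm 0"
  by (simp add: s_norm_eq_wnorm s'_norm_eq_wnorm)

lemma pairing_summable_s: "\<xi> \<in> s'_space \<Longrightarrow> \<eta> \<in> s_space \<Longrightarrow> summable (\<lambda>j. \<xi> j * cnj (\<eta> j))"
  unfolding s'_space_def by (auto intro: pairing_bound(1))

lemma pairing_add_left:
  "\<lbrakk>summable (\<lambda>j. \<xi> j * cnj (\<eta> j)); summable (\<lambda>j. \<zeta> j * cnj (\<eta> j))\<rbrakk> \<Longrightarrow>
    pairing (\<xi> + \<zeta>) \<eta> = pairing \<xi> \<eta> + pairing \<zeta> \<eta>"
  by (simp add: pairing_def suminf_add distrib_right)

lemma pairing_scale_left:
  "summable (\<lambda>j. \<xi> j * cnj (\<eta> j)) \<Longrightarrow> pairing (c *\<^sub>C \<xi>) \<eta> = c * pairing \<xi> \<eta>"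
  by (simp add: pairing_def scaleC_fun_def scaleC_complex_def suminf_mult mult.assoc)

lemma pairing_cnj:
  assumes "summable (\<lambda>j. \<xi> j * cnj (\<eta> j))"
  shows "pairing \<eta> \<xi> = cnj (pairing \<xi> \<eta>)"
proof -
  have "(\<lambda>j. cnj (\<xi> j * cnj (\<eta> j))) sums cnj (pairing \<xi> \<eta>)"
    unfolding sums_cnj pairing_def using assms by (rule summable_sums)
  then show ?thesis by (simp add: pairing_def sums_iff mult.commute)
qed

definition zeta2 :: real where "zeta2 = (\<Sum>j. 1 / (real (Suc j))\<^sup>2)"

lemma summable_inverse_Suc_squares: "summable (\<lambda>j. 1 / (real (Suc j))\<^sup>2)"
  using inverse_power_summable[of 2, where ?'a = real] summable_Suc_iff[of "\<lambda>n. inverse (real n ^ 2)"]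
  by (simp add: inverse_eq_divide)

lemma zeta2_nonneg: "0 \<le> zeta2"
  unfolding zeta2_def by (rule suminf_nonneg[OF summable_inverse_Suc_squares]) simp

text \<open>
  One additional power of decay absorbs the passage from suprema to square sums, because the inverse
  squares are summable.
\<close>

lemma s_norm_le_sup:
  assumes K: "\<And>j. cmod (\<xi> j) * real (Suc j) ^ Suc q \<le> K"
  shows "\<xi> \<in> wspace (s_weight q)" "s_norm q \<xi> \<le> sqrt zeta2 * K"
proof -
  have K0: "0 \<le> K" using order_trans[OF _ K[of 0]] by simp
  have "(\<Sum>j<n. (cmod (\<xi> j))\<^sup>2 * s_weight q j) \<le> (sqrt zeta2 * K)\<^sup>2" for n
  proof -
    have "(\<Sum>j<n. (cmod (\<xi> j))\<^sup>2 * s_weight q j) \<le> (\<Sum>j<n. K\<^sup>2 * (1 / (real (Suc j))\<^sup>2))"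
    proof (rule sum_mono)
      fix j
      have "(cmod (\<xi> j) * real (Suc j) ^ Suc q)\<^sup>2 \<le> K\<^sup>2" by (intro power_mono K) auto
      then have "((cmod (\<xi> j))\<^sup>2 * s_weight q j) * (real (Suc j))\<^sup>2 \<le> K\<^sup>2"
        unfolding power_even_eq by (simp add: power_mult_distrib mult_ac del: of_nat_Suc)
      then show "(cmod (\<xi> j))\<^sup>2 * s_weight q j \<le> K\<^sup>2 * (1 / (real (Suc j))\<^sup>2)"
        by (simp add: pos_le_divide_eq del: of_nat_Suc)
    qed
    also have "\<dots> = K\<^sup>2 * (\<Sum>j<n. 1 / (real (Suc j))\<^sup>2)" by (rule sum_distrib_left[symmetric])
    also have "\<dots> \<le> K\<^sup>2 * zeta2"
      unfolding zeta2_def by (intro mult_left_mono sum_le_suminf summable_inverse_Suc_squares) auto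
    finally show ?thesis using zeta2_nonneg by (simp add: power_mult_distrib mult.commute)
  qed
  then show "\<xi> \<in> wspace (s_weight q)" "s_norm q \<xi> \<le> sqrt zeta2 * K"
    unfolding s_norm_eq_wnorm using K0 zeta2_nonneg wnorm_leI[of "s_weight q" "sqrt zeta2 * K" \<xi>] by auto
qed


section \<open>Operators from \<open>s'\<close> to \<open>s\<close>\<close>

definition s'_seminorms :: "(cseq \<Rightarrow> real) set" where
  "s'_seminorms = {p. seminorm_on s'_space p \<and> (\<forall>q. \<exists>C. \<forall>\<xi>\<in>s'_step q. p \<xi> \<le> C * s'_norm q \<xi>)}"

lemma s'_top_eq: "s'_top = seminorm_topology s'_space s'_seminorms"
  by (simp add: s'_top_def s'_seminorms_def)

lemma seminormed_s': "seminormed_space s'_space s'_seminorms"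
proof unfold_locales
  show "cvec.subspace s'_space" by (rule s'_space_subspace)
  have "(\<lambda>_. 0) \<in> s'_seminorms"
    by (auto simp: s'_seminorms_def seminorm_on_def intro!: exI[of _ 0])
  then show "s'_seminorms \<noteq> {}" by (rule ex_in_conv[THEN iffD1, OF exI])
qed (simp add: s'_seminorms_def)

text \<open>
  The topology of \<open>s'\<close> is generated by all seminorms that are bounded on each step.  Hence an operator is
  continuous once all seminorms \<open>s_norm q (x \<xi>)\<close> are bounded on all steps, and by monotonicity of both
  scales it suffices to compare the \<open>q\<close>-th norm with the \<open>q\<close>-th step.
\<close>

lemma L_space_iff:
  "x \<in> L_space \<longleftrightarrow> clinear_on s'_space x \<and> (\<forall>\<xi>\<in>s'_space. x \<xi> \<in> s_space) \<and> (\<forall>\<xi>. \<xi> \<notin> s'_space \<longrightarrow> x \<xi> = 0) \<and>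
    (\<forall>q. \<exists>C. \<forall>\<xi>\<in>s'_step q. s_norm q (x \<xi>) \<le> C * s'_norm q \<xi>)" (is "_ \<longleftrightarrow> ?R")
proof
  assume x: "x \<in> L_space"
  then have lin: "clinear_on s'_space x" and cont: "continuous_map s'_top s_top x"
    and out: "\<forall>\<xi>. \<xi> \<notin> s'_space \<longrightarrow> x \<xi> = 0" by (auto simp: L_space_def)
  have maps: "x \<xi> \<in> s_space" if "\<xi> \<in> s'_space" for \<xi>
    using cont that unfolding continuous_map_def topspace_s_top s'_top_eq
      seminormed_space.topspace_eq[OF seminormed_s'] by auto
  have "\<exists>C. \<forall>\<xi>\<in>s'_step q. s_norm q (x \<xi>) \<le> C * s'_norm q \<xi>" for q
  proof -
    have "s_norm q \<in> range s_norm" by simp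
    from continuous_map_imp_bound[OF seminormed_s' s.seminormed_space_axioms lin
        cont[unfolded s_top_def s'_top_eq] this]
    obtain F C where F: "finite F" "F \<subseteq> s'_seminorms" "0 < C"
      and le: "\<forall>\<xi>\<in>s'_space. s_norm q (x \<xi>) \<le> C * (\<Sum>p\<in>F. p \<xi>)" by metis
    have "\<forall>p\<in>F. \<exists>C. \<forall>\<xi>\<in>s'_step q. p \<xi> \<le> C * s'_norm q \<xi>"
      using F(2) by (auto simp: s'_seminorms_def)
    from bchoice[OF this] obtain c where c: "\<forall>p\<in>F. \<forall>\<xi>\<in>s'_step q. p \<xi> \<le> c p * s'_norm q \<xi>"
      by (rule exE)
    have "s_norm q (x \<xi>) \<le> (C * (\<Sum>p\<in>F. c p)) * s'_norm q \<xi>" if \<xi>: "\<xi> \<in> s'_step q" for \<xi>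
    proof -
      have "(\<Sum>p\<in>F. p \<xi>) \<le> (\<Sum>p\<in>F. c p * s'_norm q \<xi>)" using c \<xi> by (intro sum_mono) auto
      then have "C * (\<Sum>p\<in>F. p \<xi>) \<le> C * (\<Sum>p\<in>F. c p * s'_norm q \<xi>)"
        using F(3) by (intro mult_left_mono) auto
      moreover have "s_norm q (x \<xi>) \<le> C * (\<Sum>p\<in>F. p \<xi>)" using le \<xi> s'_step_subset by auto
      ultimately show ?thesis by (simp add: sum_distrib_right mult.assoc)
    qed
    then show ?thesis by blast
  qed
  then show ?R using lin maps out by blast
next
  assume R: ?R
  then have lin: "clinear_on s'_space x" and maps: "\<And>\<xi>. \<xi> \<in> s'_space \<Longrightarrow> x \<xi> \<in> s_space" by auto
  have "continuous_map s'_top s_top x"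
    unfolding s'_top_eq s_top_def
  proof (rule bound_imp_continuous_map[OF seminormed_s' s.seminormed_space_axioms lin maps])
    fix p assume "p \<in> range s_norm"
    then obtain q where p: "p = s_norm q" by (rule rangeE)
    have "seminorm_on s'_space (\<lambda>\<xi>. s_norm q (x \<xi>))"
      unfolding seminorm_on_def
      by (auto simp: clinear_on_add[OF lin] clinear_on_scaleC[OF lin] maps s_norm_nonneg
          intro: seminorm_on_add[OF s.grade_seminorm] seminorm_on_scaleC[OF s.grade_seminorm])
    moreover have "\<exists>C. \<forall>\<xi>\<in>s'_step n. s_norm q (x \<xi>) \<le> C * s'_norm n \<xi>" for n
    proof -
      obtain C where C: "\<forall>\<xi>\<in>s'_step (max q n). s_norm (max q n) (x \<xi>) \<le> C * s'_norm (max q n) \<xi>"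
        using R by blast
      have "s_norm q (x \<xi>) \<le> \<bar>C\<bar> * s'_norm n \<xi>" if \<xi>: "\<xi> \<in> s'_step n" for \<xi>
      proof -
        have \<xi>': "\<xi> \<in> s'_step (max q n)" "s'_norm (max q n) \<xi> \<le> s'_norm n \<xi>"
          using s'_step_mono[OF _ \<xi>, of "max q n"] by auto
        have "s_norm q (x \<xi>) \<le> s_norm (max q n) (x \<xi>)"
          using maps \<xi> s'_step_subset by (intro s.mono) auto
        also have "\<dots> \<le> C * s'_norm (max q n) \<xi>" using C \<xi>'(1) by blast
        also have "\<dots> \<le> \<bar>C\<bar> * s'_norm n \<xi>"
          using \<xi>' s'_norm_nonneg[OF \<xi>'(1)] by (intro mult_mono) auto
        finally show ?thesis .
      qed
      then show ?thesis by blast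
    qed
    ultimately have "(\<lambda>\<xi>. s_norm q (x \<xi>)) \<in> s'_seminorms" by (simp add: s'_seminorms_def)
    then show "\<exists>p'\<in>s'_seminorms. \<exists>C. \<forall>\<xi>\<in>s'_space. p (x \<xi>) \<le> C * p' \<xi>"
      unfolding p by (rule bexI[rotated]) (auto intro!: exI[of _ 1])
  qed
  then show "x \<in> L_space" using R unfolding L_space_def by blast
qed

lemma L_linear: "x \<in> L_space \<Longrightarrow> clinear_on s'_space x"
  and L_maps: "x \<in> L_space \<Longrightarrow> \<xi> \<in> s'_space \<Longrightarrow> x \<xi> \<in> s_space"
  and L_outside: "x \<in> L_space \<Longrightarrow> \<xi> \<notin> s'_space \<Longrightarrow> x \<xi> = 0"
  by (simp_all add: L_space_iff)

lemma L_maps_step: "x \<in> L_space \<Longrightarrow> \<xi> \<in> s'_step q \<Longrightarrow> x \<xi> \<in> s_space"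
  by (rule L_maps) (use s'_step_subset in blast)+

text \<open>
  The supremum defining \<open>L_norm q\<close> is one of real numbers, so its boundedness has to be established
  before the expected operator norm inequality is available.
\<close>

lemma L_norm_bound:
  assumes x: "x \<in> L_space" and \<xi>: "\<xi> \<in> s'_step q"
  shows "s_norm q (x \<xi>) \<le> L_norm q x * s'_norm q \<xi>"
proof -
  obtain C where C: "\<And>\<xi>. \<xi> \<in> s'_step q \<Longrightarrow> s_norm q (x \<xi>) \<le> C * s'_norm q \<xi>"
    using x unfolding L_space_iff by blast
  let ?B = "{\<xi> \<in> s'_step q. s'_norm q \<xi> \<le> 1}"
  have bdd: "bdd_above ((\<lambda>\<xi>. s_norm q (x \<xi>)) ` ?B)"
  proof (rule bdd_aboveI2)
    fix \<xi> assume \<xi>: "\<xi> \<in> ?B"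
    then have "s_norm q (x \<xi>) \<le> C * s'_norm q \<xi>" using C by blast
    also have "\<dots> \<le> \<bar>C\<bar> * 1" using \<xi> s'_norm_nonneg[of \<xi> q] by (intro mult_mono) auto
    finally show "s_norm q (x \<xi>) \<le> \<bar>C\<bar> * 1" .
  qed
  show ?thesis
  proof (cases "s'_norm q \<xi> = 0")
    case True
    then show ?thesis using C[OF \<xi>] by simp
  next
    case False
    define a where "a = s'_norm q \<xi>"
    have a: "0 < a" using False s'_norm_nonneg[OF \<xi>] by (simp add: a_def)
    let ?\<eta> = "complex_of_real (1 / a) *\<^sub>C \<xi>"
    have "s'_norm q ?\<eta> = 1"
      using seminorm_on_scaleC[OF s'_norm_seminorm \<xi>, of "complex_of_real (1 / a)"] a
      by (simp add: a_def[symmetric] norm_divide)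
    then have "?\<eta> \<in> ?B" using cvec.subspace_scale[OF s'_step_subspace \<xi>] by simp
    then have "s_norm q (x ?\<eta>) \<le> L_norm q x" unfolding L_norm_def by (rule cSUP_upper[OF _ bdd])
    moreover have "s_norm q (x ?\<eta>) = 1 / a * s_norm q (x \<xi>)"
      using clinear_on_scaleC[OF L_linear[OF x] subsetD[OF s'_step_subset \<xi>], of "complex_of_real (1 / a)"]
        seminorm_on_scaleC[OF s.grade_seminorm L_maps_step[OF x \<xi>], of q "complex_of_real (1 / a)"] a
      by (auto simp: norm_divide)
    ultimately show ?thesis using a by (simp add: a_def[symmetric] divide_le_eq)
  qed
qed

lemma L_norm_le:
  assumes "\<And>\<xi>. \<xi> \<in> s'_step q \<Longrightarrow> s_norm q (x \<xi>) \<le> K * s'_norm q \<xi>" "0 \<le> K"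
  shows "L_norm q x \<le> K"
  unfolding L_norm_def
proof (rule cSUP_least)
  have "s'_norm q 0 = 0" by (rule seminorm_on_zero[OF s'_step_subspace s'_norm_seminorm])
  then have "0 \<in> {\<xi> \<in> s'_step q. s'_norm q \<xi> \<le> 1}"
    using cvec.subspace_0[OF s'_step_subspace] by simp
  then show "{\<xi> \<in> s'_step q. s'_norm q \<xi> \<le> 1} \<noteq> {}" by blast
  fix \<xi> assume \<xi>: "\<xi> \<in> {\<xi> \<in> s'_step q. s'_norm q \<xi> \<le> 1}"
  then have "s_norm q (x \<xi>) \<le> K * s'_norm q \<xi>" using assms(1) by simp
  also have "\<dots> \<le> K * 1" using \<xi> assms(2) by (intro mult_left_mono) auto
  finally show "s_norm q (x \<xi>) \<le> K" by simp
qed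

definition unit_seq :: "nat \<Rightarrow> cseq" where "unit_seq i = (\<lambda>j. if j = i then 1 else 0)"

lemma unit_seq_in_s: "unit_seq i \<in> s_space"
  unfolding s_space_def unit_seq_def
  by (auto intro!: summable_finite[of "{i}"] split: if_splits)

lemma L_norm_nonneg:
  assumes x: "x \<in> L_space"
  shows "0 \<le> L_norm q x"
proof (rule ccontr)
  assume neg: "\<not> 0 \<le> L_norm q x"
  let ?\<xi> = "unit_seq 0"
  have \<xi>: "?\<xi> \<in> s'_step q" by (rule s_subset_s'_step(1)[OF unit_seq_in_s])
  have "cmod (?\<xi> 0) * sqrt (1 / s_weight q 0) \<le> s'_norm q ?\<xi>"
    using wnorm_coordinate_le[of "\<lambda>j. 1 / s_weight q j" ?\<xi> 0] \<xi> unfolding s'_step_eq s'_norm_eq_wnorm by auto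
  then have "0 < s'_norm q ?\<xi>" by (simp add: unit_seq_def)
  with neg have "L_norm q x * s'_norm q ?\<xi> < 0" by (simp add: mult_neg_pos)
  moreover have "0 \<le> s_norm q (x ?\<xi>)" by (rule s_norm_nonneg[OF L_maps_step[OF x \<xi>]])
  ultimately show False using L_norm_bound[OF x \<xi>] by simp
qed

lemma L_space_add:
  assumes x: "x \<in> L_space" and y: "y \<in> L_space"
  shows "x + y \<in> L_space" "L_norm q (x + y) \<le> L_norm q x + L_norm q y"
proof -
  have b: "s_norm q ((x + y) \<xi>) \<le> (L_norm q x + L_norm q y) * s'_norm q \<xi>" if \<xi>: "\<xi> \<in> s'_step q" for q \<xi>
  proof -
    have "s_norm q ((x + y) \<xi>) \<le> s_norm q (x \<xi>) + s_norm q (y \<xi>)"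
      using seminorm_on_add[OF s.grade_seminorm L_maps_step[OF x \<xi>] L_maps_step[OF y \<xi>]] by simp
    then show ?thesis
      using L_norm_bound[OF x \<xi>] L_norm_bound[OF y \<xi>] by (simp add: distrib_right)
  qed
  have "clinear_on s'_space (x + y)"
    using L_linear[OF x] L_linear[OF y] by (auto simp: clinear_on_def scaleC_add_right)
  then show "x + y \<in> L_space"
    using b L_maps[OF x] L_maps[OF y] L_outside[OF x] L_outside[OF y]
    by (auto simp: L_space_iff intro: cvec.subspace_add[OF s.subspace])
  show "L_norm q (x + y) \<le> L_norm q x + L_norm q y"
    using b L_norm_nonneg[OF x] L_norm_nonneg[OF y] by (intro L_norm_le) auto
qed

lemma L_space_scaleC:
  assumes x: "x \<in> L_space"
  shows "c *\<^sub>C x \<in> L_space" "L_norm q (c *\<^sub>C x) \<le> cmod c * L_norm q x"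
proof -
  have b: "s_norm q ((c *\<^sub>C x) \<xi>) \<le> (cmod c * L_norm q x) * s'_norm q \<xi>" if \<xi>: "\<xi> \<in> s'_step q" for q \<xi>
    using seminorm_on_scaleC[OF s.grade_seminorm L_maps_step[OF x \<xi>], of q c] L_norm_bound[OF x \<xi>]
    by (simp add: scaleC_fun_def mult.assoc mult_left_mono)
  have "clinear_on s'_space (c *\<^sub>C x)"
    using L_linear[OF x] by (auto simp: clinear_on_def scaleC_fun_def[of c x] scaleC_add_right cvec.scale_left_commute)
  then show "c *\<^sub>C x \<in> L_space"
    using b L_maps[OF x] L_outside[OF x]
    by (auto simp: L_space_iff scaleC_fun_def[of c x] intro: cvec.subspace_scale[OF s.subspace])
  show "L_norm q (c *\<^sub>C x) \<le> cmod c * L_norm q x"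
    using b L_norm_nonneg[OF x] by (intro L_norm_le) auto
qed

lemma graded_L: "graded_space L_space L_norm"
proof unfold_locales
  have "0 \<in> L_space"
    using seminorm_on_zero[OF s.subspace s.grade_seminorm] cvec.subspace_0[OF s.subspace]
    by (auto simp: L_space_iff clinear_on_def intro!: exI[of _ 0])
  then show "cvec.subspace L_space"
    by (intro cvec.subspaceI L_space_add(1) L_space_scaleC(1))
  show "seminorm_on L_space (L_norm q)" for q
    unfolding seminorm_on_def
  proof (intro conjI ballI allI)
    fix c x assume x: "x \<in> L_space"
    show "L_norm q (c *\<^sub>C x) = cmod c * L_norm q x"
    proof (cases "c = 0")
      case True
      have "L_norm q (0 *\<^sub>C x) \<ge> 0" by (rule L_norm_nonneg[OF L_space_scaleC(1)[OF x]])
      then show ?thesis using L_space_scaleC(2)[OF x, of q 0] True by simp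
    next
      case False
      have "L_norm q (inverse c *\<^sub>C c *\<^sub>C x) \<le> cmod (inverse c) * L_norm q (c *\<^sub>C x)"
        by (rule L_space_scaleC(2)[OF L_space_scaleC(1)[OF x]])
      then have "cmod c * L_norm q x \<le> L_norm q (c *\<^sub>C x)"
        using False by (simp add: norm_divide field_simps)
      then show ?thesis using L_space_scaleC(2)[OF x, of q c] by simp
    qed
  qed (use L_norm_nonneg L_space_add(2) in auto)
  show "L_norm p x \<le> L_norm q x" if pq: "p \<le> q" and x: "x \<in> L_space" for p q x
  proof (rule L_norm_le[OF _ L_norm_nonneg[OF x]])
    fix \<xi> assume \<xi>: "\<xi> \<in> s'_step p"
    have \<xi>': "\<xi> \<in> s'_step q" "s'_norm q \<xi> \<le> s'_norm p \<xi>" by (rule s'_step_mono[OF pq \<xi>])+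
    have "s_norm p (x \<xi>) \<le> s_norm q (x \<xi>)" by (rule s.mono[OF pq L_maps_step[OF x \<xi>]])
    also have "\<dots> \<le> L_norm q x * s'_norm q \<xi>" by (rule L_norm_bound[OF x \<xi>'(1)])
    also have "\<dots> \<le> L_norm q x * s'_norm p \<xi>" by (rule mult_left_mono[OF \<xi>'(2) L_norm_nonneg[OF x]])
    finally show "s_norm p (x \<xi>) \<le> L_norm q x * s'_norm p \<xi>" .
  qed
qed

interpretation L: graded_space L_space L_norm by (rule graded_L)

lemma topspace_L_top: "topspace L_top = L_space"
  unfolding L_top_def by (rule L.topspace_eq)

text \<open>
  The limit is taken coordinatewise.  That it maps into \<open>s\<close>, is bounded, and is the limit in operator
  norm all follow from one estimate: on each step of \<open>s'\<close>, the difference to \<open>x m\<close> is a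
  coordinatewise limit of differences of small norm.
\<close>

lemma L_space_complete:
  fixes x :: "nat \<Rightarrow> cseq_op"
  assumes x: "\<And>n. x n \<in> L_space"
    and cauchy: "\<And>q e. 0 < e \<Longrightarrow> \<exists>M. \<forall>m\<ge>M. \<forall>n\<ge>M. L_norm q (x m - x n) < e"
  shows "\<exists>y. y \<in> L_space \<and> (\<forall>q. (\<lambda>n. L_norm q (x n - y)) \<longlonglongrightarrow> 0) \<and> (\<forall>\<xi> i. (\<lambda>n. x n \<xi> i) \<longlonglongrightarrow> y \<xi> i)"
proof -
  define y where "y = (\<lambda>\<xi> i. lim (\<lambda>n. x n \<xi> i))"
  have diff: "x m - x n \<in> L_space" for m n by (rule cvec.subspace_diff[OF L.subspace x x])
  have est: "s_norm q ((x m - x n) \<xi>) \<le> L_norm q (x m - x n) * s'_norm q \<xi>" if "\<xi> \<in> s'_step q" for q m n \<xi>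
    by (rule L_norm_bound[OF diff that])
  have lim: "(\<lambda>n. x n \<xi> i) \<longlonglongrightarrow> y \<xi> i" for \<xi> i
  proof (cases "\<xi> \<in> s'_space")
    case True
    then obtain q where q: "\<xi> \<in> s'_step q" by (auto simp: s'_space_def)
    have "Cauchy (\<lambda>n. x n \<xi> i)"
    proof (rule metric_CauchyI)
      fix e :: real assume "0 < e"
      define e' where "e' = e / (s'_norm q \<xi> + 1)"
      have pos: "0 < s'_norm q \<xi> + 1" using s'_norm_nonneg[OF q] by simp
      then have "0 < e'" using \<open>0 < e\<close> by (simp add: e'_def)
      then obtain M where M: "\<forall>m\<ge>M. \<forall>n\<ge>M. L_norm q (x m - x n) < e'" using cauchy by blast
      have "dist (x m \<xi> i) (x n \<xi> i) < e" if "m \<ge> M" "n \<ge> M" for m n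
      proof -
        have in_s: "(x m - x n) \<xi> \<in> s_space" by (rule L_maps[OF diff True])
        have "dist (x m \<xi> i) (x n \<xi> i) \<le> s_norm 0 ((x m - x n) \<xi>)"
          using s_norm_coordinate_le[OF in_s, of i 0] by (simp add: dist_norm)
        also have "\<dots> \<le> s_norm q ((x m - x n) \<xi>)" by (rule s.mono[OF _ in_s]) simp
        also have "\<dots> \<le> L_norm q (x m - x n) * s'_norm q \<xi>" by (rule est[OF q])
        also have "\<dots> \<le> L_norm q (x m - x n) * (s'_norm q \<xi> + 1)"
          by (rule mult_left_mono[OF _ L_norm_nonneg[OF diff]]) simp
        also have "\<dots> < e' * (s'_norm q \<xi> + 1)" using M that pos by (intro mult_strict_right_mono) auto
        also have "\<dots> = e" using pos by (simp add: e'_def)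
        finally show ?thesis .
      qed
      then show "\<exists>M. \<forall>m\<ge>M. \<forall>n\<ge>M. dist (x m \<xi> i) (x n \<xi> i) < e" by blast
    qed
    then show ?thesis unfolding y_def by (simp add: Cauchy_convergent_iff convergent_LIMSEQ_iff)
  next
    case False
    then have "(\<lambda>n. x n \<xi> i) = (\<lambda>n. 0)" using L_outside[OF x] by simp
    then show ?thesis unfolding y_def by (simp add: limI)
  qed
  have close: "(y - x m) \<xi> \<in> wspace (s_weight q) \<and> s_norm q ((y - x m) \<xi>) \<le> e * s'_norm q \<xi>"
    if \<xi>: "\<xi> \<in> s'_step q" and e: "0 < e" and M: "\<forall>n\<ge>M. L_norm q (x n - x m) < e" for q \<xi> e m M
  proof -
    have nn: "0 \<le> e * s'_norm q \<xi>" using e s'_norm_nonneg[OF \<xi>] by simp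
    have l: "(\<lambda>n. ((x n - x m) \<xi>) j) \<longlonglongrightarrow> ((y - x m) \<xi>) j" for j
      by (simp, intro tendsto_diff lim tendsto_const)
    have ev: "\<forall>\<^sub>F n in sequentially. (x n - x m) \<xi> \<in> wspace (s_weight q) \<and>
        wnorm (s_weight q) ((x n - x m) \<xi>) \<le> e * s'_norm q \<xi>"
      using eventually_ge_at_top[of M]
    proof eventually_elim
      case (elim n)
      have "L_norm q (x n - x m) * s'_norm q \<xi> \<le> e * s'_norm q \<xi>"
        using M elim s'_norm_nonneg[OF \<xi>] by (intro mult_right_mono) auto
      then have "s_norm q ((x n - x m) \<xi>) \<le> e * s'_norm q \<xi>" using est[OF \<xi>, of n m] by linarith
      then show ?case
        using s_in_wspace[OF L_maps_step[OF diff \<xi>], of n m q] unfolding s_norm_eq_wnorm by simp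
    qed
    show ?thesis
      using wnorm_pointwise_limit_le[where w = "s_weight q" and \<xi> = "(y - x m) \<xi>", OF _ nn l ev]
      unfolding s_norm_eq_wnorm by simp
  qed
  have tail: "\<exists>M. \<forall>m\<ge>M. \<forall>\<xi>\<in>s'_step q. (y - x m) \<xi> \<in> wspace (s_weight q) \<and>
      s_norm q ((y - x m) \<xi>) \<le> e * s'_norm q \<xi>" if e: "0 < e" for q e
  proof -
    obtain M where M: "\<forall>m\<ge>M. \<forall>n\<ge>M. L_norm q (x m - x n) < e" using cauchy[OF e] by blast
    have "\<forall>m\<ge>M. \<forall>\<xi>\<in>s'_step q. (y - x m) \<xi> \<in> wspace (s_weight q) \<and>
      s_norm q ((y - x m) \<xi>) \<le> e * s'_norm q \<xi>"
      using close[OF _ e] M by blast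
    then show ?thesis by blast
  qed
  have y_eq: "(y - x m) \<xi> + x m \<xi> = y \<xi>" for \<xi> m by simp
  have weight: "0 \<le> s_weight q j" for q j by simp
  have step: "y \<xi> \<in> wspace (s_weight q) \<and> (\<exists>m. s_norm q (y \<xi>) \<le> (1 + L_norm q (x m)) * s'_norm q \<xi>)"
    if \<xi>: "\<xi> \<in> s'_step q" for q \<xi>
  proof -
    obtain m where m: "(y - x m) \<xi> \<in> wspace (s_weight q)" "s_norm q ((y - x m) \<xi>) \<le> 1 * s'_norm q \<xi>"
      using tail[of 1 q] \<xi> by auto
    have xm: "x m \<xi> \<in> wspace (s_weight q)" by (rule s_in_wspace[OF L_maps_step[OF x \<xi>]])
    have "y \<xi> \<in> wspace (s_weight q)"
      using wnorm_triangle(1)[OF weight m(1) xm] by (simp only: y_eq)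
    moreover have "s_norm q (y \<xi>) \<le> s_norm q ((y - x m) \<xi>) + s_norm q (x m \<xi>)"
      using wnorm_triangle(2)[OF weight m(1) xm] by (simp only: y_eq s_norm_eq_wnorm)
    ultimately show ?thesis
      using m(2) L_norm_bound[OF x \<xi>, of m] by (auto simp: distrib_right intro!: exI[of _ m])
  qed
  have maps: "y \<xi> \<in> s_space" if \<xi>: "\<xi> \<in> s'_space" for \<xi>
    unfolding s_space_eq
  proof safe
    fix q
    obtain p where p: "\<xi> \<in> s'_step p" using \<xi> by (auto simp: s'_space_def)
    have "\<xi> \<in> s'_step (max p q)" by (rule s'_step_mono(1)[OF _ p]) simp
    then have "y \<xi> \<in> wspace (s_weight (max p q))" using step by blast
    then show "y \<xi> \<in> wspace (s_weight q)"
      using wnorm_mono(1)[of "s_weight q" "s_weight (max p q)"] s_weight_mono[of q "max p q"] by simp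
  qed
  have lin: "clinear_on s'_space y"
    unfolding clinear_on_def
  proof (intro conjI ballI allI ext)
    fix \<xi> \<eta> i assume "\<xi> \<in> s'_space" "\<eta> \<in> s'_space"
    then have "(\<lambda>n. x n (\<xi> + \<eta>) i) = (\<lambda>n. x n \<xi> i + x n \<eta> i)"
      using clinear_on_add[OF L_linear[OF x]] by simp
    then have "(\<lambda>n. x n (\<xi> + \<eta>) i) \<longlonglongrightarrow> y \<xi> i + y \<eta> i" by (simp add: tendsto_add lim)
    then show "y (\<xi> + \<eta>) i = (y \<xi> + y \<eta>) i" using LIMSEQ_unique[OF lim] by simp
  next
    fix c \<xi> i assume "\<xi> \<in> s'_space"
    then have "(\<lambda>n. x n (c *\<^sub>C \<xi>) i) = (\<lambda>n. c * x n \<xi> i)"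
      using clinear_on_scaleC[OF L_linear[OF x]] by (simp add: scaleC_fun_def scaleC_complex_def)
    then have "(\<lambda>n. x n (c *\<^sub>C \<xi>) i) \<longlonglongrightarrow> c * y \<xi> i" by (simp add: tendsto_mult lim)
    then show "y (c *\<^sub>C \<xi>) i = (c *\<^sub>C y \<xi>) i"
      using LIMSEQ_unique[OF lim] by (simp add: scaleC_fun_def scaleC_complex_def)
  qed
  have bounded: "\<exists>C. \<forall>\<xi>\<in>s'_step q. s_norm q (y \<xi>) \<le> C * s'_norm q \<xi>" for q
  proof -
    obtain M where M: "\<forall>m\<ge>M. \<forall>\<xi>\<in>s'_step q. (y - x m) \<xi> \<in> wspace (s_weight q) \<and>
      s_norm q ((y - x m) \<xi>) \<le> 1 * s'_norm q \<xi>" using tail[of 1 q] by auto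
    have "s_norm q (y \<xi>) \<le> (1 + L_norm q (x M)) * s'_norm q \<xi>" if \<xi>: "\<xi> \<in> s'_step q" for \<xi>
    proof -
      have m: "(y - x M) \<xi> \<in> wspace (s_weight q)" "s_norm q ((y - x M) \<xi>) \<le> 1 * s'_norm q \<xi>"
        using M \<xi> by auto
      have "s_norm q (y \<xi>) \<le> s_norm q ((y - x M) \<xi>) + s_norm q (x M \<xi>)"
        using wnorm_triangle(2)[OF weight m(1) s_in_wspace[OF L_maps_step[OF x[of M] \<xi>]]]
        by (simp only: y_eq s_norm_eq_wnorm)
      then show ?thesis using m(2) L_norm_bound[OF x \<xi>, of M] by (simp add: distrib_right)
    qed
    then show ?thesis by blast
  qed
  have "y \<xi> = 0" if "\<xi> \<notin> s'_space" for \<xi>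
  proof
    fix i
    have "(\<lambda>n. x n \<xi> i) = (\<lambda>n. 0)" using L_outside[OF x that] by simp
    then show "y \<xi> i = 0 i" using LIMSEQ_unique[OF lim[of \<xi> i]] by (simp add: LIMSEQ_const_iff)
  qed
  then have y: "y \<in> L_space" unfolding L_space_iff using lin maps bounded by blast
  have "(\<lambda>n. L_norm q (x n - y)) \<longlonglongrightarrow> 0" for q
  proof (rule LIMSEQ_I)
    fix e :: real assume "0 < e"
    then have "0 < e / 2" by simp
    from tail[OF this, of q] obtain M where M: "\<forall>m\<ge>M. \<forall>\<xi>\<in>s'_step q.
      (y - x m) \<xi> \<in> wspace (s_weight q) \<and> s_norm q ((y - x m) \<xi>) \<le> e / 2 * s'_norm q \<xi>" by blast
    have "norm (L_norm q (x n - y) - 0) < e" if "n \<ge> M" for n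
    proof -
      have "L_norm q (y - x n) \<le> e / 2" using M that \<open>0 < e\<close> by (intro L_norm_le) auto
      then have "L_norm q (x n - y) \<le> e / 2"
        using seminorm_on_minus_commute[OF L.subspace L.grade_seminorm y x] by simp
      then show ?thesis
        using L_norm_nonneg[OF cvec.subspace_diff[OF L.subspace x y]] \<open>0 < e\<close> by (simp add: abs_of_nonneg)
    qed
    then show "\<exists>M. \<forall>n\<ge>M. norm (L_norm q (x n - y) - 0) < e" by blast
  qed
  then show ?thesis using y lim by (intro exI[of _ y] conjI allI)
qed

definition trunc :: "nat \<Rightarrow> cseq \<Rightarrow> cseq" where
  "trunc n \<xi> = (\<lambda>j. if j < n then \<xi> j else 0)"

lemma trunc_in_s: "trunc n \<xi> \<in> s_space"
  unfolding s_space_def trunc_def by (auto intro!: summable_finite[of "{..<n}"] split: if_splits)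

lemma s'_norm_tail:
  assumes \<xi>: "\<xi> \<in> s'_step q"
  shows "\<xi> - trunc n \<xi> \<in> s'_step (Suc q)" "s'_norm (Suc q) (\<xi> - trunc n \<xi>) \<le> 1 / real (Suc n) * s'_norm q \<xi>"
proof -
  have le: "1 / s_weight (Suc q) j \<le> (1 / real (Suc n))\<^sup>2 * (1 / s_weight q j)"
    if "(\<xi> - trunc n \<xi>) j \<noteq> 0" for j
  proof -
    have "n \<le> j" using that by (auto simp: trunc_def split: if_splits)
    then have "(real (Suc n))\<^sup>2 \<le> (real (Suc j))\<^sup>2" by (intro power_mono) auto
    then have "1 / (real (Suc j))\<^sup>2 * (1 / s_weight q j) \<le> 1 / (real (Suc n))\<^sup>2 * (1 / s_weight q j)"
      by (intro mult_right_mono divide_left_mono) auto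
    then show ?thesis by (simp add: power2_eq_square mult.assoc power_divide)
  qed
  have "cmod ((\<xi> - trunc n \<xi>) j) \<le> cmod (\<xi> j)" for j by (simp add: trunc_def)
  with le show "\<xi> - trunc n \<xi> \<in> s'_step (Suc q)" "s'_norm (Suc q) (\<xi> - trunc n \<xi>) \<le> 1 / real (Suc n) * s'_norm q \<xi>"
    using wnorm_le_on_support[of "\<lambda>j. 1 / s_weight (Suc q) j" "\<lambda>j. 1 / s_weight q j" "1 / real (Suc n)" \<xi> "\<xi> - trunc n \<xi>"] \<xi>
    unfolding s'_step_eq s'_norm_eq_wnorm by (auto simp del: of_nat_Suc)
qed

text \<open>
  Elements of \<open>s'\<close> are approximated by their truncations in the next step, so operators in
  \<open>L_space\<close> are determined by their values on \<open>s\<close>.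
\<close>

lemma L_eqI:
  assumes x: "x \<in> L_space" and y: "y \<in> L_space" and eq: "\<And>\<xi>. \<xi> \<in> s_space \<Longrightarrow> x \<xi> = y \<xi>"
  shows "x = y"
proof
  fix \<xi>
  show "x \<xi> = y \<xi>"
  proof (cases "\<xi> \<in> s'_space")
    case False
    then show ?thesis using L_outside[OF x] L_outside[OF y] by simp
  next
    case True
    then obtain q where q: "\<xi> \<in> s'_step q" by (auto simp: s'_space_def)
    define d where "d = x - y"
    have d: "d \<in> L_space" unfolding d_def by (rule cvec.subspace_diff[OF L.subspace x y])
    have "s_norm (Suc q) (d \<xi>) \<le> L_norm (Suc q) d * s'_norm q \<xi> * (1 / real (Suc n))" for n
    proof -
      have "d (\<xi> - trunc n \<xi>) = d \<xi> - d (trunc n \<xi>)"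
        by (rule clinear_on_diff[OF s'_space_subspace L_linear[OF d] True s_subset_s'[OF trunc_in_s]])
      also have "d (trunc n \<xi>) = 0" unfolding d_def using eq[OF trunc_in_s] by simp
      finally have "s_norm (Suc q) (d \<xi>) = s_norm (Suc q) (d (\<xi> - trunc n \<xi>))"
        by (simp only: diff_zero)
      also have "\<dots> \<le> L_norm (Suc q) d * s'_norm (Suc q) (\<xi> - trunc n \<xi>)"
        by (rule L_norm_bound[OF d s'_norm_tail(1)[OF q]])
      also have "\<dots> \<le> L_norm (Suc q) d * (1 / real (Suc n) * s'_norm q \<xi>)"
        by (rule mult_left_mono[OF s'_norm_tail(2)[OF q] L_norm_nonneg[OF d]])
      finally show ?thesis by (simp add: mult_ac)
    qed
    moreover have "(\<lambda>n. L_norm (Suc q) d * s'_norm q \<xi> * (1 / real (Suc n))) \<longlonglongrightarrow> L_norm (Suc q) d * s'_norm q \<xi> * 0"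
      by (intro tendsto_intros LIMSEQ_Suc[OF lim_1_over_n])
    ultimately have "s_norm (Suc q) (d \<xi>) \<le> 0" by (intro tendsto_lowerbound) auto
    moreover have d\<xi>: "d \<xi> \<in> s_space" by (rule L_maps[OF d True])
    ultimately have "d \<xi> = 0" using s.mono[of 0 "Suc q", OF _ d\<xi>] by (intro s_norm_zero_imp) auto
    then show ?thesis by (simp add: d_def)
  qed
qed

lemma pairing_unit_seq: "pairing (unit_seq i) \<eta> = cnj (\<eta> i)"
proof -
  have "(\<lambda>j. unit_seq i j * cnj (\<eta> j)) = (\<lambda>j. if j = i then cnj (\<eta> j) else 0)"
    by (auto simp: unit_seq_def)
  then show ?thesis unfolding pairing_def using sums_single[of i "\<lambda>j. cnj (\<eta> j)"] by (simp add: sums_iff)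
qed

text \<open>
  Testing against the unit sequences shows that two adjoints agree on \<open>s\<close>; this gives the uniqueness
  required by the definite description in \<open>L_star\<close>.
\<close>

lemma L_star_eqI:
  assumes y: "y \<in> L_space" and adj: "\<And>\<xi> \<eta>. \<xi> \<in> ell2 \<Longrightarrow> \<eta> \<in> ell2 \<Longrightarrow> pairing (x \<xi>) \<eta> = pairing \<xi> (y \<eta>)"
  shows "L_star x = y"
  unfolding L_star_def
proof (rule the_equality)
  fix z assume z: "z \<in> L_space \<and> (\<forall>\<xi>\<in>ell2. \<forall>\<eta>\<in>ell2. pairing (x \<xi>) \<eta> = pairing \<xi> (z \<eta>))"
  show "z = y"
  proof (rule L_eqI)
    fix \<eta> assume \<eta>: "\<eta> \<in> s_space"
    show "z \<eta> = y \<eta>"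
    proof
      fix i
      have u: "unit_seq i \<in> ell2" and \<eta>': "\<eta> \<in> ell2" using unit_seq_in_s \<eta> by (auto intro: s_subset_ell2)
      have "pairing (unit_seq i) (z \<eta>) = pairing (unit_seq i) (y \<eta>)" using z adj[OF u \<eta>'] u \<eta>' by metis
      then show "z \<eta> i = y \<eta> i" by (simp add: pairing_unit_seq)
    qed
  qed (use y z in auto)
qed (use y adj in auto)


section \<open>Interpolation and property \<open>(\<Omega>)\<close>\<close>

lemma s_norm_tail:
  assumes \<xi>: "\<xi> \<in> s_space"
  shows "s_norm q (\<xi> - trunc n \<xi>) \<le> 1 / real (Suc n) * s_norm (Suc q) \<xi>"
proof -
  have le: "s_weight q j \<le> (1 / real (Suc n))\<^sup>2 * s_weight (Suc q) j"
    if "(\<xi> - trunc n \<xi>) j \<noteq> 0" for j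
  proof -
    have "n \<le> j" using that by (auto simp: trunc_def split: if_splits)
    then have "(real (Suc n))\<^sup>2 \<le> (real (Suc j))\<^sup>2" by (intro power_mono) auto
    then have "(real (Suc n))\<^sup>2 * s_weight q j \<le> (real (Suc j))\<^sup>2 * s_weight q j"
      by (intro mult_right_mono) auto
    moreover have "s_weight (Suc q) j = (real (Suc j))\<^sup>2 * s_weight q j"
      by (simp add: power2_eq_square mult.assoc)
    ultimately show ?thesis by (simp add: power_divide pos_le_divide_eq mult.commute del: of_nat_Suc power_Suc)
  qed
  have "cmod ((\<xi> - trunc n \<xi>) j) \<le> cmod (\<xi> j)" for j by (simp add: trunc_def)
  with le show ?thesis
    using wnorm_le_on_support(2)[of "s_weight q" "s_weight (Suc q)" "1 / real (Suc n)" \<xi> "\<xi> - trunc n \<xi>"]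
      s_in_wspace[OF \<xi>, of "Suc q"]
    unfolding s_norm_eq_wnorm by (auto simp del: of_nat_Suc power_Suc mult_Suc_right)
qed

lemma s_norm_trunc:
  assumes \<xi>: "\<xi> \<in> s_space"
  shows "s_norm (q + d) (trunc n \<xi>) \<le> real n ^ d * s_norm q \<xi>"
proof -
  have le: "s_weight (q + d) j \<le> (real n ^ d)\<^sup>2 * s_weight q j" if "trunc n \<xi> j \<noteq> 0" for j
  proof -
    have "Suc j \<le> n" using that by (auto simp: trunc_def split: if_splits)
    then have "real (Suc j) ^ (2 * d) \<le> real n ^ (2 * d)" by (intro power_mono) auto
    then have "real (Suc j) ^ (2 * d) * s_weight q j \<le> real n ^ (2 * d) * s_weight q j"
      by (intro mult_right_mono) auto
    then show ?thesis unfolding power_mult[symmetric] by (simp add: power_add[symmetric] mult.commute add.commute distrib_left)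
  qed
  have "cmod (trunc n \<xi> j) \<le> cmod (\<xi> j)" for j by (simp add: trunc_def)
  with le show ?thesis
    using wnorm_le_on_support(2)[of "s_weight (q + d)" "s_weight q" "real n ^ d" \<xi> "trunc n \<xi>"]
      s_in_wspace[OF \<xi>]
    unfolding s_norm_eq_wnorm by auto
qed

text \<open>
  The inequality behind \<open>(\<Omega>)\<close> for \<open>s\<close>.  Cutting \<open>\<xi>\<close> at \<open>n\<close>, the first part is estimated with \<open>A\<close> at the
  cost of \<open>n ^ d\<close>, the tail with \<open>B\<close> with a gain of \<open>1 / n\<close>; the choice \<open>n = (B / A) powr \<theta>\<close> balances
  both, and \<open>\<theta>\<close> is determined by \<open>\<theta> * d = 1 - \<theta>\<close>.
\<close>

lemma s_functional_interpolation:
  assumes lin: "clinear_on s_space z" and d: "0 < d" and A: "0 \<le> A" and B: "0 \<le> B"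
    and zB: "\<And>\<xi>. \<xi> \<in> s_space \<Longrightarrow> cmod (z \<xi>) \<le> B * s_norm p \<xi>"
    and zA: "\<And>\<xi>. \<xi> \<in> s_space \<Longrightarrow> cmod (z \<xi>) \<le> A * s_norm (Suc p + d) \<xi>"
    and \<theta>: "\<theta> = 1 / real (Suc d)" and \<xi>: "\<xi> \<in> s_space"
  shows "cmod (z \<xi>) \<le> (2 ^ d + 1) * (B powr (1 - \<theta>) * A powr \<theta>) * s_norm (Suc p) \<xi>"
proof -
  define N where "N = s_norm (Suc p) \<xi>"
  have N: "0 \<le> N" "s_norm p \<xi> \<le> N" unfolding N_def using \<xi> by (auto intro: s_norm_nonneg s.mono)
  have \<theta>01: "0 < \<theta>" "\<theta> < 1" using d unfolding \<theta> by auto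
  consider "A = 0 \<or> B = 0" | "0 < B" "B \<le> A" | "0 < A" "A < B" using A B by linarith
  then show ?thesis
  proof cases
    case 1
    then have "cmod (z \<xi>) \<le> 0" using zA[OF \<xi>] zB[OF \<xi>] by auto
    moreover have "0 \<le> (2 ^ d + 1) * (B powr (1 - \<theta>) * A powr \<theta>) * N" using N by simp
    ultimately show ?thesis unfolding N_def by linarith
  next
    case 2
    have "B = B powr (1 - \<theta>) * B powr \<theta>" using 2 by (simp add: powr_add[symmetric])
    also have "\<dots> \<le> B powr (1 - \<theta>) * A powr \<theta>"
      using 2 \<theta>01 by (intro mult_left_mono powr_mono2) auto
    also have "\<dots> \<le> (2 ^ d + 1) * (B powr (1 - \<theta>) * A powr \<theta>)"
      using mult_right_mono[of 1 "2 ^ d + 1 :: real" "B powr (1 - \<theta>) * A powr \<theta>"] by simp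
    finally have "B * N \<le> (2 ^ d + 1) * (B powr (1 - \<theta>) * A powr \<theta>) * N" using N by (intro mult_right_mono)
    moreover have "B * s_norm p \<xi> \<le> B * N" using N B by (intro mult_left_mono)
    ultimately show ?thesis using zB[OF \<xi>] unfolding N_def by linarith
  next
    case 3
    \<comment> \<open>Rounding \<open>t \<ge> 1\<close> up to an integer at most doubles it; this is the origin of the factor \<open>2 ^ d\<close>.\<close>
    define t where "t = (B / A) powr \<theta>"
    define n where "n = nat \<lceil>t\<rceil>"
    have t1: "1 \<le> t" unfolding t_def using 3 \<theta>01 by (intro ge_one_powr_ge_zero) auto
    have n: "t \<le> real n" "real n \<le> 2 * t" using t1 unfolding n_def by linarith+
    let ?M = "B powr (1 - \<theta>) * A powr \<theta>"
    have AM: "A * t ^ d = ?M"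
    proof -
      have "t ^ d = (B / A) powr (\<theta> * real d)"
        unfolding t_def using 3 by (simp add: powr_powr[symmetric] powr_realpow)
      also have "\<theta> * real d = 1 - \<theta>" unfolding \<theta> by (simp add: field_simps)
      also have "(B / A) powr (1 - \<theta>) = B powr (1 - \<theta>) / A powr (1 - \<theta>)" using 3 by (intro powr_divide)
      finally have "A * t ^ d = B powr (1 - \<theta>) * (A powr 1 / A powr (1 - \<theta>))" using 3 by simp
      also have "A powr 1 / A powr (1 - \<theta>) = A powr \<theta>" unfolding powr_diff[symmetric] by simp
      finally show ?thesis .
    qed
    have BM: "B / t = ?M"
    proof -
      have "B / t = B powr 1 / (B powr \<theta> / A powr \<theta>)" unfolding t_def using 3 by (simp add: powr_divide)
      also have "\<dots> = B powr (1 - \<theta>) * A powr \<theta>" unfolding powr_diff using 3 by simp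
      finally show ?thesis .
    qed
    have tail_s: "\<xi> - trunc n \<xi> \<in> s_space" by (rule cvec.subspace_diff[OF s.subspace \<xi> trunc_in_s])
    have "z \<xi> = z (trunc n \<xi> + (\<xi> - trunc n \<xi>))" by simp
    also have "\<dots> = z (trunc n \<xi>) + z (\<xi> - trunc n \<xi>)" by (rule clinear_on_add[OF lin trunc_in_s tail_s])
    finally have "cmod (z \<xi>) \<le> cmod (z (trunc n \<xi>)) + cmod (z (\<xi> - trunc n \<xi>))"
      using norm_triangle_ineq by metis
    moreover have "cmod (z (trunc n \<xi>)) \<le> 2 ^ d * ?M * N"
    proof -
      have "cmod (z (trunc n \<xi>)) \<le> A * (real n ^ d * N)"
        using zA[OF trunc_in_s, of n \<xi>] mult_left_mono[OF s_norm_trunc[OF \<xi>, of "Suc p" d n] A]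
        unfolding N_def by linarith
      also have "\<dots> \<le> A * ((2 * t) ^ d * N)"
        using n N t1 A by (intro mult_left_mono mult_right_mono power_mono) auto
      also have "\<dots> = 2 ^ d * (A * t ^ d) * N" by (simp add: power_mult_distrib)
      finally show ?thesis unfolding AM .
    qed
    moreover have "cmod (z (\<xi> - trunc n \<xi>)) \<le> ?M * N"
    proof -
      have "cmod (z (\<xi> - trunc n \<xi>)) \<le> B * (1 / real (Suc n) * N)"
        using zB[OF tail_s] mult_left_mono[OF s_norm_tail[OF \<xi>, of p n] B] unfolding N_def by linarith
      also have "\<dots> \<le> B * (1 / t * N)"
        using n N t1 B by (intro mult_left_mono mult_right_mono divide_left_mono) auto
      also have "\<dots> = (B / t) * N" by simp
      finally show ?thesis unfolding BM .
    qed
    ultimately show ?thesis unfolding N_def[symmetric] by (simp add: distrib_right)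
  qed
qed

text \<open>
  If \<open>p x = 0\<close> then \<open>x\<close> cannot be normalized, hence the detour over numbers \<open>t\<close> above \<open>p x\<close>.
\<close>

lemma dual_norm_bound:
  assumes V: "cvec.subspace V" and p: "seminorm_on V p" and lin: "clinear_on V y"
    and D: "dual_norm V p y = ennreal D" "0 \<le> D" and x: "x \<in> V"
  shows "cmod (y x) \<le> D * p x"
proof -
  have unit: "cmod (y u) \<le> D" if "u \<in> V" "p u \<le> 1" for u
  proof -
    have "ennreal (cmod (y u)) \<le> dual_norm V p y" unfolding dual_norm_def using that by (intro SUP_upper) auto
    then show ?thesis using D by simp
  qed
  have scale: "cmod (y x) \<le> D * t" if t: "p x < t" for t
  proof -
    have t0: "0 < t" using seminorm_on_nonneg[OF p x] t by simp
    let ?u = "complex_of_real (1 / t) *\<^sub>C x"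
    have "p ?u = 1 / t * p x" using seminorm_on_scaleC[OF p x, of "complex_of_real (1 / t)"] t0 by (simp add: norm_divide)
    then have "p ?u \<le> 1" using t t0 by simp
    from unit[OF cvec.subspace_scale[OF V x] this] have "cmod (y ?u) \<le> D" .
    moreover have "y ?u = complex_of_real (1 / t) * y x"
      using clinear_on_scaleC[OF lin x, of "complex_of_real (1 / t)"] by (simp add: scaleC_complex_def)
    ultimately show ?thesis using t0 by (simp add: norm_divide norm_mult pos_divide_le_eq mult.commute)
  qed
  show ?thesis
  proof (rule tendsto_lowerbound)
    show "(\<lambda>n. D * (p x + 1 / real (Suc n))) \<longlonglongrightarrow> D * p x"
      using tendsto_mult[OF tendsto_const tendsto_add[OF tendsto_const LIMSEQ_Suc[OF lim_1_over_n]], of D "p x"] by simp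
    show "\<forall>\<^sub>F n in sequentially. cmod (y x) \<le> D * (p x + 1 / real (Suc n))"
      by (intro always_eventually allI scale) simp
  qed simp
qed

lemma dual_norm_le:
  assumes "\<And>x. x \<in> V \<Longrightarrow> cmod (y x) \<le> D * p x" "0 \<le> D"
  shows "dual_norm V p y \<le> ennreal D"
  unfolding dual_norm_def
proof (rule SUP_least)
  fix x assume x: "x \<in> {x \<in> V. p x \<le> 1}"
  then have "cmod (y x) \<le> D * p x" using assms by simp
  also have "\<dots> \<le> D * 1" using x assms by (intro mult_left_mono) auto
  finally show "ennreal (cmod (y x)) \<le> ennreal D" by (simp add: ennreal_leI)
qed

lemma dual_norm_eq_0:
  assumes "cvec.subspace V" "seminorm_on V p" "clinear_on V y" "dual_norm V p y = 0"
  shows "dual_norm V p' y = 0"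
proof -
  have "cmod (y x) \<le> 0 * p x" if "x \<in> V" for x
    by (rule dual_norm_bound[OF assms(1-3) _ _ that]) (use assms(4) in auto)
  then have "dual_norm V p' y \<le> ennreal 0" by (intro dual_norm_le) auto
  then show ?thesis by simp
qed

lemma ennreal_powr_ennreal: "0 \<le> D \<Longrightarrow> ennreal_powr (ennreal D) a = ennreal (D powr a)"
  by (simp add: ennreal_powr_def)

lemma ennreal_powr_eq_0_iff: "ennreal_powr t a = 0 \<longleftrightarrow> t = 0"
  by (cases t) (auto simp: ennreal_powr_def)

text \<open>
  A functional on a space that factors through \<open>s\<close> is estimated by pulling it back to \<open>s\<close> along
  the surjection \<open>T\<close> and returning along the section \<open>S\<close>.
\<close>

lemma property_Omega_if_retract_of_s:
  assumes V: "graded_space V nrm"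
    and T: "clinear_on s_space T" "\<And>\<xi>. \<xi> \<in> s_space \<Longrightarrow> T \<xi> \<in> V"
    and S: "\<And>x. x \<in> V \<Longrightarrow> S x \<in> s_space" and TS: "\<And>x. x \<in> V \<Longrightarrow> T (S x) = x"
    and T_bound: "\<And>q. \<exists>m C. 0 < C \<and> (\<forall>\<xi>\<in>s_space. nrm q (T \<xi>) \<le> C * s_norm m \<xi>)"
    and S_bound: "\<And>q. \<exists>m C. 0 < C \<and> (\<forall>x\<in>V. s_norm q (S x) \<le> C * nrm m x)"
  shows "property_Omega V nrm"
  unfolding property_Omega_def
proof
  interpret V: graded_space V nrm by fact
  fix p
  obtain p1 C1 where C1: "0 < C1" "\<And>\<xi>. \<xi> \<in> s_space \<Longrightarrow> nrm p (T \<xi>) \<le> C1 * s_norm p1 \<xi>"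
    using T_bound[of p] by blast
  obtain q C2 where C2: "0 < C2" "\<And>x. x \<in> V \<Longrightarrow> s_norm (Suc p1) (S x) \<le> C2 * nrm q x"
    using S_bound[of "Suc p1"] by blast
  have "\<exists>\<theta>::real. 0 < \<theta> \<and> \<theta> < 1 \<and> (\<exists>C::real. 0 < C \<and> (\<forall>y\<in>top_dual V nrm. dual_norm V (nrm q) y \<le>
      ennreal C * ennreal_powr (dual_norm V (nrm p) y) (1 - \<theta>) * ennreal_powr (dual_norm V (nrm r) y) \<theta>))" for r
  proof -
    obtain r1 C3 where C3: "0 < C3" "\<And>\<xi>. \<xi> \<in> s_space \<Longrightarrow> nrm r (T \<xi>) \<le> C3 * s_norm r1 \<xi>"
      using T_bound[of r] by blast
    define d where "d = Suc r1"
    define \<theta> where "\<theta> = 1 / real (Suc d)"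
    have \<theta>: "0 < \<theta>" "\<theta> < 1" by (auto simp: \<theta>_def d_def)
    define C where "C = (2 ^ d + 1) * (C1 powr (1 - \<theta>) * C3 powr \<theta>) * C2"
    have "0 < (2 ^ d + 1 :: real)" by (simp add: add_pos_pos)
    then have C: "0 < C" unfolding C_def using C1 C2 C3 by (intro mult_pos_pos) auto
    have "dual_norm V (nrm q) y \<le> ennreal C * ennreal_powr (dual_norm V (nrm p) y) (1 - \<theta>)
        * ennreal_powr (dual_norm V (nrm r) y) \<theta>" if "y \<in> top_dual V nrm" for y
    proof -
      have lin: "clinear_on V y" using that by (simp add: top_dual_def)
      show ?thesis
      proof (cases "dual_norm V (nrm p) y = \<infinity> \<or> dual_norm V (nrm r) y = \<infinity>")
        case True
        \<comment> \<open>The product on the right cannot be \<open>0 * \<infinity>\<close>: one vanishing dual norm makes all of them vanish.\<close>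
        have nz: "dual_norm V (nrm n) y \<noteq> 0" for n
          using dual_norm_eq_0[OF V.subspace V.grade_seminorm lin, of n] True by (metis ennreal_top_neq_zero infinity_ennreal_def)
        have inf: "ennreal_powr top a = top" for a by (simp add: ennreal_powr_def)
        have "ennreal C * ennreal_powr (dual_norm V (nrm p) y) (1 - \<theta>) * ennreal_powr (dual_norm V (nrm r) y) \<theta> = \<infinity>"
          using True nz C ennreal_powr_eq_0_iff by (auto simp: inf ennreal_mult_eq_top_iff)
        then show ?thesis by simp
      next
        case False
        then obtain B A where B: "dual_norm V (nrm p) y = ennreal B" "0 \<le> B"
          and A: "dual_norm V (nrm r) y = ennreal A" "0 \<le> A"
          by (metis ennreal_cases infinity_ennreal_def)
        define z where "z = y \<circ> T"
        have z: "clinear_on s_space z"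
          using lin T unfolding clinear_on_def z_def by auto
        have zB: "cmod (z \<xi>) \<le> (B * C1) * s_norm p1 \<xi>" if \<xi>: "\<xi> \<in> s_space" for \<xi>
        proof -
          have "cmod (z \<xi>) \<le> B * nrm p (T \<xi>)"
            unfolding z_def comp_def by (rule dual_norm_bound[OF V.subspace V.grade_seminorm lin B T(2)[OF \<xi>]])
          also have "\<dots> \<le> B * (C1 * s_norm p1 \<xi>)" by (rule mult_left_mono[OF C1(2)[OF \<xi>] B(2)])
          finally show ?thesis by simp
        qed
        have zA: "cmod (z \<xi>) \<le> (A * C3) * s_norm (Suc p1 + d) \<xi>" if \<xi>: "\<xi> \<in> s_space" for \<xi>
        proof -
          have "cmod (z \<xi>) \<le> A * nrm r (T \<xi>)"
            unfolding z_def comp_def by (rule dual_norm_bound[OF V.subspace V.grade_seminorm lin A T(2)[OF \<xi>]])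
          also have "\<dots> \<le> A * (C3 * s_norm r1 \<xi>)" by (rule mult_left_mono[OF C3(2)[OF \<xi>] A(2)])
          also have "\<dots> \<le> A * (C3 * s_norm (Suc p1 + d) \<xi>)"
            using C3 A \<xi> by (intro mult_left_mono s.mono) (auto simp: d_def)
          finally show ?thesis by simp
        qed
        define K where "K = (2 ^ d + 1) * ((B * C1) powr (1 - \<theta>) * (A * C3) powr \<theta>)"
        have K0: "0 \<le> K" unfolding K_def by simp
        have "cmod (y x) \<le> (K * C2) * nrm q x" if x: "x \<in> V" for x
        proof -
          have "cmod (y x) = cmod (z (S x))" unfolding z_def using TS[OF x] by simp
          also have "\<dots> \<le> K * s_norm (Suc p1) (S x)"
            unfolding K_def
            by (rule s_functional_interpolation[OF z _ _ _ zB zA \<theta>_def S[OF x]]) (use A B C1 C3 in \<open>auto simp: d_def\<close>)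
          also have "\<dots> \<le> K * (C2 * nrm q x)" by (rule mult_left_mono[OF C2(2)[OF x] K0])
          finally show ?thesis by simp
        qed
        then have "dual_norm V (nrm q) y \<le> ennreal (K * C2)"
          using K0 C2(1) by (intro dual_norm_le) auto
        also have "K * C2 = C * B powr (1 - \<theta>) * A powr \<theta>"
          unfolding K_def C_def using A B C1 C3 by (simp add: powr_mult)
        also have "ennreal \<dots> = ennreal C * ennreal (B powr (1 - \<theta>)) * ennreal (A powr \<theta>)"
          using C by (simp add: ennreal_mult)
        finally show ?thesis using A B by (simp add: ennreal_powr_ennreal)
      qed
    qed
    then show ?thesis using \<theta> C by blast
  qed
  then show "\<exists>q. \<forall>r. \<exists>\<theta>::real. 0 < \<theta> \<and> \<theta> < 1 \<and> (\<exists>C::real. 0 < C \<and> (\<forall>y\<in>top_dual V nrm. dual_norm V (nrm q) y \<le>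
      ennreal C * ennreal_powr (dual_norm V (nrm p) y) (1 - \<theta>) * ennreal_powr (dual_norm V (nrm r) y) \<theta>))"
    by blast
qed


section \<open>Orthonormal sequences in \<open>s\<close>\<close>

lemma sum_fun_apply: "(\<Sum>i\<in>I. g i) x = (\<Sum>i\<in>I. g i x)"
  by (induction I rule: infinite_finite_induct) auto

lemma pairing_sum_left:
  assumes "\<And>j. j \<in> J \<Longrightarrow> summable (\<lambda>i. \<xi> j i * cnj (\<eta> i))"
  shows "pairing (\<Sum>j\<in>J. c j *\<^sub>C \<xi> j) \<eta> = (\<Sum>j\<in>J. c j * pairing (\<xi> j) \<eta>)"
proof -
  have "(\<lambda>i. (\<Sum>j\<in>J. c j *\<^sub>C \<xi> j) i * cnj (\<eta> i)) = (\<lambda>i. \<Sum>j\<in>J. c j * (\<xi> j i * cnj (\<eta> i)))"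
    by (simp add: sum_fun_apply scaleC_fun_def scaleC_complex_def sum_distrib_right mult.assoc)
  then have "pairing (\<Sum>j\<in>J. c j *\<^sub>C \<xi> j) \<eta> = (\<Sum>i. \<Sum>j\<in>J. c j * (\<xi> j i * cnj (\<eta> i)))"
    by (simp add: pairing_def)
  also have "\<dots> = (\<Sum>j\<in>J. \<Sum>i. c j * (\<xi> j i * cnj (\<eta> i)))"
    by (rule suminf_sum) (simp add: assms summable_mult)
  also have "\<dots> = (\<Sum>j\<in>J. c j * pairing (\<xi> j) \<eta>)"
    by (simp add: pairing_def suminf_mult assms)
  finally show ?thesis .
qed

lemma ell2_subspace: "cvec.subspace ell2"
  unfolding ell2_eq(1) by (rule s'_step_subspace)

lemma pairing_self:
  assumes "\<xi> \<in> ell2"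
  shows "pairing \<xi> \<xi> = complex_of_real ((s'_norm 0 \<xi>)\<^sup>2)"
proof -
  have s: "summable (\<lambda>j. (cmod (\<xi> j))\<^sup>2)" using assms by (simp add: ell2_def)
  have "pairing \<xi> \<xi> = (\<Sum>j. complex_of_real ((cmod (\<xi> j))\<^sup>2))"
    unfolding pairing_def complex_norm_square ..
  also have "\<dots> = complex_of_real (\<Sum>j. (cmod (\<xi> j))\<^sup>2)" by (rule suminf_of_real[OF s, symmetric])
  also have "(\<Sum>j. (cmod (\<xi> j))\<^sup>2) = (s'_norm 0 \<xi>)\<^sup>2"
    unfolding s'_norm_def by (simp add: suminf_nonneg[OF s])
  finally show ?thesis .
qed

text \<open>
  Bessel's inequality for a coordinate vector.  The vector \<open>v\<close> is its projection onto the span of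
  the \<open>f j\<close>, whose squared norm equals its \<open>i\<close>-th coordinate.
\<close>

lemma orthonormal_coordinates_le_1:
  assumes f: "orthonormal_seq f" and J: "finite J"
  shows "(\<Sum>j\<in>J. (cmod (f j i))\<^sup>2) \<le> 1"
proof -
  define W where "W = (\<Sum>j\<in>J. (cmod (f j i))\<^sup>2)"
  define v where "v = (\<Sum>j\<in>J. cnj (f j i) *\<^sub>C f j)"
  have f2: "f j \<in> ell2" for j using f by (simp add: orthonormal_seq_def)
  have v2: "v \<in> ell2" unfolding v_def
    by (intro cvec.subspace_sum[OF ell2_subspace] cvec.subspace_scale[OF ell2_subspace] f2)
  have vf: "pairing v (f k) = cnj (f k i)" if "k \<in> J" for k
  proof -
    have "pairing v (f k) = (\<Sum>j\<in>J. cnj (f j i) * pairing (f j) (f k))"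
      unfolding v_def by (rule pairing_sum_left) (rule pairing_ell2_summable(1)[OF f2 f2])
    also have "\<dots> = (\<Sum>j\<in>J. if j = k then cnj (f j i) else 0)"
      using f by (intro sum.cong) (auto simp: orthonormal_seq_def)
    finally show ?thesis using that J by simp
  qed
  have "pairing v v = (\<Sum>j\<in>J. cnj (f j i) * pairing (f j) v)"
    unfolding v_def by (rule pairing_sum_left)
      (rule pairing_ell2_summable(1)[OF f2 v2[unfolded v_def]])
  also have "\<dots> = (\<Sum>j\<in>J. complex_of_real ((cmod (f j i))\<^sup>2))"
  proof (rule sum.cong)
    fix j assume "j \<in> J"
    then have "pairing (f j) v = f j i"
      using pairing_cnj[OF pairing_ell2_summable(1)[OF v2 f2], of j] vf by simp
    then show "cnj (f j i) * pairing (f j) v = complex_of_real ((cmod (f j i))\<^sup>2)"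
      by (simp only: complex_norm_square mult.commute)
  qed simp
  finally have "complex_of_real ((s'_norm 0 v)\<^sup>2) = complex_of_real W"
    using pairing_self[OF v2] by (simp add: W_def)
  then have norm_v: "(s'_norm 0 v)\<^sup>2 = W" by (simp only: of_real_eq_iff)
  have "v i = (\<Sum>j\<in>J. complex_of_real ((cmod (f j i))\<^sup>2))"
    unfolding v_def
    by (simp add: sum_fun_apply scaleC_fun_def scaleC_complex_def complex_norm_square mult.commute
        del: of_real_power)
  then have vi: "v i = complex_of_real W" by (simp add: W_def)
  have W0: "0 \<le> W" unfolding W_def by (simp add: sum_nonneg)
  have "cmod (v i) \<le> s'_norm 0 v"
    using wnorm_coordinate_le[of "\<lambda>_. 1" v i] v2 by (simp add: ell2_eq(2) s'_norm_eq_wnorm)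
  then have "(cmod (v i))\<^sup>2 \<le> W" unfolding norm_v[symmetric] by (intro power_mono) auto
  then have "W * W \<le> 1 * W" using vi W0 by (simp add: power2_eq_square)
  then have "W \<le> 1" using W0 by (metis mult_right_le_imp_le less_eq_real_def zero_le_one)
  then show ?thesis by (simp add: W_def)
qed

lemma orthonormal_s_norm_0: "orthonormal_seq f \<Longrightarrow> s_norm 0 (f j) = 1"
  using pairing_self[of "f j"] s'_norm_nonneg[of "f j" 0]
  by (auto simp: orthonormal_seq_def s_norm_0 ell2_eq(1) power2_eq_1_iff complex_eq_iff)

text \<open>
  An orthonormal sequence in \<open>s\<close> cannot stay bounded in \<open>s_norm 1\<close>: every \<open>f j\<close> with
  \<open>s_norm 1 (f j) \<le> R\<close> has at least a quarter of its mass on the first \<open>\<lceil>2 * R\<rceil>\<close> coordinates, and each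
  coordinate carries total mass at most \<open>1\<close>.
\<close>

lemma orthonormal_card_le:
  assumes f: "orthonormal_seq f" and fs: "\<And>j. f j \<in> s_space" and J: "finite J"
    and R: "1 \<le> R" and le: "\<And>j. j \<in> J \<Longrightarrow> s_norm 1 (f j) \<le> R"
  shows "real (card J) \<le> 12 * R"
proof -
  define n where "n = nat \<lceil>2 * R\<rceil>"
  have n: "2 * R \<le> real n" "real n \<le> 2 * R + 1" unfolding n_def using R by linarith+
  have mass: "1 / 4 \<le> (\<Sum>i<n. (cmod (f j i))\<^sup>2)" if j: "j \<in> J" for j
  proof -
    have "s_norm 0 (f j - trunc n (f j)) \<le> 1 / real (Suc n) * s_norm 1 (f j)"
      using s_norm_tail[OF fs, of 0 j n] by simp
    also have "\<dots> \<le> 1 / real (Suc n) * R" by (rule mult_left_mono[OF le[OF j]]) simp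
    also have "\<dots> \<le> 1 / 2" using n R by (simp add: field_simps)
    finally have tail: "s_norm 0 (f j - trunc n (f j)) \<le> 1 / 2" .
    have "f j = trunc n (f j) + (f j - trunc n (f j))" by simp
    then have "s_norm 0 (f j) \<le> s_norm 0 (trunc n (f j)) + s_norm 0 (f j - trunc n (f j))"
      using seminorm_on_add[OF s.grade_seminorm trunc_in_s cvec.subspace_diff[OF s.subspace fs trunc_in_s]] by metis
    then have "1 / 2 \<le> s_norm 0 (trunc n (f j))" using tail orthonormal_s_norm_0[OF f, of j] by simp
    then have "(1 / 2)\<^sup>2 \<le> (s_norm 0 (trunc n (f j)))\<^sup>2" by (intro power_mono) auto
    also have "(s_norm 0 (trunc n (f j)))\<^sup>2 = (\<Sum>i<n. (cmod (f j i))\<^sup>2)"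
    proof -
      have "(\<Sum>i. (cmod (trunc n (f j) i))\<^sup>2) = (\<Sum>i<n. (cmod (trunc n (f j) i))\<^sup>2)"
        by (rule suminf_finite) (auto simp: trunc_def)
      then show ?thesis unfolding s_norm_def by (simp add: sum_nonneg trunc_def)
    qed
    finally show ?thesis by (simp add: power2_eq_square)
  qed
  have "real (card J) * (1 / 4) = (\<Sum>j\<in>J. 1 / 4)" by simp
  also have "\<dots> \<le> (\<Sum>j\<in>J. \<Sum>i<n. (cmod (f j i))\<^sup>2)" by (rule sum_mono[OF mass])
  also have "\<dots> = (\<Sum>i<n. \<Sum>j\<in>J. (cmod (f j i))\<^sup>2)" by (rule sum.swap)
  also have "\<dots> \<le> (\<Sum>i<n. 1)" by (intro sum_mono orthonormal_coordinates_le_1[OF f J])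
  also have "\<dots> \<le> 2 * R + 1" using n by simp
  finally show ?thesis using R by simp
qed

text \<open>
  If at most \<open>c * R\<close> of the numbers \<open>b k \<ge> 1\<close> are bounded by \<open>R\<close>, then \<open>b\<close> is polynomially comparable
  with an injective sequence of natural numbers: indices whose \<open>b k\<close> have the same integer part \<open>n\<close>
  are distinguished by their rank, which is at most linear in \<open>n\<close>, and the pair of \<open>n\<close> and the rank is
  encoded by Cantor's quadratic pairing function.
\<close>

lemma polynomial_relabelling:
  fixes b :: "nat \<Rightarrow> real"
  assumes b: "\<And>k. 1 \<le> b k" and c: "0 \<le> c"
    and count: "\<And>R. 1 \<le> R \<Longrightarrow> finite {k. b k \<le> R} \<and> real (card {k. b k \<le> R}) \<le> c * R"
  obtains m :: "nat \<Rightarrow> nat" and C :: real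
  where "inj m" "1 \<le> C" "\<And>k. b k \<le> real (Suc (m k))" "\<And>k. real (Suc (m k)) \<le> C * (b k)\<^sup>2"
proof
  define n where "n k = nat \<lfloor>b k\<rfloor>" for k
  define r where "r k = card {i. i < k \<and> n i = n k}" for k
  define m where "m k = prod_encode (n k, r k)" for k
  have nb: "real (n k) \<le> b k" "b k \<le> real (n k) + 1" for k unfolding n_def using b[of k] by linarith+
  have rank_less: "r k < r k'" if "k < k'" "n k = n k'" for k k'
  proof -
    have "{i. i < k \<and> n i = n k} \<subset> {i. i < k' \<and> n i = n k'}" using that by auto
    moreover have "finite {i. i < k' \<and> n i = n k'}" by simp
    ultimately show ?thesis unfolding r_def by (rule psubset_card_mono[rotated])
  qed
  show "inj m"
  proof (rule injI)
    fix k k' assume "m k = m k'"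
    then have "n k = n k'" "r k = r k'" by (simp_all add: m_def)
    then show "k = k'" using rank_less[of k k'] rank_less[of k' k] by (metis linorder_less_linear less_irrefl)
  qed
  show "b k \<le> real (Suc (m k))" for k
  proof -
    have "n k \<le> m k" unfolding m_def by (rule le_prod_encode_1)
    then show ?thesis using nb(2)[of k] by simp
  qed
  show "1 \<le> (2 + 2 * c)\<^sup>2" using c by (simp add: power2_eq_square algebra_simps)
  show "real (Suc (m k)) \<le> (2 + 2 * c)\<^sup>2 * (b k)\<^sup>2" for k
  proof -
    have R: "1 \<le> b k + 1" using b[of k] by simp
    have "{i. i < k \<and> n i = n k} \<subseteq> {i. b i \<le> b k + 1}"
      using nb by (auto intro: order_trans[OF nb(2)])
    then have "r k \<le> card {i. b i \<le> b k + 1}"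
      unfolding r_def using count[OF R] by (intro card_mono) auto
    then have "real (r k) \<le> c * (b k + 1)" using count[OF R] by (meson of_nat_mono order_trans)
    also have "\<dots> \<le> c * (2 * b k)" using b[of k] c by (intro mult_left_mono) auto
    finally have r: "real (r k) \<le> 2 * c * b k" by simp
    have "2 * Suc (m k) \<le> 2 * (n k + r k + 1)\<^sup>2"
      unfolding m_def prod_encode_def triangle_def by (simp add: power2_eq_square algebra_simps)
    then have "Suc (m k) \<le> (n k + r k + 1)\<^sup>2" by simp
    then have "real (Suc (m k)) \<le> (real (n k) + real (r k) + 1)\<^sup>2"
      by (metis of_nat_mono of_nat_power of_nat_add of_nat_1)
    also have "\<dots> \<le> ((2 + 2 * c) * b k)\<^sup>2"
      using nb(1)[of k] r b[of k] by (intro power_mono) (auto simp: algebra_simps)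
    finally show ?thesis by (simp add: power_mult_distrib)
  qed
qed


section \<open>Algebras with a basis of finite-rank projections\<close>

lemma scaleC_fun_apply: "(c *\<^sub>C g) x = c *\<^sub>C g x"
  by (simp add: scaleC_fun_def)

lemma span_projection_apply:
  "\<xi> \<in> s'_space \<Longrightarrow> span_projection f J \<xi> = (\<Sum>j\<in>J. pairing \<xi> (f j) *\<^sub>C f j)"
  by (simp add: span_projection_def)

lemma span_projection_bound:
  assumes f: "\<And>j. f j \<in> s_space" and \<xi>: "\<xi> \<in> s'_step q"
  shows "s_norm q (span_projection f J \<xi>) \<le> (\<Sum>j\<in>J. (s_norm q (f j))\<^sup>2) * s'_norm q \<xi>"
proof -
  have "s_norm q (span_projection f J \<xi>) = s_norm q (\<Sum>j\<in>J. pairing \<xi> (f j) *\<^sub>C f j)"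
    using \<xi> s'_step_subset by (subst span_projection_apply) auto
  also have "\<dots> \<le> (\<Sum>j\<in>J. s_norm q (pairing \<xi> (f j) *\<^sub>C f j))"
    by (intro seminorm_on_sum[OF s.subspace s.grade_seminorm] cvec.subspace_scale[OF s.subspace] f)
  also have "\<dots> \<le> (\<Sum>j\<in>J. (s_norm q (f j))\<^sup>2 * s'_norm q \<xi>)"
  proof (rule sum_mono)
    fix j
    have "s_norm q (pairing \<xi> (f j) *\<^sub>C f j) = cmod (pairing \<xi> (f j)) * s_norm q (f j)"
      by (rule seminorm_on_scaleC[OF s.grade_seminorm f])
    also have "\<dots> \<le> (s'_norm q \<xi> * s_norm q (f j)) * s_norm q (f j)"
      by (intro mult_right_mono pairing_bound[OF \<xi> f] s_norm_nonneg f)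
    finally show "s_norm q (pairing \<xi> (f j) *\<^sub>C f j) \<le> (s_norm q (f j))\<^sup>2 * s'_norm q \<xi>"
      by (simp add: power2_eq_square mult_ac)
  qed
  finally show ?thesis by (simp add: sum_distrib_right)
qed

lemma span_projection_orthonormal:
  assumes f: "\<And>j. f j \<in> s_space" "orthonormal_seq f" and J: "finite J"
  shows "span_projection f J (f i) = (if i \<in> J then f i else 0)"
proof -
  have "span_projection f J (f i) = (\<Sum>j\<in>J. if j = i then f i else 0)"
    unfolding span_projection_apply[OF s_subset_s'[OF f(1)]]
    using f(2) by (intro sum.cong) (auto simp: orthonormal_seq_def)
  then show ?thesis using J by simp
qed

lemma span_projection_self_adjoint:
  assumes f: "\<And>j. f j \<in> s_space" and \<xi>: "\<xi> \<in> ell2" and \<eta>: "\<eta> \<in> ell2"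
  shows "pairing (span_projection f J \<xi>) \<eta> = pairing \<xi> (span_projection f J \<eta>)"
proof -
  have summ: "summable (\<lambda>i. \<alpha> i * cnj (\<beta> i))" if "\<alpha> \<in> ell2" "\<beta> \<in> ell2" for \<alpha> \<beta>
    by (rule pairing_ell2_summable(1)[OF that])
  have f2: "f j \<in> ell2" for j by (rule s_subset_ell2[OF f])
  have expand: "pairing (span_projection f J \<alpha>) \<beta> = (\<Sum>j\<in>J. pairing \<alpha> (f j) * pairing (f j) \<beta>)"
    if "\<alpha> \<in> ell2" "\<beta> \<in> ell2" for \<alpha> \<beta>
    using that ell2_subset_s' by (subst span_projection_apply) (auto intro!: pairing_sum_left summ f2)
  have P\<eta>: "span_projection f J \<eta> \<in> ell2"
    unfolding span_projection_apply[OF subsetD[OF ell2_subset_s' \<eta>]]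
    by (intro cvec.subspace_sum[OF ell2_subspace] cvec.subspace_scale[OF ell2_subspace] f2)
  have "pairing \<xi> (span_projection f J \<eta>) = cnj (pairing (span_projection f J \<eta>) \<xi>)"
    by (rule pairing_cnj[OF summ[OF P\<eta> \<xi>]])
  also have "\<dots> = (\<Sum>j\<in>J. cnj (pairing \<eta> (f j)) * cnj (pairing (f j) \<xi>))"
    using expand[OF \<eta> \<xi>] by simp
  also have "\<dots> = (\<Sum>j\<in>J. pairing \<xi> (f j) * pairing (f j) \<eta>)"
    using pairing_cnj[OF summ[OF \<eta> f2]] pairing_cnj[OF summ[OF f2 \<xi>]] by (simp add: mult.commute)
  finally show ?thesis using expand[OF \<xi> \<eta>] by simp
qed

locale block_diagonal_algebra =
  fixes E :: "cseq_op set" and f :: "nat \<Rightarrow> cseq" and N :: "nat \<Rightarrow> nat set"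
  assumes E_closed: "closed_star_subalgebra L_top (\<circ>) L_star E"
    and f_in_s: "f j \<in> s_space"
    and orthonormal: "orthonormal_seq f"
    and finite_N: "finite (N k)" and N_nonempty: "N k \<noteq> {}"
    and disjoint_N: "disjoint_family N"
    and basis: "schauder_basis L_top E (\<lambda>k. span_projection f (N k))"
begin

abbreviation P :: "nat \<Rightarrow> cseq_op" where "P k \<equiv> span_projection f (N k)"

definition block_norm :: "nat \<Rightarrow> nat \<Rightarrow> real" where
  "block_norm q k = Max ((\<lambda>j. s_norm q (f j)) ` N k)"

lemma E_subspace: "cvec.subspace E"
  and E_mult: "x \<in> E \<Longrightarrow> y \<in> E \<Longrightarrow> x \<circ> y \<in> E"
  and E_star: "x \<in> E \<Longrightarrow> L_star x \<in> E"
  and E_closedin: "closedin L_top E"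
  using E_closed by (auto simp: closed_star_subalgebra_def)

lemma E_subset_L: "E \<subseteq> L_space"
  using closedin_subset[OF E_closedin] unfolding topspace_L_top .

lemma E_in_L: "x \<in> E \<Longrightarrow> x \<in> L_space"
  using E_subset_L by (rule subsetD)

lemma graded_E: "graded_space E L_norm"
  by (rule L.graded_subspace[OF E_subspace E_subset_L])

sublocale E: graded_space E L_norm by (rule graded_E)

lemma subtopology_E: "subtopology L_top E = seminorm_topology E (range L_norm)"
  unfolding L_top_def by (rule L.subtopology_eq[OF E_subspace E_subset_L])

lemma P_in_E: "P k \<in> E"
  using basis by (simp add: schauder_basis_def)

lemma P_in_L: "P k \<in> L_space"
  by (rule E_in_L[OF P_in_E])

lemma E_limit:
  assumes "\<And>n. x n \<in> E" "y \<in> L_space" "\<And>q. (\<lambda>n. L_norm q (x n - y)) \<longlonglongrightarrow> 0"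
  shows "y \<in> E"
proof -
  have "limitin L_top x y sequentially"
    unfolding L_top_def using assms by (subst L.limitin_iff) (auto intro: E_in_L)
  then show ?thesis by (rule limitin_closedin[OF _ E_closedin]) (use assms(1) in auto)
qed

lemma P_f: "P k (f j) = (if j \<in> N k then f j else 0)"
  by (rule span_projection_orthonormal[OF f_in_s orthonormal finite_N])

lemma N_disjoint: "j \<in> N k \<Longrightarrow> j \<in> N l \<Longrightarrow> k = l"
  using disjoint_N by (auto simp: disjoint_family_on_def)

lemma f_norm: "s_norm 0 (f j) = 1" "f j \<in> s'_step q" "s'_norm q (f j) \<le> 1"
  using orthonormal_s_norm_0[OF orthonormal, of j] s_subset_s'_step[of "f j" q, OF f_in_s] by auto

lemma block_norm_ge: "j \<in> N k \<Longrightarrow> s_norm q (f j) \<le> block_norm q k"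
  unfolding block_norm_def using finite_N by (intro Max_ge) auto

lemma block_norm_attained:
  obtains j where "j \<in> N k" "block_norm q k = s_norm q (f j)"
proof -
  have "block_norm q k \<in> (\<lambda>j. s_norm q (f j)) ` N k"
    unfolding block_norm_def using finite_N N_nonempty by (intro Max_in) auto
  then show thesis using that by blast
qed

lemma block_norm_power: "Max ((\<lambda>j. s_norm q (f j) ^ r) ` N k) = block_norm q k ^ r"
proof (rule Max_eqI)
  show "finite ((\<lambda>j. s_norm q (f j) ^ r) ` N k)" using finite_N by simp
  show "y \<le> block_norm q k ^ r" if "y \<in> (\<lambda>j. s_norm q (f j) ^ r) ` N k" for y
    using that block_norm_ge s_norm_nonneg[OF f_in_s] by (auto intro: power_mono)
  show "block_norm q k ^ r \<in> (\<lambda>j. s_norm q (f j) ^ r) ` N k"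
    by (rule block_norm_attained[of k q]) auto
qed

lemma block_norm_mono: "p \<le> q \<Longrightarrow> block_norm p k \<le> block_norm q k"
proof (rule block_norm_attained[of k p])
  fix j assume "p \<le> q" "j \<in> N k" "block_norm p k = s_norm p (f j)"
  then show ?thesis using s.mono[OF \<open>p \<le> q\<close> f_in_s] block_norm_ge order_trans by metis
qed

lemma block_norm_ge_1: "1 \<le> block_norm q k"
proof -
  obtain j where "j \<in> N k" using N_nonempty by blast
  then have "1 \<le> block_norm 0 k" using block_norm_ge[of j k 0] f_norm(1)[of j] by simp
  then show ?thesis using block_norm_mono[of 0 q k] by simp
qed

text \<open>Log-convexity of the norms of \<open>s\<close> along the unit vectors \<open>f j\<close>, where \<open>s_norm 0\<close> equals \<open>1\<close>.\<close>

lemma block_norm_square: "(block_norm q k)\<^sup>2 \<le> block_norm (2 * q) k"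
proof (rule block_norm_attained[of k q])
  fix j assume j: "j \<in> N k" "block_norm q k = s_norm q (f j)"
  have "(s_norm q (f j))\<^sup>2 \<le> s_norm (2 * q) (f j)"
    using s_norm_log_convex[OF f_in_s, of q j] f_norm(1)[of j] by simp
  then show ?thesis using j block_norm_ge[OF j(1), of "2 * q"] by simp
qed

lemma block_norm_power_le: "block_norm q k ^ r \<le> block_norm (2 ^ r * q) k"
proof -
  have *: "block_norm q k ^ (2 ^ n) \<le> block_norm (2 ^ n * q) k" for n
  proof (induction n)
    case (Suc n)
    have "block_norm q k ^ (2 ^ Suc n) = (block_norm q k ^ (2 ^ n))\<^sup>2"
      by (simp add: power_mult[symmetric] mult.commute)
    also have "\<dots> \<le> (block_norm (2 ^ n * q) k)\<^sup>2"
      using Suc block_norm_ge_1[of q k] by (intro power_mono) auto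
    also have "\<dots> \<le> block_norm (2 * (2 ^ n * q)) k" by (rule block_norm_square)
    finally show ?case by (simp add: mult.assoc)
  qed simp
  have "block_norm q k ^ r \<le> block_norm q k ^ (2 ^ r)"
    by (rule power_increasing[OF _ block_norm_ge_1]) (simp add: less_imp_le)
  then show ?thesis using *[of r] by simp
qed

lemma card_N_le: "real (card (N k)) \<le> 12 * block_norm 1 k"
  by (rule orthonormal_card_le[OF orthonormal f_in_s finite_N block_norm_ge_1]) (rule block_norm_ge)

lemma block_norm_le_L_norm: "block_norm q k \<le> L_norm q (P k)"
proof (rule block_norm_attained[of k q])
  fix j assume j: "j \<in> N k" "block_norm q k = s_norm q (f j)"
  have "s_norm q (f j) \<le> L_norm q (P k) * s'_norm q (f j)"
    using L_norm_bound[of "P k" "f j" q, OF P_in_L f_norm(2)] j(1) by (simp add: P_f)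
  also have "\<dots> \<le> L_norm q (P k) * 1" by (rule mult_left_mono[OF f_norm(3) L_norm_nonneg[OF P_in_L]])
  finally show ?thesis using j by simp
qed

text \<open>
  The projection onto a block is bounded by its rank times the square of the weight.  The rank is
  itself at most a multiple of \<open>block_norm 1 k\<close>, and the resulting third power of a weight is
  dominated by a later weight.
\<close>

lemma L_norm_P_le: "L_norm q (P k) \<le> 12 * block_norm (16 * Suc q) k"
proof -
  let ?b = "block_norm (Suc q) k"
  have b1: "1 \<le> ?b" by (rule block_norm_ge_1)
  have sq: "(s_norm q (f j))\<^sup>2 \<le> ?b\<^sup>2" if "j \<in> N k" for j
    using block_norm_ge[OF that, of q] block_norm_mono[of q "Suc q" k] s_norm_nonneg[OF f_in_s]
    by (intro power_mono) auto
  have "(\<Sum>j\<in>N k. (s_norm q (f j))\<^sup>2) \<le> (\<Sum>j\<in>N k. ?b\<^sup>2)" by (rule sum_mono[OF sq])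
  also have "\<dots> = real (card (N k)) * ?b\<^sup>2" by simp
  also have "\<dots> \<le> (12 * ?b) * ?b\<^sup>2"
    using card_N_le[of k] block_norm_mono[of 1 "Suc q" k] by (intro mult_right_mono) auto
  also have "\<dots> = 12 * ?b ^ 3" by (simp add: power2_eq_square power3_eq_cube)
  \<comment> \<open>Exponent \<open>4\<close> becomes the index \<open>2 ^ 4 * Suc q\<close> through \<open>block_norm_power_le\<close>.\<close>
  also have "\<dots> \<le> 12 * ?b ^ 4" using b1 by (intro mult_left_mono power_increasing) auto
  also have "\<dots> \<le> 12 * block_norm (16 * Suc q) k"
    using block_norm_power_le[of "Suc q" k 4] by simp
  finally have le: "(\<Sum>j\<in>N k. (s_norm q (f j))\<^sup>2) \<le> 12 * block_norm (16 * Suc q) k" .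
  show ?thesis
  proof (rule L_norm_le)
    fix \<xi> assume \<xi>: "\<xi> \<in> s'_step q"
    show "s_norm q (P k \<xi>) \<le> 12 * block_norm (16 * Suc q) k * s'_norm q \<xi>"
      using span_projection_bound[where f = f and J = "N k", OF f_in_s \<xi>] mult_right_mono[OF le s'_norm_nonneg[OF \<xi>]] by simp
  qed (use block_norm_ge_1[of "16 * Suc q" k] in simp)
qed

text \<open>
  For \<open>x\<close> in \<open>E\<close> every \<open>f j\<close> of the \<open>k\<close>-th block is an eigenvector of \<open>x\<close> with the same eigenvalue, so the
  choice of \<open>j\<close> is immaterial there.
\<close>

definition coef :: "cseq_op \<Rightarrow> nat \<Rightarrow> complex" where
  "coef x k = (let j = SOME j. j \<in> N k in pairing (x (f j)) (f j))"

abbreviation partial_sum :: "(nat \<Rightarrow> complex) \<Rightarrow> nat \<Rightarrow> cseq_op" where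
  "partial_sum c n \<equiv> (\<Sum>k<n. c k *\<^sub>C P k)"

lemma partial_sum_in_E: "partial_sum c n \<in> E"
  by (intro cvec.subspace_sum[OF E_subspace] cvec.subspace_scale[OF E_subspace] P_in_E)

lemma partial_sum_apply: "partial_sum c n \<xi> = (\<Sum>k<n. c k *\<^sub>C P k \<xi>)"
  by (simp add: sum_fun_apply scaleC_fun_apply)

lemma partial_sum_f:
  assumes "j \<in> N k" "k < n"
  shows "partial_sum c n (f j) = c k *\<^sub>C f j"
proof -
  have "partial_sum c n (f j) = (\<Sum>l<n. if l = k then c k *\<^sub>C f j else 0)"
    unfolding partial_sum_apply using assms(1) N_disjoint by (intro sum.cong) (auto simp: P_f)
  then show ?thesis using assms(2) by simp
qed

lemma pairing_scale_f: "pairing (c *\<^sub>C f j) (f j) = c"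
  using pairing_scale_left[OF pairing_summable_s[OF s_subset_s'[OF f_in_s] f_in_s], of c j j] orthonormal
  by (simp add: orthonormal_seq_def)

lemma coef_eqI_some: "(\<And>j. j \<in> N k \<Longrightarrow> x (f j) = c *\<^sub>C f j) \<Longrightarrow> coef x k = c"
  unfolding coef_def Let_def using N_nonempty[of k] by (simp add: some_in_eq pairing_scale_f)

text \<open>
  The partial sums of the basis expansion of \<open>x\<close>, evaluated at \<open>f j\<close>, are constant beyond the block of
  \<open>j\<close>; this identifies the coefficients of the expansion with the eigenvalues of \<open>x\<close>.
\<close>

lemma expansion:
  assumes x: "x \<in> E"
  shows "(\<lambda>n. L_norm q (partial_sum (coef x) n - x)) \<longlonglongrightarrow> 0"
    and "j \<in> N k \<Longrightarrow> x (f j) = coef x k *\<^sub>C f j"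
proof -
  obtain c where "limitin (subtopology L_top E) (\<lambda>n. partial_sum c n) x sequentially"
    using basis x by (auto simp: schauder_basis_def)
  then have lim: "(\<lambda>n. L_norm q (partial_sum c n - x)) \<longlonglongrightarrow> 0" for q
    unfolding subtopology_E E.limitin_iff[OF partial_sum_in_E] by simp
  have act: "x (f j) = c k *\<^sub>C f j" if j: "j \<in> N k" for j k
  proof -
    have in_L: "partial_sum c n - x \<in> L_space" for n
      by (rule cvec.subspace_diff[OF L.subspace E_in_L[OF partial_sum_in_E] E_in_L[OF x]])
    have "\<forall>\<^sub>F n in sequentially. s_norm 0 (c k *\<^sub>C f j - x (f j)) \<le> L_norm 0 (partial_sum c n - x)"
      using eventually_gt_at_top[of k]
    proof eventually_elim
      case (elim n)
      have "s_norm 0 ((partial_sum c n - x) (f j)) \<le> L_norm 0 (partial_sum c n - x) * s'_norm 0 (f j)"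
        by (rule L_norm_bound[OF in_L f_norm(2)])
      also have "\<dots> \<le> L_norm 0 (partial_sum c n - x) * 1"
        by (rule mult_left_mono[OF f_norm(3) L_norm_nonneg[OF in_L]])
      also have "(partial_sum c n - x) (f j) = c k *\<^sub>C f j - x (f j)"
        using partial_sum_f[OF j elim, of c] by (simp only: minus_apply)
      finally show ?case by (simp only: mult_1_right)
    qed
    then have "s_norm 0 (c k *\<^sub>C f j - x (f j)) \<le> 0" by (rule tendsto_lowerbound[OF lim]) simp
    moreover have "c k *\<^sub>C f j - x (f j) \<in> s_space"
      by (intro cvec.subspace_diff[OF s.subspace] cvec.subspace_scale[OF s.subspace] f_in_s
          L_maps[OF E_in_L[OF x] s_subset_s'[OF f_in_s]])
    ultimately have "c k *\<^sub>C f j - x (f j) = 0" by (intro s_norm_zero_imp)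
    then show ?thesis by simp
  qed
  have "coef x = c" using act by (auto intro!: coef_eqI_some)
  then show "(\<lambda>n. L_norm q (partial_sum (coef x) n - x)) \<longlonglongrightarrow> 0"
    and "j \<in> N k \<Longrightarrow> x (f j) = coef x k *\<^sub>C f j" using lim act by auto
qed

lemma coef_bound:
  assumes x: "x \<in> E"
  shows "cmod (coef x k) * block_norm q k \<le> L_norm q x"
proof (rule block_norm_attained[of k q])
  fix j assume j: "j \<in> N k" "block_norm q k = s_norm q (f j)"
  have "cmod (coef x k) * s_norm q (f j) = s_norm q (x (f j))"
    using seminorm_on_scaleC[OF s.grade_seminorm f_in_s, of q "coef x k" j] expansion(2)[OF x j(1)] by simp
  also have "\<dots> \<le> L_norm q x * s'_norm q (f j)" by (rule L_norm_bound[OF E_in_L[OF x] f_norm(2)])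
  also have "\<dots> \<le> L_norm q x * 1" by (rule mult_left_mono[OF f_norm(3) L_norm_nonneg[OF E_in_L[OF x]]])
  finally show ?thesis using j by simp
qed

lemma coef_add: "x \<in> E \<Longrightarrow> y \<in> E \<Longrightarrow> coef (x + y) k = coef x k + coef y k"
  by (rule coef_eqI_some) (simp add: expansion(2) cvec.scale_left_distrib)

lemma coef_scaleC: "x \<in> E \<Longrightarrow> coef (c *\<^sub>C x) k = c * coef x k"
  by (rule coef_eqI_some) (simp add: expansion(2) scaleC_fun_apply[of c x])

lemma coef_mult:
  assumes x: "x \<in> E" and y: "y \<in> E"
  shows "coef (x \<circ> y) k = coef x k * coef y k"
proof (rule coef_eqI_some)
  fix j assume j: "j \<in> N k"
  have "(x \<circ> y) (f j) = x (coef y k *\<^sub>C f j)" using expansion(2)[OF y j] by simp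
  also have "\<dots> = coef y k *\<^sub>C x (f j)"
    by (rule clinear_on_scaleC[OF L_linear[OF E_in_L[OF x]] s_subset_s'[OF f_in_s]])
  finally show "(x \<circ> y) (f j) = (coef x k * coef y k) *\<^sub>C f j"
    using expansion(2)[OF x j] by (simp add: mult.commute)
qed

lemma coef_P: "coef (P k) l = (if k = l then 1 else 0)"
  using N_disjoint by (intro coef_eqI_some) (auto simp: P_f)

text \<open>
  Each block contains one of the vectors \<open>f j\<close>, so the growth of orthonormal sequences is inherited
  by the block norms.
\<close>

lemma block_norm_count:
  assumes q: "1 \<le> q" and R: "1 \<le> R"
  shows "finite {k. block_norm q k \<le> R} \<and> real (card {k. block_norm q k \<le> R}) \<le> 12 * R"
proof -
  define rep where "rep k = (SOME j. j \<in> N k)" for k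
  have rep: "rep k \<in> N k" for k unfolding rep_def using N_nonempty by (simp add: some_in_eq)
  have inj: "inj rep" by (rule injI) (metis rep N_disjoint)
  have "card G \<le> nat \<lfloor>12 * R\<rfloor>" if G: "G \<subseteq> {k. block_norm q k \<le> R}" "finite G" for G
  proof -
    have "real (card (rep ` G)) \<le> 12 * R"
    proof (rule orthonormal_card_le[OF orthonormal f_in_s _ R])
      show "finite (rep ` G)" using G by simp
      fix j assume "j \<in> rep ` G"
      then obtain k where k: "k \<in> G" "j = rep k" by blast
      then show "s_norm 1 (f j) \<le> R"
        using block_norm_ge[OF rep, of 1 k] block_norm_mono[OF q, of k] G(1) by auto
    qed
    then show ?thesis using card_image[OF inj_on_subset[OF inj subset_UNIV], of G] by linarith
  qed
  then have "finite {k. block_norm q k \<le> R} \<and> card {k. block_norm q k \<le> R} \<le> nat \<lfloor>12 * R\<rfloor>"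
    by (rule finite_if_finite_subsets_card_bdd)
  then show ?thesis using R by (auto simp: le_nat_iff le_floor_iff)
qed

lemma block_norm_relabelling:
  assumes "1 \<le> q"
  obtains m :: "nat \<Rightarrow> nat" and C :: real
  where "inj m" "1 \<le> C" "\<And>k. block_norm q k \<le> real (Suc (m k))" "\<And>k. real (Suc (m k)) \<le> C * (block_norm q k)\<^sup>2"
  using polynomial_relabelling[of "block_norm q" 12, OF block_norm_ge_1 _ block_norm_count[OF assms]] by auto

text \<open>
  Nuclearity: the weights \<open>block_norm 1 k\<close> grow at least like a root of an injective enumeration,
  hence a loss of finitely many powers turns a supremum bound on coefficients into absolute
  convergence.
\<close>

lemma coefficient_sum_bound:
  "\<exists>m C. 0 < C \<and>
    (\<forall>c K n. (\<forall>k. cmod (c k) * block_norm m k \<le> K) \<longrightarrow> (\<Sum>k<n. cmod (c k) * L_norm q (P k)) \<le> C * K)"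
proof -
  obtain l :: "nat \<Rightarrow> nat" and D where l: "inj l" "1 \<le> D" "\<And>k. real (Suc (l k)) \<le> D * (block_norm 1 k)\<^sup>2"
    using block_norm_relabelling[of 1] by (metis order_refl)
  define M where "M = 16 * Suc q"
  define C where "C = 12 * D\<^sup>2"
  \<comment> \<open>Exponent \<open>5\<close>: one weight from the norm of \<open>P k\<close> and four that pay for the summable factor
    \<open>1 / (l k + 1)\<^sup>2\<close>.  The summand \<open>1\<close> added to \<open>zeta2\<close> makes positivity of the constant evident.\<close>
  have "(\<Sum>k<n. cmod (c k) * L_norm q (P k)) \<le> (C * (zeta2 + 1)) * K"
    if K: "\<forall>k. cmod (c k) * block_norm (2 ^ 5 * M) k \<le> K" for c K n
  proof -
    have K0: "0 \<le> K"
      using order_trans[OF mult_nonneg_nonneg K[rule_format, of 0]] block_norm_ge_1[of "2 ^ 5 * M" 0] by simp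
    have each: "cmod (c k) * L_norm q (P k) \<le> C * K * (1 / (real (Suc (l k)))\<^sup>2)" for k
    proof -
      let ?b = "block_norm M k" and ?t = "real (Suc (l k))"
      have b: "1 \<le> ?b" "block_norm 1 k \<le> ?b" using block_norm_ge_1 block_norm_mono[of 1 M k] by (auto simp: M_def)
      have "(block_norm 1 k)\<^sup>2 \<le> ?b\<^sup>2" using b(2) block_norm_ge_1[of 1 k] by (intro power_mono) auto
      then have "D * (block_norm 1 k)\<^sup>2 \<le> D * ?b\<^sup>2" using l(2) by (intro mult_left_mono) auto
      then have "?t \<le> D * ?b\<^sup>2" using l(3)[of k] by linarith
      then have "?t\<^sup>2 \<le> (D * ?b\<^sup>2)\<^sup>2" by (intro power_mono) auto
      also have "\<dots> = D\<^sup>2 * ?b ^ 4" by (simp add: power_mult_distrib power_mult[symmetric])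
      finally have t: "?t\<^sup>2 \<le> D\<^sup>2 * ?b ^ 4" .
      have "(cmod (c k) * L_norm q (P k)) * ?t\<^sup>2 \<le> (cmod (c k) * (12 * ?b)) * (D\<^sup>2 * ?b ^ 4)"
        using L_norm_P_le[of q k] t b L_norm_nonneg[OF P_in_L] unfolding M_def
        by (intro mult_mono mult_nonneg_nonneg) auto
      also have "\<dots> = C * (cmod (c k) * ?b ^ 5)" unfolding C_def by (simp add: eval_nat_numeral mult_ac)
      also have "\<dots> \<le> C * (cmod (c k) * block_norm (2 ^ 5 * M) k)"
        unfolding C_def by (intro mult_left_mono block_norm_power_le) auto
      also have "\<dots> \<le> C * K" using K unfolding C_def by (intro mult_left_mono) auto
      finally show ?thesis by (simp add: pos_le_divide_eq del: of_nat_Suc)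
    qed
    have "(\<Sum>k<n. cmod (c k) * L_norm q (P k)) \<le> (\<Sum>k<n. C * K * (1 / (real (Suc (l k)))\<^sup>2))"
      by (rule sum_mono) (rule each)
    also have "\<dots> = C * K * (\<Sum>k<n. 1 / (real (Suc (l k)))\<^sup>2)" by (rule sum_distrib_left[symmetric])
    also have "(\<Sum>k<n. 1 / (real (Suc (l k)))\<^sup>2) = (\<Sum>i\<in>l ` {..<n}. 1 / (real (Suc i))\<^sup>2)"
      by (subst sum.reindex) (auto intro: inj_on_subset[OF l(1)])
    also have "C * K * \<dots> \<le> C * K * (zeta2 + 1)"
    proof (rule mult_left_mono)
      have "(\<Sum>i\<in>l ` {..<n}. 1 / (real (Suc i))\<^sup>2) \<le> zeta2"
        unfolding zeta2_def by (rule sum_le_suminf[OF summable_inverse_Suc_squares]) auto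
      then show "(\<Sum>i\<in>l ` {..<n}. 1 / (real (Suc i))\<^sup>2) \<le> zeta2 + 1" by simp
    qed (use K0 in \<open>simp add: C_def\<close>)
    finally show ?thesis by (simp add: mult_ac)
  qed
  moreover have "0 < C * (zeta2 + 1)" unfolding C_def using l(2) zeta2_nonneg by (intro mult_pos_pos) auto
  ultimately show ?thesis by (intro exI[of _ "2 ^ 5 * M"] exI[of _ "C * (zeta2 + 1)"] conjI allI impI)
qed

lemma L_norm_partial_sum_le: "L_norm q (\<Sum>k\<in>I. c k *\<^sub>C P k) \<le> (\<Sum>k\<in>I. cmod (c k) * L_norm q (P k))"
proof -
  have "L_norm q (\<Sum>k\<in>I. c k *\<^sub>C P k) \<le> (\<Sum>k\<in>I. L_norm q (c k *\<^sub>C P k))"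
    by (intro seminorm_on_sum[OF L.subspace L.grade_seminorm] L_space_scaleC(1) P_in_L)
  then show ?thesis by (simp only: seminorm_on_scaleC[OF L.grade_seminorm P_in_L])
qed

lemma L_norm_le_coef:
  "\<exists>m C. 0 < C \<and> (\<forall>x\<in>E. \<forall>K. (\<forall>k. cmod (coef x k) * block_norm m k \<le> K) \<longrightarrow> L_norm q x \<le> C * K)"
proof -
  from coefficient_sum_bound[of q] obtain m C where C: "0 < C"
    "\<forall>c K n. (\<forall>k. cmod (c k) * block_norm m k \<le> K) \<longrightarrow> (\<Sum>k<n. cmod (c k) * L_norm q (P k)) \<le> C * K"
    by (elim exE conjE)
  have "L_norm q x \<le> C * K" if x: "x \<in> E" and K: "\<forall>k. cmod (coef x k) * block_norm m k \<le> K" for x K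
  proof (rule tendsto_lowerbound)
    have S: "partial_sum (coef x) n \<in> L_space" for n by (rule E_in_L[OF partial_sum_in_E])
    show "(\<lambda>n. C * K + L_norm q (partial_sum (coef x) n - x)) \<longlonglongrightarrow> C * K"
      using tendsto_add[OF tendsto_const expansion(1)[OF x], of "C * K"] by simp
    have "L_norm q x \<le> C * K + L_norm q (partial_sum (coef x) n - x)" for n
    proof -
      have "L_norm q (x - 0) \<le> L_norm q (x - partial_sum (coef x) n) + L_norm q (partial_sum (coef x) n - 0)"
        by (rule seminorm_on_diff_triangle[OF L.subspace L.grade_seminorm cvec.subspace_0[OF L.subspace] E_in_L[OF x] S])
      moreover have "L_norm q (partial_sum (coef x) n) \<le> C * K"
        by (rule order_trans[OF L_norm_partial_sum_le C(2)[rule_format, OF K[rule_format]]])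
      ultimately show ?thesis
        using seminorm_on_minus_commute[OF L.subspace L.grade_seminorm E_in_L[OF x] S, of q n] by simp
    qed
    then show "\<forall>\<^sub>F n in sequentially. L_norm q x \<le> C * K + L_norm q (partial_sum (coef x) n - x)" by simp
  qed simp
  then show ?thesis using C(1) by (intro exI[of _ m] exI[of _ C] conjI ballI allI impI)
qed

lemma coef_inject:
  assumes x: "x \<in> E" and y: "y \<in> E" and eq: "coef x = coef y"
  shows "x = y"
proof (rule L_eqI[OF E_in_L[OF x] E_in_L[OF y]])
  fix \<xi> assume \<xi>: "\<xi> \<in> s_space"
  have xy: "x - y \<in> E" by (rule cvec.subspace_diff[OF E_subspace x y])
  have "coef (x - y) k = 0" for k
    using coef_add[OF xy y, of k] eq by simp
  moreover from L_norm_le_coef[of 0] obtain m C where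
    C: "\<forall>z\<in>E. \<forall>K. (\<forall>k. cmod (coef z k) * block_norm m k \<le> K) \<longrightarrow> L_norm 0 z \<le> C * K"
    by (elim exE conjE)
  ultimately have "L_norm 0 (x - y) \<le> C * 0" by (intro C[rule_format, OF xy]) simp
  then have "L_norm 0 (x - y) = 0" using L_norm_nonneg[OF E_in_L[OF xy], of 0] by simp
  then have "s_norm 0 ((x - y) \<xi>) \<le> 0"
    using L_norm_bound[OF E_in_L[OF xy] s_subset_s'_step(1)[OF \<xi>, of 0]] by simp
  then have "(x - y) \<xi> = 0" by (rule s_norm_zero_imp[OF L_maps[OF E_in_L[OF xy] s_subset_s'[OF \<xi>]]])
  then show "x \<xi> = y \<xi>" by simp
qed

text \<open>
  Every coefficient sequence that decays against all weights occurs: its expansion converges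
  absolutely in the complete space \<open>L_space\<close>, and \<open>E\<close> is closed.
\<close>

lemma coef_surj:
  assumes c: "\<And>q. \<exists>K. \<forall>k. cmod (c k) * block_norm q k \<le> K"
  obtains x where "x \<in> E" "coef x = c"
proof -
  have summ: "summable (\<lambda>k. cmod (c k) * L_norm q (P k))" for q
  proof -
    from coefficient_sum_bound[of q] obtain m C where C:
      "\<forall>c K n. (\<forall>k. cmod (c k) * block_norm m k \<le> K) \<longrightarrow> (\<Sum>k<n. cmod (c k) * L_norm q (P k)) \<le> C * K"
      by (elim exE conjE)
    obtain K where "\<forall>k. cmod (c k) * block_norm m k \<le> K" using c by blast
    then have "(\<Sum>k<n. cmod (c k) * L_norm q (P k)) \<le> C * K" for n by (intro C[rule_format]) simp
    then show ?thesis
      by (intro summableI_nonneg_bounded[of _ "C * K"] mult_nonneg_nonneg L_norm_nonneg P_in_L) auto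
  qed
  have S_L: "partial_sum c n \<in> L_space" for n by (rule E_in_L[OF partial_sum_in_E])
  have cauchy: "\<exists>M. \<forall>m\<ge>M. \<forall>n\<ge>M. L_norm q (partial_sum c m - partial_sum c n) < e" if e: "0 < e" for q e
  proof -
    let ?U = "\<lambda>n. \<Sum>k<n. cmod (c k) * L_norm q (P k)"
    have "Cauchy ?U" using summ[of q] by (simp add: Cauchy_convergent_iff summable_iff_convergent)
    then obtain M where M: "\<And>m n. m \<ge> M \<Longrightarrow> n \<ge> M \<Longrightarrow> dist (?U m) (?U n) < e"
      using e unfolding Cauchy_def by meson
    have le: "L_norm q (partial_sum c m - partial_sum c n) \<le> dist (?U m) (?U n)" if "n \<le> m" for m n
    proof -
      have "partial_sum c m - partial_sum c n = (\<Sum>k\<in>{n..<m}. c k *\<^sub>C P k)"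
        using sum_diff_nat_ivl[of 0 n m "\<lambda>k. c k *\<^sub>C P k"] that by (simp add: atLeast0LessThan)
      moreover have "?U m - ?U n = (\<Sum>k\<in>{n..<m}. cmod (c k) * L_norm q (P k))"
        using sum_diff_nat_ivl[of 0 n m "\<lambda>k. cmod (c k) * L_norm q (P k)"] that by (simp add: atLeast0LessThan)
      ultimately show ?thesis using L_norm_partial_sum_le[of q c "{n..<m}"] by (simp add: dist_norm)
    qed
    have "L_norm q (partial_sum c m - partial_sum c n) < e" if "m \<ge> M" "n \<ge> M" for m n
    proof (cases "n \<le> m")
      case True
      then show ?thesis using le[OF True] M[OF that] by simp
    next
      case False
      then have "L_norm q (partial_sum c n - partial_sum c m) < e" using le[of m n] M[OF that(2,1)] by simp
      then show ?thesis
        using seminorm_on_minus_commute[OF L.subspace L.grade_seminorm S_L S_L, of q m n] by simp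
    qed
    then show ?thesis by blast
  qed
  have "\<exists>x. x \<in> L_space \<and> (\<forall>q. (\<lambda>n. L_norm q (partial_sum c n - x)) \<longlonglongrightarrow> 0) \<and>
      (\<forall>\<xi> i. (\<lambda>n. partial_sum c n \<xi> i) \<longlonglongrightarrow> x \<xi> i)"
    by (rule L_space_complete[OF S_L]) (rule cauchy)
  then obtain x where x: "x \<in> L_space"
    "\<forall>q. (\<lambda>n. L_norm q (partial_sum c n - x)) \<longlonglongrightarrow> 0" "\<forall>\<xi> i. (\<lambda>n. partial_sum c n \<xi> i) \<longlonglongrightarrow> x \<xi> i"
    by (elim exE conjE)
  have xE: "x \<in> E" by (rule E_limit[OF partial_sum_in_E x(1) x(2)[rule_format]])
  have "coef x k = c k" for k
  proof (rule coef_eqI_some)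
    fix j assume j: "j \<in> N k"
    show "x (f j) = c k *\<^sub>C f j"
    proof
      fix i
      have "\<forall>\<^sub>F n in sequentially. partial_sum c n (f j) i = (c k *\<^sub>C f j) i"
        using eventually_gt_at_top[of k] by eventually_elim (simp only: partial_sum_f[OF j])
      then have "(\<lambda>n. partial_sum c n (f j) i) \<longlonglongrightarrow> (c k *\<^sub>C f j) i" by (rule tendsto_eventually)
      then show "x (f j) i = (c k *\<^sub>C f j) i" using LIMSEQ_unique[OF x(3)[rule_format]] by simp
    qed
  qed
  then show thesis using that[OF xE] by auto
qed

lemma pairing_expansion:
  assumes x: "x \<in> E" and \<xi>: "\<xi> \<in> ell2" and \<eta>: "\<eta> \<in> ell2"
  shows "(\<lambda>n. \<Sum>k<n. coef x k * pairing (P k \<xi>) \<eta>) \<longlonglongrightarrow> pairing (x \<xi>) \<eta>"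
proof -
  let ?S = "partial_sum (coef x)"
  have \<xi>': "\<xi> \<in> s'_step 0" "\<xi> \<in> s'_space" using \<xi> ell2_subset_s' by (auto simp: ell2_eq(1))
  have ell2: "y \<xi> \<in> ell2" if "y \<in> E" for y
    by (rule s_subset_ell2[OF L_maps[OF E_in_L[OF that] \<xi>'(2)]])
  have D: "?S n - x \<in> E" for n by (rule cvec.subspace_diff[OF E_subspace partial_sum_in_E x])
  have eq: "pairing (?S n \<xi>) \<eta> = (\<Sum>k<n. coef x k * pairing (P k \<xi>) \<eta>)" for n
    unfolding partial_sum_apply by (intro pairing_sum_left pairing_ell2_summable(1)[OF ell2[OF P_in_E] \<eta>])
  have diff: "pairing (?S n \<xi>) \<eta> - pairing (x \<xi>) \<eta> = pairing ((?S n - x) \<xi>) \<eta>" for n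
  proof -
    have "?S n \<xi> = (?S n - x) \<xi> + x \<xi>" by (simp only: minus_apply diff_add_cancel)
    then have "pairing (?S n \<xi>) \<eta> = pairing ((?S n - x) \<xi>) \<eta> + pairing (x \<xi>) \<eta>"
      using pairing_add_left[OF pairing_ell2_summable(1)[OF ell2[OF D] \<eta>] pairing_ell2_summable(1)[OF ell2[OF x] \<eta>]]
      by metis
    then show ?thesis by simp
  qed
  have "(\<lambda>n. pairing (?S n \<xi>) \<eta> - pairing (x \<xi>) \<eta>) \<longlonglongrightarrow> 0"
  proof (rule Lim_null_comparison)
    have "norm (pairing (?S n \<xi>) \<eta> - pairing (x \<xi>) \<eta>) \<le> L_norm 0 (?S n - x) * (s'_norm 0 \<xi> * s'_norm 0 \<eta>)" for n
    proof -
      have "norm (pairing (?S n \<xi>) \<eta> - pairing (x \<xi>) \<eta>) \<le> s'_norm 0 ((?S n - x) \<xi>) * s'_norm 0 \<eta>"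
        unfolding diff by (rule pairing_ell2_summable(2)[OF ell2[OF D] \<eta>])
      also have "\<dots> \<le> (L_norm 0 (?S n - x) * s'_norm 0 \<xi>) * s'_norm 0 \<eta>"
        using L_norm_bound[OF E_in_L[OF D] \<xi>'(1)] \<eta> unfolding s_norm_0 ell2_eq(1)
        by (intro mult_right_mono s'_norm_nonneg)
      finally show ?thesis by (simp only: mult.assoc)
    qed
    then show "\<forall>\<^sub>F n in sequentially. norm (pairing (?S n \<xi>) \<eta> - pairing (x \<xi>) \<eta>)
        \<le> L_norm 0 (?S n - x) * (s'_norm 0 \<xi> * s'_norm 0 \<eta>)" by (rule always_eventually[OF allI])
    show "(\<lambda>n. L_norm 0 (?S n - x) * (s'_norm 0 \<xi> * s'_norm 0 \<eta>)) \<longlonglongrightarrow> 0"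
      by (rule tendsto_mult_left_zero[OF expansion(1)[OF x]])
  qed
  then have "(\<lambda>n. pairing (?S n \<xi>) \<eta>) \<longlonglongrightarrow> pairing (x \<xi>) \<eta>" by (simp only: LIM_zero_iff)
  then show ?thesis by (simp only: eq)
qed

text \<open>
  The projections are self-adjoint, so the element of \<open>E\<close> with the conjugate coefficients, which
  exists by \<open>coef_surj\<close>, is an adjoint of \<open>x\<close>.
\<close>

lemma coef_star:
  assumes x: "x \<in> E"
  shows "coef (L_star x) k = cnj (coef x k)"
proof -
  have "\<exists>K. \<forall>k. cmod (cnj (coef x k)) * block_norm q k \<le> K" for q
    using coef_bound[OF x, of _ q] by auto
  then obtain y where y: "y \<in> E" "coef y = (\<lambda>k. cnj (coef x k))"
    by (rule coef_surj)
  have "L_star x = y"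
  proof (rule L_star_eqI[OF E_in_L[OF y(1)]])
    fix \<xi> \<eta> assume \<xi>: "\<xi> \<in> ell2" and \<eta>: "\<eta> \<in> ell2"
    have y2: "z \<eta> \<in> ell2" if "z \<in> E" for z
      by (rule s_subset_ell2[OF L_maps[OF E_in_L[OF that] subsetD[OF ell2_subset_s' \<eta>]]])
    have "(\<lambda>n. cnj (\<Sum>k<n. coef y k * pairing (P k \<eta>) \<xi>)) \<longlonglongrightarrow> cnj (pairing (y \<eta>) \<xi>)"
      by (intro tendsto_cnj pairing_expansion[OF y(1) \<eta> \<xi>])
    moreover have "cnj (\<Sum>k<n. coef y k * pairing (P k \<eta>) \<xi>) = (\<Sum>k<n. coef x k * pairing (P k \<xi>) \<eta>)" for n
      using span_projection_self_adjoint[where f = f, OF f_in_s \<xi> \<eta>] pairing_cnj[OF pairing_ell2_summable(1)[OF y2[OF P_in_E] \<xi>]]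
      by (simp add: y(2))
    moreover have "cnj (pairing (y \<eta>) \<xi>) = pairing \<xi> (y \<eta>)"
      by (rule pairing_cnj[OF pairing_ell2_summable(1)[OF y2[OF y(1)] \<xi>], symmetric])
    ultimately show "pairing (x \<xi>) \<eta> = pairing \<xi> (y \<eta>)"
      using LIMSEQ_unique[OF pairing_expansion[OF x \<xi> \<eta>]] by simp
  qed
  then show ?thesis using y(2) by simp
qed

end


section \<open>The equivalences\<close>

lemma closed_coordinate_subspace:
  "closedin s_top {\<xi> \<in> s_space. \<forall>i. i \<notin> I \<longrightarrow> \<xi> i = 0}"
  unfolding closedin_def topspace_s_top
proof
  show "openin s_top (s_space - {\<xi> \<in> s_space. \<forall>i. i \<notin> I \<longrightarrow> \<xi> i = 0})"
    unfolding s_top_def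
  proof (rule s.openinI)
    fix \<xi> assume "\<xi> \<in> s_space - {\<xi> \<in> s_space. \<forall>i. i \<notin> I \<longrightarrow> \<xi> i = 0}"
    then obtain i where i: "\<xi> \<in> s_space" "i \<notin> I" "\<xi> i \<noteq> 0" by blast
    have "\<eta> i \<noteq> 0" if "\<eta> \<in> s_space" "s_norm 0 (\<eta> - \<xi>) < cmod (\<xi> i)" for \<eta>
      using s_norm_coordinate_le[OF cvec.subspace_diff[OF s.subspace that(1) i(1)], of i 0] that(2) by auto
    then have "{\<eta> \<in> s_space. s_norm 0 (\<eta> - \<xi>) < cmod (\<xi> i)} \<subseteq> s_space - {\<xi> \<in> s_space. \<forall>i. i \<notin> I \<longrightarrow> \<xi> i = 0}"
      using i(2) by blast
    then show "\<exists>p\<in>range s_norm. \<exists>e>0. {\<eta> \<in> s_space. p (\<eta> - \<xi>) < e}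
        \<subseteq> s_space - {\<xi> \<in> s_space. \<forall>i. i \<notin> I \<longrightarrow> \<xi> i = 0}"
      using i(3) by (intro bexI[of _ "s_norm 0"] exI[of _ "cmod (\<xi> i)"] conjI) auto
  qed blast
qed blast

lemma complemented_coordinate_subspace:
  "complemented_in s_top {\<xi> \<in> s_space. \<forall>i. i \<notin> I \<longrightarrow> \<xi> i = 0}"
proof -
  define \<pi> :: "cseq \<Rightarrow> cseq" where "\<pi> \<xi> = (\<lambda>i. if i \<in> I then \<xi> i else 0)" for \<xi>
  have *: "\<pi> \<xi> \<in> wspace (s_weight q) \<and> s_norm q (\<pi> \<xi>) \<le> 1 * s_norm q \<xi>" if "\<xi> \<in> s_space" for \<xi> q
    using wnorm_le_on_support[of "s_weight q" "s_weight q" 1 \<xi> "\<pi> \<xi>"] s_in_wspace[OF that, of q]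
    by (simp add: \<pi>_def s_norm_eq_wnorm)
  then have maps: "\<pi> \<xi> \<in> s_space" if "\<xi> \<in> s_space" for \<xi>
    using that unfolding s_space_eq[THEN arg_cong, of "\<lambda>S. \<pi> \<xi> \<in> S"] by blast
  have lin: "clinear_on s_space \<pi>"
    by (auto simp: clinear_on_def \<pi>_def scaleC_fun_def scaleC_complex_def)
  have "continuous_map s_top s_top \<pi>"
    unfolding s_top_def
  proof (rule bound_imp_continuous_map[OF s.seminormed_space_axioms s.seminormed_space_axioms lin maps])
    fix p assume "p \<in> range s_norm"
    then obtain q where "p = s_norm q" by (rule rangeE)
    then show "\<exists>p'\<in>range s_norm. \<exists>C. \<forall>\<xi>\<in>s_space. p (\<pi> \<xi>) \<le> C * p' \<xi>"
      using * by (intro bexI[of _ "s_norm q"] exI[of _ 1]) auto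
  qed
  moreover have "\<pi> (\<pi> \<xi>) = \<pi> \<xi>" for \<xi> by (simp add: \<pi>_def fun_eq_iff)
  moreover have "\<pi> ` s_space = {\<xi> \<in> s_space. \<forall>i. i \<notin> I \<longrightarrow> \<xi> i = 0}"
  proof safe
    fix \<xi> assume "\<xi> \<in> s_space" "\<forall>i. i \<notin> I \<longrightarrow> \<xi> i = 0"
    moreover from this have "\<xi> = \<pi> \<xi>" by (auto simp: \<pi>_def)
    ultimately show "\<xi> \<in> \<pi> ` s_space" by (metis imageI)
  qed (use maps in \<open>auto simp: \<pi>_def\<close>)
  ultimately show ?thesis
    unfolding complemented_in_def topspace_s_top using lin by (intro exI[of _ \<pi>]) simp
qed

text \<open>
  An idempotent sequence only takes the values \<open>0\<close> and \<open>1\<close>, so \<open>j + 1 \<le> s_norm 1 \<xi>\<close> for each \<open>j\<close> in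
  its support.  All but one of the powers of \<open>j + 1\<close> in the higher norm are estimated in this way.
\<close>

lemma s_norm_idempotent_le:
  assumes \<xi>: "\<xi> \<in> s_space" and idem: "s_mult \<xi> \<xi> = \<xi>"
  shows "s_norm (Suc q) \<xi> \<le> s_norm 1 \<xi> ^ Suc q"
proof -
  have idem_at: "\<xi> j = 0 \<or> \<xi> j = 1" for j
    using fun_cong[OF idem, of j] by (auto simp: s_mult_def)
  have sq: "(cmod (\<xi> j))\<^sup>2 = cmod (\<xi> j)" "cmod (\<xi> j) \<le> 1" for j using idem_at[of j] by auto
  let ?T = "s_norm 1 \<xi>"
  have T0: "0 \<le> ?T" by (rule s_norm_nonneg[OF \<xi>])
  have le: "(cmod (\<xi> j))\<^sup>2 * s_weight (Suc q) j \<le> (?T ^ q)\<^sup>2 * ((cmod (\<xi> j))\<^sup>2 * s_weight 1 j)" for j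
  proof (cases "\<xi> j = 0")
    case False
    then have "\<xi> j = 1" using idem_at by blast
    then have "real (Suc j) \<le> ?T" using s_norm_coordinate_le[OF \<xi>, of j 1] by simp
    then have "real (Suc j) ^ (2 * q) \<le> ?T ^ (2 * q)" by (intro power_mono) auto
    then have "real (Suc j) ^ (2 * q) * (real (Suc j))\<^sup>2 \<le> (?T ^ q)\<^sup>2 * (real (Suc j))\<^sup>2"
      unfolding power_even_eq[of ?T] by (intro mult_right_mono) auto
    moreover have "s_weight (Suc q) j = real (Suc j) ^ (2 * q) * (real (Suc j))\<^sup>2"
      by (simp add: power_add[symmetric] del: of_nat_Suc)
    ultimately show ?thesis using \<open>\<xi> j = 1\<close> by (simp del: of_nat_Suc power_Suc)
  qed simp
  have "(\<Sum>j<n. (cmod (\<xi> j))\<^sup>2 * s_weight (Suc q) j) \<le> (?T ^ Suc q)\<^sup>2" for n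
  proof -
    have "(\<Sum>j<n. (cmod (\<xi> j))\<^sup>2 * s_weight (Suc q) j) \<le> (\<Sum>j<n. (?T ^ q)\<^sup>2 * ((cmod (\<xi> j))\<^sup>2 * s_weight 1 j))"
      by (rule sum_mono) (rule le)
    also have "\<dots> \<le> (?T ^ q)\<^sup>2 * ?T\<^sup>2"
      unfolding sum_distrib_left[symmetric]
      using wnorm_partial_sum_le[of "s_weight 1" \<xi> n] s_in_wspace[OF \<xi>, of 1]
      by (intro mult_left_mono) (auto simp: s_norm_eq_wnorm)
    finally show ?thesis by (simp add: power_mult_distrib mult.commute)
  qed
  then show ?thesis
    using wnorm_leI(2)[of "s_weight (Suc q)" "?T ^ Suc q" \<xi>] T0 unfolding s_norm_eq_wnorm by simp
qed

context block_diagonal_algebra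
begin

definition polynomially_bounded_blocks :: bool where
  "polynomially_bounded_blocks \<longleftrightarrow>
    (\<exists>p. \<forall>q. \<exists>r C. 0 < C \<and> (\<forall>k. block_norm q k \<le> C * block_norm p k ^ r))"

lemma s_subtopology_eq:
  "cvec.subspace F \<Longrightarrow> F \<subseteq> s_space \<Longrightarrow> subtopology s_top F = seminorm_topology F (range s_norm)"
  unfolding s_top_def by (rule s.subtopology_eq)

lemma frechet_isoD:
  assumes F: "cvec.subspace F" "F \<subseteq> s_space" and iso: "frechet_iso L_top E s_top F \<phi>"
  shows "bij_betw \<phi> E F" "clinear_on E \<phi>"
    "\<exists>m C. 0 < C \<and> (\<forall>x\<in>E. s_norm q (\<phi> x) \<le> C * L_norm m x)"
    "\<exists>m C. 0 < C \<and> (\<forall>y\<in>F. L_norm q (inv_into E \<phi> y) \<le> C * s_norm m y)"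
proof -
  have lin: "clinear_on E \<phi>"
    and homeo: "homeomorphic_map (seminorm_topology E (range L_norm)) (seminorm_topology F (range s_norm)) \<phi>"
    using iso unfolding frechet_iso_def subtopology_E s_subtopology_eq[OF F] by auto
  note * = homeomorphic_map_imp_bounds[OF graded_E s.graded_subspace[OF F] lin homeo]
  show "bij_betw \<phi> E F" "clinear_on E \<phi>"
    "\<exists>m C. 0 < C \<and> (\<forall>x\<in>E. s_norm q (\<phi> x) \<le> C * L_norm m x)"
    "\<exists>m C. 0 < C \<and> (\<forall>y\<in>F. L_norm q (inv_into E \<phi> y) \<le> C * s_norm m y)"
    using * lin by auto
qed

text \<open>
  The isomorphism makes the weights of \<open>E\<close> comparable with the norms of the images of the basis
  projections.  These images are idempotent, so all their norms are at most powers of the first one,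
  and the same follows for the weights.
\<close>

lemma polynomial_bound_if_star_iso:
  assumes F: "closed_star_subalgebra s_top s_mult s_star F"
    and iso: "frechet_star_iso L_top (\<circ>) L_star E s_top s_mult s_star F \<phi>"
  shows polynomially_bounded_blocks
proof -
  have F_sub: "cvec.subspace F" "F \<subseteq> s_space"
    using F closedin_subset[of s_top F] unfolding closed_star_subalgebra_def topspace_s_top by auto
  have fiso: "frechet_iso L_top E s_top F \<phi>"
    and mult: "\<phi> (x \<circ> y) = s_mult (\<phi> x) (\<phi> y)" if "x \<in> E" "y \<in> E" for x y
    using iso that by (auto simp: frechet_star_iso_def)
  note fiso = fiso[OF P_in_E[of 0] P_in_E[of 0]]
  note iso_facts = frechet_isoD[OF F_sub fiso]
  have \<phi>P: "\<phi> (P k) \<in> s_space" for k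
    using bij_betwE[OF iso_facts(1)] P_in_E F_sub(2) by blast
  have PP: "P k \<circ> P k = P k" for k
    by (rule coef_inject[OF E_mult[OF P_in_E P_in_E] P_in_E]) (simp add: fun_eq_iff coef_mult[OF P_in_E P_in_E] coef_P)
  have idem: "s_mult (\<phi> (P k)) (\<phi> (P k)) = \<phi> (P k)" for k
    using mult[OF P_in_E[of k] P_in_E[of k]] PP by simp
  obtain m1 C1 where C1: "0 < C1" "\<forall>x\<in>E. s_norm 1 (\<phi> x) \<le> C1 * L_norm m1 x"
    using iso_facts(3)[of 1] by (elim exE conjE)
  define p where "p = 16 * Suc m1"
  have \<phi>P_le: "s_norm 1 (\<phi> (P k)) \<le> (12 * C1) * block_norm p k" for k
  proof -
    have "s_norm 1 (\<phi> (P k)) \<le> C1 * L_norm m1 (P k)" using C1(2) P_in_E by blast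
    also have "\<dots> \<le> C1 * (12 * block_norm p k)"
      unfolding p_def using C1(1) by (intro mult_left_mono L_norm_P_le) auto
    finally show ?thesis by simp
  qed
  have "\<exists>r C. 0 < C \<and> (\<forall>k. block_norm q k \<le> C * block_norm p k ^ r)" for q
  proof -
    obtain m C where C: "0 < C" "\<forall>y\<in>F. L_norm q (inv_into E \<phi> y) \<le> C * s_norm m y"
      using iso_facts(4)[of q] by (elim exE conjE)
    have "block_norm q k \<le> (C * (12 * C1) ^ Suc m) * block_norm p k ^ Suc m" for k
    proof -
      have "inv_into E \<phi> (\<phi> (P k)) = P k"
        by (rule inv_into_f_f[OF bij_betw_imp_inj_on[OF iso_facts(1)] P_in_E])
      then have "L_norm q (P k) \<le> C * s_norm m (\<phi> (P k))"
        using C(2) bij_betwE[OF iso_facts(1)] P_in_E[of k] by fastforce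
      then have "block_norm q k \<le> C * s_norm m (\<phi> (P k))" using block_norm_le_L_norm[of q k] by simp
      also have "\<dots> \<le> C * s_norm (Suc m) (\<phi> (P k))" using C(1) by (intro mult_left_mono s.mono \<phi>P) auto
      also have "\<dots> \<le> C * s_norm 1 (\<phi> (P k)) ^ Suc m"
        using C(1) by (intro mult_left_mono s_norm_idempotent_le \<phi>P idem) auto
      also have "\<dots> \<le> C * ((12 * C1) * block_norm p k) ^ Suc m"
        using C(1) s_norm_nonneg[OF \<phi>P] by (intro mult_left_mono power_mono \<phi>P_le) auto
      finally show ?thesis by (simp only: power_mult_distrib mult.assoc)
    qed
    moreover have "0 < C * (12 * C1) ^ Suc m" using C(1) C1(1) by simp
    ultimately show ?thesis by blast
  qed
  then show ?thesis unfolding polynomially_bounded_blocks_def by blast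
qed

text \<open>
  Under a polynomial bound the powers of one weight \<open>block_norm p\<close> define the topology of \<open>E\<close>.  The
  relabelling \<open>m\<close> makes this weight comparable with \<open>m k\<close>, so that sending the \<open>k\<close>-th coefficient to
  position \<open>m k\<close> identifies \<open>E\<close> with a coordinate subspace of \<open>s\<close>.
\<close>

lemma coordinate_iso_if_polynomial_bound:
  assumes polynomially_bounded_blocks
  shows "\<exists>I \<phi>.
    frechet_star_iso L_top (\<circ>) L_star E s_top s_mult s_star {\<xi> \<in> s_space. \<forall>i. i \<notin> I \<longrightarrow> \<xi> i = 0} \<phi> \<and>
    closed_star_subalgebra s_top s_mult s_star {\<xi> \<in> s_space. \<forall>i. i \<notin> I \<longrightarrow> \<xi> i = 0}"
proof -
  obtain p0 where p0: "\<forall>q. \<exists>r C. 0 < C \<and> (\<forall>k. block_norm q k \<le> C * block_norm p0 k ^ r)"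
    using assms unfolding polynomially_bounded_blocks_def by blast
  \<comment> \<open>The count of small weights starts at index \<open>1\<close>; a larger index preserves the domination.\<close>
  define p where "p = Suc p0"
  obtain m :: "nat \<Rightarrow> nat" and D where m: "inj m" "1 \<le> D" "\<And>k. block_norm p k \<le> real (Suc (m k))"
    "\<And>k. real (Suc (m k)) \<le> D * (block_norm p k)\<^sup>2"
    using block_norm_relabelling[of p] unfolding p_def by (metis le_add1 plus_1_eq_Suc)
  have dom: "\<exists>r C. 0 < C \<and> (\<forall>k. block_norm q k \<le> C * real (Suc (m k)) ^ r)" for q
  proof -
    obtain r C where C: "0 < C" "\<forall>k. block_norm q k \<le> C * block_norm p0 k ^ r" using p0 by blast
    have "block_norm q k \<le> C * real (Suc (m k)) ^ r" for k
    proof -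
      have "block_norm p0 k \<le> real (Suc (m k))"
        using m(3)[of k] block_norm_mono[of p0 p k] by (simp add: p_def)
      then have "C * block_norm p0 k ^ r \<le> C * real (Suc (m k)) ^ r"
        using C(1) block_norm_ge_1[of p0 k] by (intro mult_left_mono power_mono) auto
      then show ?thesis using C(2)[rule_format, of k] by linarith
    qed
    then show ?thesis using C(1) by blast
  qed
  define I where "I = range m"
  define F where "F = {\<xi> \<in> s_space. \<forall>i. i \<notin> I \<longrightarrow> \<xi> i = 0}"
  define \<phi> :: "cseq_op \<Rightarrow> cseq" where "\<phi> x = (\<lambda>i. if i \<in> I then coef x (inv m i) else 0)" for x
  have \<phi>_m: "\<phi> x (m k) = coef x k" for x k using m(1) by (simp add: \<phi>_def I_def)
  have \<phi>_eqI: "\<phi> x = \<xi>" if "\<And>k. coef x k = \<xi> (m k)" "\<And>i. i \<notin> I \<Longrightarrow> \<xi> i = 0" for x \<xi>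
  proof
    fix i show "\<phi> x i = \<xi> i"
    proof (cases "i \<in> I")
      case True
      then obtain k where "i = m k" by (auto simp: I_def)
      then show ?thesis using that(1)[of k] \<phi>_m[of x k] by simp
    next
      case False
      then show ?thesis using that(2) by (simp add: \<phi>_def)
    qed
  qed
  have up: "\<phi> x \<in> wspace (s_weight q) \<and>
      s_norm q (\<phi> x) \<le> (sqrt zeta2 * D ^ Suc q) * L_norm (2 ^ (2 * Suc q) * p) x" if x: "x \<in> E" for x q
  proof -
    let ?K = "D ^ Suc q * L_norm (2 ^ (2 * Suc q) * p) x"
    have "cmod (\<phi> x i) * real (Suc i) ^ Suc q \<le> ?K" for i
    proof (cases "i \<in> I")
      case True
      then obtain k where k: "i = m k" by (auto simp: I_def)
      have "real (Suc (m k)) ^ Suc q \<le> (D * (block_norm p k)\<^sup>2) ^ Suc q" by (intro power_mono m(4)) simp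
      also have "\<dots> = D ^ Suc q * block_norm p k ^ (2 * Suc q)"
        by (simp only: power_mult_distrib power_mult[symmetric])
      also have "\<dots> \<le> D ^ Suc q * block_norm (2 ^ (2 * Suc q) * p) k"
        using m(2) by (intro mult_left_mono block_norm_power_le) auto
      finally have "cmod (coef x k) * real (Suc (m k)) ^ Suc q
          \<le> cmod (coef x k) * (D ^ Suc q * block_norm (2 ^ (2 * Suc q) * p) k)" by (rule mult_left_mono) simp
      also have "\<dots> = D ^ Suc q * (cmod (coef x k) * block_norm (2 ^ (2 * Suc q) * p) k)" by (simp only: mult_ac)
      also have "\<dots> \<le> ?K" using m(2) by (intro mult_left_mono coef_bound[OF x]) auto
      finally show ?thesis by (simp only: k \<phi>_m)
    next
      case False
      then have "cmod (\<phi> x i) = 0" by (simp add: \<phi>_def)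
      moreover have "0 \<le> ?K" using m(2) L_norm_nonneg[OF E_in_L[OF x]] by (intro mult_nonneg_nonneg) auto
      ultimately show ?thesis by simp
    qed
    then show ?thesis using s_norm_le_sup[of "\<phi> x" q ?K] by (simp only: mult.assoc simp_thms)
  qed
  have \<phi>_s: "\<phi> x \<in> s_space" if "x \<in> E" for x
    using up[OF that] by (simp add: s_space_eq)
  have \<phi>_F: "\<phi> x \<in> F" if "x \<in> E" for x
    using \<phi>_s[OF that] by (simp add: F_def \<phi>_def)
  have lin: "clinear_on E \<phi>"
    unfolding clinear_on_def
    by (auto intro!: ext simp: \<phi>_def coef_add coef_scaleC scaleC_fun_def[where 'b = complex] scaleC_complex_def)
  have coef_m: "cmod (\<xi> (m k)) * block_norm q k \<le> C * s_norm r \<xi>"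
    if "\<xi> \<in> s_space" "0 < C" "\<forall>k. block_norm q k \<le> C * real (Suc (m k)) ^ r" for \<xi> q C r k
  proof -
    have "cmod (\<xi> (m k)) * block_norm q k \<le> cmod (\<xi> (m k)) * (C * real (Suc (m k)) ^ r)"
      using that(3) by (intro mult_left_mono) auto
    also have "\<dots> = C * (cmod (\<xi> (m k)) * real (Suc (m k)) ^ r)" by (simp only: mult_ac)
    also have "\<dots> \<le> C * s_norm r \<xi>" using that(2) by (intro mult_left_mono s_norm_coordinate_le that(1)) auto
    finally show ?thesis .
  qed
  have down: "\<exists>r C. \<forall>x\<in>E. L_norm q x \<le> C * s_norm r (\<phi> x)" for q
  proof -
    from L_norm_le_coef[of q] obtain l C where C: "0 < C"
      "\<forall>x\<in>E. \<forall>K. (\<forall>k. cmod (coef x k) * block_norm l k \<le> K) \<longrightarrow> L_norm q x \<le> C * K" by (elim exE conjE)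
    from dom[of l] obtain r C' where C': "0 < C'" "\<forall>k. block_norm l k \<le> C' * real (Suc (m k)) ^ r"
      by (elim exE conjE)
    have "L_norm q x \<le> (C * C') * s_norm r (\<phi> x)" if x: "x \<in> E" for x
      using C(2)[rule_format, OF x, of "C' * s_norm r (\<phi> x)"] coef_m[OF \<phi>_s[OF x] C'] by (simp add: \<phi>_m)
    then show ?thesis by blast
  qed
  have surj: "\<exists>x\<in>E. \<phi> x = \<xi>" if \<xi>: "\<xi> \<in> F" for \<xi>
  proof -
    have \<xi>s: "\<xi> \<in> s_space" and out: "\<And>i. i \<notin> I \<Longrightarrow> \<xi> i = 0" using \<xi> by (auto simp: F_def)
    have "\<exists>K. \<forall>k. cmod (\<xi> (m k)) * block_norm q k \<le> K" for q
    proof -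
      from dom[of q] obtain r C' where C': "0 < C'" "\<forall>k. block_norm q k \<le> C' * real (Suc (m k)) ^ r"
        by (elim exE conjE)
      show ?thesis using coef_m[OF \<xi>s C'] by blast
    qed
    then obtain x where "x \<in> E" "coef x = (\<lambda>k. \<xi> (m k))" by (rule coef_surj)
    then show ?thesis using \<phi>_eqI[of x \<xi>] out by (intro bexI[of _ x]) auto
  qed
  have inj: "inj_on \<phi> E"
  proof (rule inj_onI)
    fix x y assume "x \<in> E" "y \<in> E" "\<phi> x = \<phi> y"
    moreover from this have "coef x = coef y" using \<phi>_m by (metis ext)
    ultimately show "x = y" by (intro coef_inject)
  qed
  have image: "\<phi> ` E = F" using \<phi>_F surj by (auto simp: image_iff)
  have bij: "bij_betw \<phi> E F" unfolding bij_betw_def using inj image by blast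
  have F_sub: "cvec.subspace F" "F \<subseteq> s_space"
    using clinear_on_image_subspace[OF E_subspace lin] unfolding image by (auto simp: F_def)
  have "homeomorphic_map (subtopology L_top E) (subtopology s_top F) \<phi>"
    unfolding subtopology_E s_subtopology_eq[OF F_sub]
    by (rule homeomorphic_map_of_bounds[OF graded_E s.graded_subspace[OF F_sub] lin bij])
      (use up down in blast)+
  then have iso: "frechet_iso L_top E s_top F \<phi>" using lin by (simp add: frechet_iso_def)
  have mult: "\<phi> (x \<circ> y) = s_mult (\<phi> x) (\<phi> y)" if "x \<in> E" "y \<in> E" for x y
    by (rule \<phi>_eqI) (simp_all add: coef_mult[OF that] s_mult_def \<phi>_m, simp add: \<phi>_def)
  have star: "\<phi> (L_star x) = s_star (\<phi> x)" if "x \<in> E" for x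
    by (rule \<phi>_eqI) (simp_all add: coef_star[OF that] s_star_def \<phi>_m, simp add: \<phi>_def)
  have star_iso: "frechet_star_iso L_top (\<circ>) L_star E s_top s_mult s_star F \<phi>"
    unfolding frechet_star_iso_def using iso mult star by blast
  have "s_mult \<xi> \<eta> \<in> F" if "\<xi> \<in> F" "\<eta> \<in> F" for \<xi> \<eta>
    using surj[OF that(1)] surj[OF that(2)] mult \<phi>_F E_mult by metis
  moreover have "s_star \<xi> \<in> F" if "\<xi> \<in> F" for \<xi>
    using surj[OF that] star \<phi>_F E_star by metis
  ultimately have "closed_star_subalgebra s_top s_mult s_star F"
    unfolding closed_star_subalgebra_def using F_sub(1) closed_coordinate_subspace[of I] by (simp add: F_def)
  with star_iso show ?thesis unfolding F_def by (intro exI[of _ I] exI[of _ \<phi>] conjI)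
qed

text \<open>
  With \<open>\<phi>\<close> as section and the projection followed by the inverse of \<open>\<phi>\<close> as surjection, \<open>E\<close> is a retract
  of \<open>s\<close>.
\<close>

lemma property_Omega_if_complemented_iso:
  assumes F: "complemented_in s_top F" and iso: "frechet_iso L_top E s_top F \<phi>"
  shows "property_Omega E L_norm"
proof -
  obtain \<pi> where \<pi>: "clinear_on s_space \<pi>" "continuous_map s_top s_top \<pi>" "\<forall>\<xi>\<in>s_space. \<pi> (\<pi> \<xi>) = \<pi> \<xi>"
    "\<pi> ` s_space = F"
    using F unfolding complemented_in_def topspace_s_top by blast
  have \<pi>_fix: "\<pi> \<xi> = \<xi>" if "\<xi> \<in> F" for \<xi> using that \<pi>(3,4) by blast
  have F_sub: "cvec.subspace F" "F \<subseteq> s_space"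
    using clinear_on_image_subspace[OF s.subspace \<pi>(1)] continuous_map_image_subset_topspace[OF \<pi>(2)]
    unfolding \<pi>(4) topspace_s_top by auto
  note facts = frechet_isoD[OF F_sub iso]
  define T where "T = (\<lambda>\<xi>. inv_into E \<phi> (\<pi> \<xi>))"
  have \<pi>F: "\<pi> \<xi> \<in> F" if "\<xi> \<in> s_space" for \<xi> using \<pi>(4) that by blast
  have inv_lin: "clinear_on F (inv_into E \<phi>)" by (rule clinear_on_inv_into[OF E_subspace facts(2,1)])
  show ?thesis
  proof (rule property_Omega_if_retract_of_s[OF graded_E, where T = T and S = \<phi>])
    show "clinear_on s_space T"
      using \<pi>(1) inv_lin \<pi>F unfolding clinear_on_def T_def by auto
    show "T \<xi> \<in> E" if "\<xi> \<in> s_space" for \<xi>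
      unfolding T_def using inv_into_into[of "\<pi> \<xi>" \<phi> E] \<pi>F[OF that] facts(1) by (simp add: bij_betw_def)
    show \<phi>s: "\<phi> x \<in> s_space" if "x \<in> E" for x using bij_betwE[OF facts(1)] that F_sub(2) by blast
    show "T (\<phi> x) = x" if "x \<in> E" for x
      unfolding T_def using \<pi>_fix[of "\<phi> x"] bij_betwE[OF facts(1)] that
        inv_into_f_f[OF bij_betw_imp_inj_on[OF facts(1)] that] by simp
    show "\<exists>m C. 0 < C \<and> (\<forall>x\<in>E. s_norm q (\<phi> x) \<le> C * L_norm m x)" for q by (rule facts(3))
    show "\<exists>m C. 0 < C \<and> (\<forall>\<xi>\<in>s_space. L_norm q (T \<xi>) \<le> C * s_norm m \<xi>)" for q
    proof -
      obtain l C where C: "0 < C" "\<forall>y\<in>F. L_norm q (inv_into E \<phi> y) \<le> C * s_norm l y"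
        using facts(4)[of q] by (elim exE conjE)
      from continuous_map_graded_imp_bound[OF graded_s graded_s \<pi>(1) \<pi>(2)[unfolded s_top_def], of l]
      obtain m C' where C': "0 < C'" "\<forall>\<xi>\<in>s_space. s_norm l (\<pi> \<xi>) \<le> C' * s_norm m \<xi>" by (elim exE conjE)
      have "L_norm q (T \<xi>) \<le> (C * C') * s_norm m \<xi>" if \<xi>: "\<xi> \<in> s_space" for \<xi>
      proof -
        have "L_norm q (T \<xi>) \<le> C * s_norm l (\<pi> \<xi>)" unfolding T_def using C(2) \<pi>F[OF \<xi>] by blast
        also have "\<dots> \<le> C * (C' * s_norm m \<xi>)" using C(1) C'(2) \<xi> by (intro mult_left_mono) auto
        finally show ?thesis by simp
      qed
      then show ?thesis using C(1) C'(1) by (intro exI[of _ m] exI[of _ "C * C'"]) auto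
    qed
  qed
qed

lemma coef_in_dual: "(\<lambda>x. coef x k) \<in> top_dual E L_norm"
proof -
  have lin: "clinear_on E (\<lambda>x. coef x k)"
    by (auto simp: clinear_on_def coef_add coef_scaleC scaleC_complex_def)
  have le: "cmod (coef x k) \<le> L_norm 0 x" if "x \<in> E" for x
    using order_trans[OF mult_left_mono[OF block_norm_ge_1[of 0 k], of "cmod (coef x k)"] coef_bound[OF that]] by simp
  have "openin (seminorm_topology E (range L_norm)) {x \<in> E. coef x k \<in> U}" if U: "open U" for U
  proof (rule E.openinI)
    fix x assume x: "x \<in> {x \<in> E. coef x k \<in> U}"
    then obtain e where e: "0 < e" "\<And>z. dist z (coef x k) < e \<Longrightarrow> z \<in> U"
      using U unfolding open_dist by blast
    have "coef y k \<in> U" if "y \<in> E" "L_norm 0 (y - x) < e" for y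
    proof (rule e(2))
      have "coef (y - x) k = coef y k - coef x k"
        using clinear_on_diff[OF E_subspace lin that(1), of x] x by simp
      then show "dist (coef y k) (coef x k) < e"
        using le[OF cvec.subspace_diff[OF E_subspace that(1), of x]] x that(2) by (simp add: dist_norm)
    qed
    then have "{y \<in> E. L_norm 0 (y - x) < e} \<subseteq> {x \<in> E. coef x k \<in> U}" by blast
    then show "\<exists>p\<in>range L_norm. \<exists>e>0. {y \<in> E. p (y - x) < e} \<subseteq> {x \<in> E. coef x k \<in> U}"
      using e(1) by (intro bexI[of _ "L_norm 0"] exI[of _ e] conjI) auto
  qed blast
  then have "continuous_map (seminorm_topology E (range L_norm)) euclidean (\<lambda>x. coef x k)"
    unfolding continuous_map_def E.topspace_eq by simp
  then show ?thesis using lin by (simp add: top_dual_def)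
qed

text \<open>
  The dual norm of the \<open>k\<close>-th coordinate functional lies between \<open>1 / L_norm q (P k)\<close> and
  \<open>1 / block_norm q k\<close>.  For \<open>p = 0\<close> the first factor on the right-hand side of \<open>(\<Omega>)\<close> is at most \<open>1\<close>, and
  the inequality turns into a bound for \<open>block_norm r k powr \<theta>\<close> whose weight does not depend on \<open>r\<close>.
\<close>

lemma polynomial_bound_if_property_Omega:
  assumes "property_Omega E L_norm"
  shows polynomially_bounded_blocks
proof -
  obtain q where q: "\<forall>r. \<exists>\<theta>::real. 0 < \<theta> \<and> \<theta> < 1 \<and> (\<exists>C::real. 0 < C \<and> (\<forall>y\<in>top_dual E L_norm.
      dual_norm E (L_norm q) y \<le> ennreal C * ennreal_powr (dual_norm E (L_norm 0) y) (1 - \<theta>)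
        * ennreal_powr (dual_norm E (L_norm r) y) \<theta>))"
    using assms unfolding property_Omega_def by meson
  define Q where "Q = 16 * Suc q"
  have "\<exists>n C. 0 < C \<and> (\<forall>k. block_norm r k \<le> C * block_norm Q k ^ n)" for r
  proof -
    obtain \<theta> C :: real where \<theta>: "0 < \<theta>" "\<theta> < 1" and C: "0 < C" and
      Om: "\<forall>y\<in>top_dual E L_norm. dual_norm E (L_norm q) y
        \<le> ennreal C * ennreal_powr (dual_norm E (L_norm 0) y) (1 - \<theta>) * ennreal_powr (dual_norm E (L_norm r) y) \<theta>"
      using q[rule_format, of r] by (elim exE conjE)
    have powr_le: "ennreal_powr t a \<le> ennreal (b powr a)" if "t \<le> ennreal b" "0 \<le> b" "0 \<le> a" for t a and b :: real
    proof -
      have "t \<noteq> top" using that(1) by (auto simp: top_unique)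
      then obtain t' where t': "t = ennreal t'" "0 \<le> t'" by (cases t) auto
      then have "t' \<le> b" using that by simp
      then show ?thesis using t' that by (simp add: ennreal_powr_ennreal ennreal_leI powr_mono2)
    qed
    have bound: "block_norm r k powr \<theta> \<le> (12 * C) * block_norm Q k" for k
    proof -
      define y where "y = (\<lambda>x. coef x k)"
      let ?b = "block_norm r k"
      have b1: "1 \<le> ?b" by (rule block_norm_ge_1)
      have y: "y \<in> top_dual E L_norm" unfolding y_def by (rule coef_in_dual)
      then have lin: "clinear_on E y" by (simp add: top_dual_def)
      have d: "dual_norm E (L_norm l) y \<le> ennreal (1 / block_norm l k)" for l
        using coef_bound[of _ k l] block_norm_ge_1[of l k]
        by (intro dual_norm_le) (auto simp: y_def field_simps)
      have "1 / block_norm 0 k \<le> 1" using block_norm_ge_1[of 0 k] by simp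
      then have d0: "dual_norm E (L_norm 0) y \<le> ennreal 1"
        using d[of 0] by (meson ennreal_leI order_trans)
      have "dual_norm E (L_norm q) y
          \<le> ennreal C * ennreal_powr (dual_norm E (L_norm 0) y) (1 - \<theta>) * ennreal_powr (dual_norm E (L_norm r) y) \<theta>"
        using Om y by blast
      also have "\<dots> \<le> ennreal C * ennreal (1 powr (1 - \<theta>)) * ennreal ((1 / ?b) powr \<theta>)"
        using d d0 \<theta> b1 by (intro mult_mono powr_le) auto
      also have "\<dots> = ennreal (C * (1 / ?b) powr \<theta>)" using C by (simp add: ennreal_mult[symmetric])
      finally have le: "dual_norm E (L_norm q) y \<le> ennreal (C * (1 / ?b) powr \<theta>)" .
      obtain D where D: "dual_norm E (L_norm q) y = ennreal D" "0 \<le> D"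
        using le by (cases "dual_norm E (L_norm q) y") (auto simp: top_unique)
      have DC: "D \<le> C * (1 / ?b) powr \<theta>" using le C unfolding D(1) by (subst (asm) ennreal_le_iff) auto
      have "cmod (y (P k)) \<le> D * L_norm q (P k)"
        by (rule dual_norm_bound[OF E_subspace E.grade_seminorm lin D P_in_E])
      then have "1 \<le> D * L_norm q (P k)" by (simp add: y_def coef_P)
      also have "\<dots> \<le> (C * (1 / ?b) powr \<theta>) * (12 * block_norm Q k)"
        unfolding Q_def using DC D(2) C L_norm_nonneg[OF P_in_L] by (intro mult_mono L_norm_P_le) auto
      also have "(1 / ?b) powr \<theta> = 1 / ?b powr \<theta>" using b1 by (simp add: powr_divide)
      finally show ?thesis using b1 by (simp add: field_simps)
    qed
    define n where "n = nat \<lceil>1 / \<theta>\<rceil>"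
    have n: "1 / \<theta> \<le> real n" unfolding n_def by linarith
    have "block_norm r k \<le> (12 * C) powr (1 / \<theta>) * block_norm Q k ^ n" for k
    proof -
      have b1: "1 \<le> block_norm r k" "1 \<le> block_norm Q k" by (rule block_norm_ge_1)+
      have "block_norm r k = (block_norm r k powr \<theta>) powr (1 / \<theta>)" using b1 \<theta> by (simp add: powr_powr)
      also have "\<dots> \<le> ((12 * C) * block_norm Q k) powr (1 / \<theta>)" using \<theta> by (intro powr_mono2 bound) auto
      also have "\<dots> = (12 * C) powr (1 / \<theta>) * block_norm Q k powr (1 / \<theta>)" using C b1 by (intro powr_mult)
      also have "\<dots> \<le> (12 * C) powr (1 / \<theta>) * block_norm Q k powr real n"
        using b1 n by (intro mult_left_mono powr_mono) auto
      also have "block_norm Q k powr real n = block_norm Q k ^ n" using b1 by (intro powr_realpow) auto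
      finally show ?thesis .
    qed
    moreover have "0 < (12 * C) powr (1 / \<theta>)" using C by simp
    ultimately show ?thesis by blast
  qed
  then show ?thesis unfolding polynomially_bounded_blocks_def by blast
qed

end

theorem theorem6p2:
  fixes E :: "cseq_op set" and f :: "nat \<Rightarrow> cseq" and N :: "nat \<Rightarrow> nat set"
  assumes "closed_star_subalgebra L_top (\<circ>) L_star E"
    and "\<forall>x\<in>E. \<forall>y\<in>E. x \<circ> y = y \<circ> x"
    and "infinite_dim E"
    and "\<forall>j. f j \<in> s_space"
    and "orthonormal_seq f"
    and "\<forall>k. finite (N k) \<and> N k \<noteq> {}"
    and "disjoint_family N"
    and "canonical_schauder_basis E (\<lambda>k. span_projection f (N k))"
  shows
    "((\<exists>F \<phi>. closed_star_subalgebra s_top s_mult s_star F \<and>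
             frechet_star_iso L_top (\<circ>) L_star E s_top s_mult s_star F \<phi>)
      \<longleftrightarrow> (\<exists>F \<phi>. complemented_in s_top F \<and> frechet_iso L_top E s_top F \<phi>)) \<and>
     ((\<exists>F \<phi>. complemented_in s_top F \<and> frechet_iso L_top E s_top F \<phi>)
      \<longleftrightarrow> property_Omega E L_norm) \<and>
     (property_Omega E L_norm
      \<longleftrightarrow> (\<exists>p::nat. \<forall>q::nat. \<exists>r::nat. \<exists>C::real. 0 < C \<and>
             (\<forall>k. Max ((\<lambda>j. s_norm q (f j)) ` N k)
                  \<le> C * Max ((\<lambda>j. s_norm p (f j) ^ r) ` N k))))"
    (is "(?i \<longleftrightarrow> ?ii) \<and> (?ii \<longleftrightarrow> ?iii) \<and> (?iii \<longleftrightarrow> ?iv)")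
proof -
  interpret block_diagonal_algebra E f N
    using assms unfolding canonical_schauder_basis_def by unfold_locales auto
  have iv: "?iv \<longleftrightarrow> polynomially_bounded_blocks"
    unfolding polynomially_bounded_blocks_def block_norm_power block_norm_def[symmetric] ..
  have "?i \<Longrightarrow> ?iv"
    unfolding iv using polynomial_bound_if_star_iso by (elim exE conjE)
  moreover have "?iv \<Longrightarrow> ?i \<and> ?ii"
  proof -
    assume ?iv
    then have polynomially_bounded_blocks unfolding iv .
    from coordinate_iso_if_polynomial_bound[OF this] obtain I \<phi> where
      "frechet_star_iso L_top (\<circ>) L_star E s_top s_mult s_star {\<xi> \<in> s_space. \<forall>i. i \<notin> I \<longrightarrow> \<xi> i = 0} \<phi>"
      "closed_star_subalgebra s_top s_mult s_star {\<xi> \<in> s_space. \<forall>i. i \<notin> I \<longrightarrow> \<xi> i = 0}"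
      by (elim exE conjE)
    then show ?thesis
      using complemented_coordinate_subspace[of I] unfolding frechet_star_iso_def by blast
  qed
  moreover have "?ii \<Longrightarrow> ?iii" using property_Omega_if_complemented_iso by (elim exE conjE)
  moreover have "?iii \<Longrightarrow> ?iv" unfolding iv by (rule polynomial_bound_if_property_Omega)
  ultimately show ?thesis by argo
qed

end
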